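(* Let $d\ge 1$ and let $\mathcal K=(\mathcal K(n))_{n\ge1}$ be an open, bounded, circled matrix convex set in $\mathbb C^d$ containing a non-commutative neighborhood of $0$. Let $\Lambda\subset\mathcal F_d$ be a finite initial segment, let $\mathcal U$ be a separable Hilbert space, and let $p=\sum_{w\in\Lambda}p_w w$ with $p_w\in B(\mathcal U)$ for $w\in\Lambda$. There exists a formal power series $\tilde x=\sum_{w\in\mathcal F_d}\tilde x_w w$ with coefficients $\tilde x_w\in B(\mathcal U)$ such that $\tilde x_w=p_w$ for all $w\in\Lambda$ and $$\|\tilde x\|=\sup\{\|p(X)\| : X\in\mathcal K,\ X\text{ is }\Lambda\text{-nilpotent}\}.$$
   Context: $M_{m,n}$ denotes the complex $m\times n$ matrices, $M_n=M_{n,n}$, and $M_n(\mathbb C^d)$ the $d$-tuples $X=(X_1,\dots,X_d)$ with $X_j\in M_n$. A matrix convex set $\mathcal K=(\mathcal K(n))_{n\ge 1}$ is a sequence of sets $\mathcal K(n)\subset M_n(\mathbb C^d)$ such that (i) $X\in\mathcal K(n)$, $Y\in\mathcal K(m)$ imply $X\oplus Y=(X_1\oplus Y_1,\dots,X_d\oplus Y_d)\in\mathcal K(n+m)$; (ii) $X\in\mathcal K(m)$, $\alpha\in M_{m,n}$, $\alpha^*\alpha=I_n$ imply $\alpha^*X\alpha=(\alpha^*X_1\alpha,\dots,\alpha^*X_d\alpha)\in\mathcal K(n)$. $\mathcal K$ is open if each $\mathcal K(n)$ is open; circled if $e^{i\theta}\mathcal K(n)\subseteq\mathcal K(n)$ for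 all $\theta\in\mathbb R$ and all $n$. For $\gamma>0$ let $N_\gamma(n)=\{X\in M_n(\mathbb C^d):\sum_{j}X_jX_j^*<\gamma^2 I\}$; $\mathcal K$ contains a non-commutative neighborhood of $0$ if $N_\gamma(n)\subseteq\mathcal K(n)$ for all $n$ for some $\gamma>0$, and is bounded if $\mathcal K(n)\subseteq N_\Gamma(n)$ for all $n$ for some $\Gamma>0$. Write $X\in\mathcal K$ for $X\in\bigcup_n\mathcal K(n)$. $\mathcal F_d$ is the free semigroup of words in $g_1,\dots,g_d$ with identity the empty word $\emptyset$; $|w|$ is the length of $w$. For $w=g_{i_1}\cdots g_{i_k}$ and a $d$-tuple $X$, $X^w=X_{i_1}\cdots X_{i_k}$ and $X^\emptyset=I$. For a formal power series $f=\sum_{w\in\mathcal F_d}f_w w$ with $f_w\in B(\mathcal U)$, $f(X)=\sum_{j=0}^\infty\sum_{|w|=j}f_w\otimes X^w$, the sum over $j$ converging in operator norm; $\|f\|=\sup\{\|f(X)\|:X\in\mathcal K\}$ (the assertion about $\|\tilde x\|$ includes that $\tilde x(X)$ converges for every $X\in\mathcal K$). A set $\Lambda\subset\mathcal F_d$ is an initial segment if for every $w\in\mathcal F_d\setminus\Lambda$ and $1\le j\le d$ both $g_jw$ and $wg_j$ lie in $\mathcal F_d\setminus\Lambda$. A tuple $X$ is $\Lambda$-nilpotent if $X^v=0$ for all $v\in\mathcal F_d\setminus\Lambda$. *)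

theory Defs
  imports
    "HOL-Analysis.Elementary_Topology"
    "HOL-Analysis.L2_Norm"
    "HOL-Library.FuncSet"
    "HOL-Library.Extended_Nonnegative_Real"
    "Jordan_Normal_Form.Schur_Decomposition"
begin

section \<open>Complex Hilbert spaces and their bounded operators\<close>

class chilbert_space = banach +
  fixes scaleC :: "complex \<Rightarrow> 'a \<Rightarrow> 'a" (infixr "*\<^sub>C" 75)
    and cinner :: "'a \<Rightarrow> 'a \<Rightarrow> complex"
  assumes scaleC_add_right: "a *\<^sub>C (x + y) = a *\<^sub>C x + a *\<^sub>C y"
    and scaleC_add_left: "(a + b) *\<^sub>C x = a *\<^sub>C x + b *\<^sub>C x"
    and scaleC_scaleC: "a *\<^sub>C (b *\<^sub>C x) = (a * b) *\<^sub>C x"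
    and scaleC_one: "1 *\<^sub>C x = x"
    and scaleR_scaleC: "r *\<^sub>R x = complex_of_real r *\<^sub>C x"
    and cinner_commute: "cinner x y = cnj (cinner y x)"
    and cinner_add_left: "cinner (x + y) z = cinner x z + cinner y z"
    and cinner_scaleC_left: "cinner (a *\<^sub>C x) y = a * cinner x y"
    and cinner_self: "cinner x x = complex_of_real ((norm x)\<^sup>2)"

instantiation complex :: chilbert_space
begin
definition scaleC_complex :: "complex \<Rightarrow> complex \<Rightarrow> complex" where "scaleC_complex a x = a * x"
definition cinner_complex :: "complex \<Rightarrow> complex \<Rightarrow> complex" where "cinner_complex x y = x * cnj y"
instance
  by standard
    (auto simp: scaleC_complex_def cinner_complex_def algebra_simps scaleR_conv_of_real
      complex_norm_square[symmetric])
end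

definition bounded_clinear :: "('u::chilbert_space \<Rightarrow> 'u) \<Rightarrow> bool" where
  "bounded_clinear T \<longleftrightarrow> bounded_linear T \<and> (\<forall>c x. T (c *\<^sub>C x) = c *\<^sub>C T x)"

section \<open>The Hilbert space U \<otimes> C^n\<close>

text \<open>The space U \<otimes> C^n is \<^term>\<open>carrier_vec n :: 'u vec set\<close>: the vector h stands for
  the sum of the elementary tensors of the entry h(k) with the k-th unit vector.\<close>

definition tensor_norm :: "'u::real_normed_vector vec \<Rightarrow> real" where
  "tensor_norm h = L2_set (\<lambda>i. norm (h $ i)) {..<dim_vec h}"

definition op_norm :: "nat \<Rightarrow> ('u::real_normed_vector vec \<Rightarrow> 'u vec) \<Rightarrow> ennreal" where
  "op_norm n T = (SUP h \<in> {h \<in> carrier_vec n. tensor_norm h \<le> 1}. ennreal (tensor_norm (T h)))"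

definition bounded_tensor_op :: "nat \<Rightarrow> ('u::chilbert_space vec \<Rightarrow> 'u vec) \<Rightarrow> bool" where
  "bounded_tensor_op n L \<longleftrightarrow>
     L \<in> carrier_vec n \<rightarrow>\<^sub>E carrier_vec n \<and>
     (\<forall>h \<in> carrier_vec n. \<forall>k \<in> carrier_vec n. L (h + k) = L h + L k) \<and>
     (\<forall>c. \<forall>h \<in> carrier_vec n. L (map_vec ((*\<^sub>C) c) h) = map_vec ((*\<^sub>C) c) (L h)) \<and>
     op_norm n L < \<infinity>"

definition tensor_op ::
    "('u::chilbert_space \<Rightarrow> 'u) \<Rightarrow> complex mat \<Rightarrow> 'u vec \<Rightarrow> 'u vec" where
  "tensor_op T A h = vec (dim_row A) (\<lambda>i. \<Sum>k<dim_col A. (A $$ (i, k)) *\<^sub>C T (h $ k))"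

section \<open>Matrix convex sets\<close>

text \<open>The index type \<^typ>\<open>'d\<close> has d elements, so d-tuples are functions on it and the
  free semigroup (with identity) on d generators is \<^typ>\<open>'d list\<close>. In a family K of sets
  only the levels \<^term>\<open>K n\<close> with n positive are ever considered.\<close>

definition mat_tuples :: "nat \<Rightarrow> ('d \<Rightarrow> complex mat) set" where
  "mat_tuples n = {X. \<forall>j. X j \<in> carrier_mat n n}"

definition mat_direct_sum :: "complex mat \<Rightarrow> complex mat \<Rightarrow> complex mat" where
  "mat_direct_sum A B =
     four_block_mat A (0\<^sub>m (dim_row A) (dim_col B)) (0\<^sub>m (dim_row B) (dim_col A)) B"

definition matrix_convex :: "(nat \<Rightarrow> ('d \<Rightarrow> complex mat) set) \<Rightarrow> bool" where
  "matrix_convex K \<longleftrightarrow>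
     (\<forall>n\<ge>1. K n \<subseteq> mat_tuples n) \<and>
     (\<forall>n\<ge>1. \<forall>m\<ge>1. \<forall>X \<in> K n. \<forall>Y \<in> K m. (\<lambda>j. mat_direct_sum (X j) (Y j)) \<in> K (n + m)) \<and>
     (\<forall>m\<ge>1. \<forall>n\<ge>1. \<forall>X \<in> K m. \<forall>\<alpha> \<in> carrier_mat m n.
        mat_adjoint \<alpha> * \<alpha> = 1\<^sub>m n \<longrightarrow> (\<lambda>j. mat_adjoint \<alpha> * X j * \<alpha>) \<in> K n)"

text \<open>Openness of each level, with respect to the sup metric on the entries.\<close>

definition nc_open :: "(nat \<Rightarrow> ('d \<Rightarrow> complex mat) set) \<Rightarrow> bool" where
  "nc_open K \<longleftrightarrow> (\<forall>n\<ge>1. \<forall>X \<in> K n. \<exists>\<epsilon>>0. \<forall>Y \<in> mat_tuples n.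
     (\<forall>j. \<forall>i<n. \<forall>k<n. cmod (Y j $$ (i, k) - X j $$ (i, k)) < \<epsilon>) \<longrightarrow> Y \<in> K n)"

definition circled :: "(nat \<Rightarrow> ('d \<Rightarrow> complex mat) set) \<Rightarrow> bool" where
  "circled K \<longleftrightarrow>
     (\<forall>\<theta>. \<forall>n\<ge>1. \<forall>X \<in> K n. (\<lambda>j. exp (\<i> * complex_of_real \<theta>) \<cdot>\<^sub>m X j) \<in> K n)"

text \<open>The order on \<^typ>\<open>complex\<close> is the partial one: a positive number is in particular
  real, so a positive definite matrix is Hermitian.\<close>

definition pos_definite :: "nat \<Rightarrow> complex mat \<Rightarrow> bool" where
  "pos_definite n A \<longleftrightarrow> A \<in> carrier_mat n n \<and>
     (\<forall>v \<in> carrier_vec n. v \<noteq> 0\<^sub>v n \<longrightarrow> 0 < (A *\<^sub>v v) \<bullet>c v)"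

definition row_gram :: "nat \<Rightarrow> ('d::finite \<Rightarrow> complex mat) \<Rightarrow> complex mat" where
  "row_gram n X = mat n n (\<lambda>(i, k). \<Sum>j\<in>UNIV. (X j * mat_adjoint (X j)) $$ (i, k))"

definition nc_ball :: "real \<Rightarrow> nat \<Rightarrow> ('d::finite \<Rightarrow> complex mat) set" where
  "nc_ball \<gamma> n =
     {X \<in> mat_tuples n. pos_definite n (complex_of_real (\<gamma>\<^sup>2) \<cdot>\<^sub>m 1\<^sub>m n - row_gram n X)}"

definition contains_nc_nbhd_0 :: "(nat \<Rightarrow> ('d::finite \<Rightarrow> complex mat) set) \<Rightarrow> bool" where
  "contains_nc_nbhd_0 K \<longleftrightarrow> (\<exists>\<gamma>>0. \<forall>n\<ge>1. nc_ball \<gamma> n \<subseteq> K n)"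

definition nc_bounded :: "(nat \<Rightarrow> ('d::finite \<Rightarrow> complex mat) set) \<Rightarrow> bool" where
  "nc_bounded K \<longleftrightarrow> (\<exists>\<Gamma>>0. \<forall>n\<ge>1. K n \<subseteq> nc_ball \<Gamma> n)"

section \<open>Words and formal power series\<close>

definition word_mat :: "nat \<Rightarrow> ('d \<Rightarrow> complex mat) \<Rightarrow> 'd list \<Rightarrow> complex mat" where
  "word_mat n X w = foldr (\<lambda>j A. X j * A) w (1\<^sub>m n)"

definition initial_segment :: "'d list set \<Rightarrow> bool" where
  "initial_segment \<Lambda> \<longleftrightarrow> (\<forall>w. w \<notin> \<Lambda> \<longrightarrow> (\<forall>j. j # w \<notin> \<Lambda> \<and> w @ [j] \<notin> \<Lambda>))"

definition nc_nilpotent :: "'d list set \<Rightarrow> nat \<Rightarrow> ('d \<Rightarrow> complex mat) \<Rightarrow> bool" where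
  "nc_nilpotent \<Lambda> n X \<longleftrightarrow> (\<forall>v. v \<notin> \<Lambda> \<longrightarrow> word_mat n X v = 0\<^sub>m n n)"

text \<open>A formal power series is the function giving its coefficients.\<close>

definition nc_partial_sum :: "nat \<Rightarrow> ('d::finite list \<Rightarrow> 'u::chilbert_space \<Rightarrow> 'u) \<Rightarrow>
    ('d \<Rightarrow> complex mat) \<Rightarrow> nat \<Rightarrow> 'u vec \<Rightarrow> 'u vec" where
  "nc_partial_sum n f X N h =
     vec n (\<lambda>i. \<Sum>j<N. \<Sum>w | length w = j. tensor_op (f w) (word_mat n X w) h $ i)"

definition nc_sums :: "nat \<Rightarrow> ('d::finite list \<Rightarrow> 'u::chilbert_space \<Rightarrow> 'u) \<Rightarrow>
    ('d \<Rightarrow> complex mat) \<Rightarrow> ('u vec \<Rightarrow> 'u vec) \<Rightarrow> bool" where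
  "nc_sums n f X L \<longleftrightarrow> bounded_tensor_op n L \<and>
     (\<lambda>N. op_norm n (\<lambda>h. nc_partial_sum n f X N h - L h)) \<longlonglongrightarrow> 0"

definition nc_convergent :: "nat \<Rightarrow> ('d::finite list \<Rightarrow> 'u::chilbert_space \<Rightarrow> 'u) \<Rightarrow>
    ('d \<Rightarrow> complex mat) \<Rightarrow> bool" where
  "nc_convergent n f X \<longleftrightarrow> (\<exists>L. nc_sums n f X L)"

definition nc_eval :: "nat \<Rightarrow> ('d::finite list \<Rightarrow> 'u::chilbert_space \<Rightarrow> 'u) \<Rightarrow>
    ('d \<Rightarrow> complex mat) \<Rightarrow> 'u vec \<Rightarrow> 'u vec" where
  "nc_eval n f X = (THE L. nc_sums n f X L)"

text \<open>The supremum is taken in \<^typ>\<open>ennreal\<close>, where the empty supremum is 0.\<close>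

definition nc_norm :: "(nat \<Rightarrow> ('d::finite \<Rightarrow> complex mat) set) \<Rightarrow>
    ('d list \<Rightarrow> 'u::chilbert_space \<Rightarrow> 'u) \<Rightarrow> ennreal" where
  "nc_norm K f = Sup {op_norm n (nc_eval n f X) | n X. n \<ge> 1 \<and> X \<in> K n}"

definition nc_poly :: "'d list set \<Rightarrow> ('d list \<Rightarrow> 'u::chilbert_space \<Rightarrow> 'u) \<Rightarrow>
    'd list \<Rightarrow> 'u \<Rightarrow> 'u" where
  "nc_poly \<Lambda> p w = (if w \<in> \<Lambda> then p w else (\<lambda>_. 0))"

lemma nc_sums_tendsto_entry:
  assumes L: "nc_sums n f X L" and h: "h \<in> carrier_vec n" "tensor_norm h \<le> 1" and i: "i < n"
  shows "(\<lambda>N. nc_partial_sum n f X N h $ i) \<longlonglongrightarrow> L h $ i"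
proof -
  let ?D = "\<lambda>N h. nc_partial_sum n f X N h - L h"
  have Lh: "L h \<in> carrier_vec n"
    using L h(1) unfolding nc_sums_def bounded_tensor_op_def by blast
  have lim: "(\<lambda>N. op_norm n (?D N)) \<longlonglongrightarrow> 0"
    using L by (simp add: nc_sums_def)
  have le: "ennreal (norm (?D N h $ i)) \<le> op_norm n (?D N)" for N
  proof -
    have "norm (?D N h $ i) \<le> tensor_norm (?D N h)"
      unfolding tensor_norm_def using Lh i by (intro member_le_L2_set) auto
    also have "ennreal (tensor_norm (?D N h)) \<le> op_norm n (?D N)"
      unfolding op_norm_def using h by (intro SUP_upper) auto
    finally show ?thesis by (simp add: ennreal_leI)
  qed
  have "(\<lambda>N. ennreal (norm (?D N h $ i))) \<longlonglongrightarrow> ennreal 0"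
    by (rule tendsto_sandwich[OF _ _ tendsto_const[of "ennreal 0"] lim[folded ennreal_0]])
      (auto simp: le)
  then have "(\<lambda>N. norm (?D N h $ i)) \<longlonglongrightarrow> 0"
    by (subst (asm) tendsto_ennreal_iff) auto
  moreover have "?D N h $ i = nc_partial_sum n f X N h $ i - L h $ i" for N
    using Lh i by auto
  ultimately show ?thesis
    by (simp add: LIM_zero_iff tendsto_norm_zero_iff)
qed

lemma nc_sums_unique:
  assumes L: "nc_sums n f X L" and M: "nc_sums n f X M"
  shows "L = M"
proof
  fix h
  have car: "L k \<in> carrier_vec n" "M k \<in> carrier_vec n" if "k \<in> carrier_vec n" for k
    using L M that unfolding nc_sums_def bounded_tensor_op_def by blast+
  have small: "L k = M k" if "k \<in> carrier_vec n" "tensor_norm k \<le> 1" for k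
    using nc_sums_tendsto_entry[OF L that] nc_sums_tendsto_entry[OF M that] car[OF that(1)]
    by (intro eq_vecI) (auto intro: LIMSEQ_unique)
  show "L h = M h"
  proof (cases "h \<in> carrier_vec n")
    case False
    then show ?thesis using L M
      unfolding nc_sums_def bounded_tensor_op_def by (metis PiE_arb)
  next
    case True
    define c where "c = max 1 (tensor_norm h)"
    have c: "c \<ge> 1" "tensor_norm h \<le> c" by (auto simp: c_def)
    define k where "k = map_vec ((*\<^sub>C) (complex_of_real (1 / c))) h"
    have k: "k \<in> carrier_vec n" using True by (simp add: k_def)
    have "tensor_norm k = L2_set (\<lambda>i. (1 / c) * norm (h $ i)) {..<dim_vec h}"
      unfolding tensor_norm_def using c
      by (intro L2_set_cong) (auto simp: k_def scaleR_scaleC[symmetric] simp del: of_real_divide)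
    also have "\<dots> = (1 / c) * tensor_norm h"
      unfolding tensor_norm_def using c by (intro L2_set_right_distrib[symmetric]) auto
    also have "\<dots> \<le> 1" using c by simp
    finally have eq: "L k = M k" using small k by blast
    have h: "h = map_vec ((*\<^sub>C) (complex_of_real c)) k"
      using c by (intro eq_vecI)
        (auto simp: k_def scaleC_scaleC scaleC_one simp flip: of_real_mult)
    have "L h = map_vec ((*\<^sub>C) (complex_of_real c)) (L k)"
      using L k h unfolding nc_sums_def bounded_tensor_op_def by blast
    moreover have "M h = map_vec ((*\<^sub>C) (complex_of_real c)) (M k)"
      using M k h unfolding nc_sums_def bounded_tensor_op_def by blast
    ultimately show ?thesis using eq by simp
  qed
qed

lemma nc_eval_eq: "nc_sums n f X L \<Longrightarrow> nc_eval n f X = L"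
  unfolding nc_eval_def by (blast intro: nc_sums_unique)

end

theory Submission
  imports Defs "HOL-Library.Function_Algebras"
begin

text \<open>One separation argument replaces the quotient operator algebra of the literature. Let C be the
  supremum over the nilpotent tuples. To each nilpotent X in K (of any order) and tensors h, k
  attach the functional \<open>x \<mapsto> \<langle>x(X) h, k\<rangle>\<close> on the coefficients outside the segment, at the cost
  \<open>C (|h|^2 + |k|^2) / 2 - Re \<langle>p(X) h, k\<rangle>\<close>. Direct sums make these data a cone. If the functional
  vanishes, compressing X to a semi-invariant subspace gives a nilpotent tuple for the segment with
  the same value of \<open>\<langle>p(X) h, k\<rangle>\<close>, so the cost is nonnegative. Hahn--Banach then provides a linear
  functional below the cost, and Riesz representation turns it into the missing coefficients, with
  \<open>|x(X)| \<le> C\<close> on nilpotent tuples. For a general X, the tensor product of X with a finite shift is a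
  nilpotent tuple in K, because K is circled and the shift dilates to a unitary; its Toeplitz
  structure bounds the homogeneous parts of x(X), and the Cesaro means of its partial sums.\<close>

section \<open>Sublinear functionals\<close>

text \<open>The unknown coefficients are operators on a possibly infinite-dimensional space, and no
  topology is put on their dual: a functional is stored through its values at rank-one operators,
  and the algebraic form of Hahn--Banach is enough. Continuity is recovered afterwards. The ball
  inside K contains weighted paths that single out one missing coefficient without touching the
  prescribed ones, so the cost itself bounds each coefficient, and Riesz applies. Admitting
  nilpotent tuples of every order in one cone gives all coefficients at once, with no passage to the
  limit over longer segments. The last obstacle is the constant. Partial sums of a power series need
  not respect the bound of its sum, and the geometric decay that openness of K provides gives
  convergence with a worse constant; averaging over the blocks of the shift restores C itself. If
  the supremum is infinite, nothing has to be extended: the polynomial with zero coefficients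
  outside the segment already attains it.\<close>

definition sublinear :: "('v::real_vector \<Rightarrow> real) \<Rightarrow> bool" where
  "sublinear q \<longleftrightarrow> (\<forall>x y. q (x + y) \<le> q x + q y) \<and> (\<forall>t>0. \<forall>x. q (t *\<^sub>R x) \<le> t * q x)"

lemma sublinear_add: "sublinear q \<Longrightarrow> q (x + y) \<le> q x + q y"
  and sublinear_scale_le: "sublinear q \<Longrightarrow> t > 0 \<Longrightarrow> q (t *\<^sub>R x) \<le> t * q x"
  by (auto simp: sublinear_def)

text \<open>A second application with the factor \<open>1 / t\<close> reverses the inequality. The
  definition asks only for one direction because that is what the infima below deliver
  directly.\<close>

lemma sublinear_scale:
  assumes "sublinear q" "t > 0"
  shows "q (t *\<^sub>R x) = t * q x"
proof -
  have "q ((1/t) *\<^sub>R (t *\<^sub>R x)) \<le> (1/t) * q (t *\<^sub>R x)"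
    using assms by (intro sublinear_scale_le) auto
  then have "t * q x \<le> q (t *\<^sub>R x)"
    using assms(2) by (simp add: field_simps)
  with sublinear_scale_le[OF assms, of x] show ?thesis by simp
qed

lemma sublinear_zero: "sublinear q \<Longrightarrow> q 0 = 0"
  using sublinear_scale[of q 2 0] by simp

lemma sublinear_minus: "sublinear q \<Longrightarrow> - q (- x) \<le> q x"
  using sublinear_add[of q x "- x"] sublinear_zero[of q] by simp

text \<open>The witness is the pointwise infimum. It is finite because every member satisfies
  \<open>- q (- x) \<le> - f (- x) \<le> f x\<close>. Comparability is what makes it subadditive: of
  two members \<open>f\<close> and \<open>g\<close>, the smaller one bounds the infimum at
  \<open>x + y\<close> by \<open>f x + g y\<close>.\<close>

lemma sublinear_chain_bound:
  fixes q :: "'v::real_vector \<Rightarrow> real"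
  assumes q: "sublinear q"
    and C: "\<And>f. f \<in> C \<Longrightarrow> sublinear f \<and> (\<forall>x. f x \<le> q x)"
    and chain: "\<And>f g. f \<in> C \<Longrightarrow> g \<in> C \<Longrightarrow> (\<forall>x. f x \<le> g x) \<or> (\<forall>x. g x \<le> f x)"
  shows "\<exists>u. sublinear u \<and> (\<forall>x. u x \<le> q x) \<and> (\<forall>f\<in>C. \<forall>x. u x \<le> f x)"
proof (cases "C = {}")
  case True
  then show ?thesis using q by auto
next
  case False
  define u where "u x = (INF f\<in>C. f x)" for x
  have bdd: "bdd_below ((\<lambda>f. f x) ` C)" for x
  proof (rule bdd_belowI2)
    fix f assume "f \<in> C"
    then show "- q (- x) \<le> f x"
      using C[of f] sublinear_minus[of f x] by (meson dual_order.trans neg_le_iff_le)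
  qed
  have le: "u x \<le> f x" if "f \<in> C" for f x
    unfolding u_def using bdd that by (rule cINF_lower)
  have ge: "b \<le> u x" if "\<And>f. f \<in> C \<Longrightarrow> b \<le> f x" for b x
    unfolding u_def using False that by (rule cINF_greatest)
  have "u (x + y) \<le> u x + u y" for x y
  proof -
    have "u (x + y) \<le> f x + g y" if "f \<in> C" "g \<in> C" for f g
      using chain[OF that]
    proof
      assume "\<forall>x. f x \<le> g x"
      then show ?thesis
        using le[OF that(1), of "x + y"] C[OF that(1)] sublinear_add[of f x y] by (smt (verit))
    next
      assume "\<forall>x. g x \<le> f x"
      then show ?thesis
        using le[OF that(2), of "x + y"] C[OF that(2)] sublinear_add[of g x y] by (smt (verit))
    qed
    then have "u (x + y) - f x \<le> u y" if "f \<in> C" for f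
      using that by (intro ge) (metis add.commute diff_le_eq)
    then have "u (x + y) - u y \<le> u x"
      by (intro ge) (simp add: diff_le_eq add.commute)
    then show ?thesis by simp
  qed
  moreover have "u (t *\<^sub>R x) \<le> t * u x" if "t > 0" for t x
  proof -
    have "u (t *\<^sub>R x) / t \<le> u x"
    proof (rule ge)
      fix f assume "f \<in> C"
      then have "u (t *\<^sub>R x) \<le> t * f x"
        using le[of f "t *\<^sub>R x"] C[of f] sublinear_scale[of f t x] that by simp
      then show "u (t *\<^sub>R x) / t \<le> f x" using that by (simp add: field_simps)
    qed
    then show ?thesis using that by (simp add: field_simps)
  qed
  moreover have "u x \<le> q x" for x
    using False le C by (meson all_not_in_conv order_trans)
  ultimately show ?thesis
    using le unfolding sublinear_def by blast
qed

text \<open>The infimum of \<open>m (x + t *\<^sub>R y) - t * m y\<close> over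
  \<open>t \<ge> 0\<close> is again sublinear and lies below \<open>m\<close> (take
  \<open>t = 0\<close>), so by minimality it equals \<open>m\<close>; the value \<open>t = 1\<close>
  then gives the claim. It is the usual modification in the proof of Hahn--Banach that forces
  linearity in the direction \<open>y\<close>.\<close>

lemma minimal_sublinear_superadditive:
  fixes m :: "'v::real_vector \<Rightarrow> real"
  assumes m: "sublinear m"
    and minimal: "\<And>p. sublinear p \<Longrightarrow> (\<And>x. p x \<le> m x) \<Longrightarrow> p = m"
  shows "m x + m y \<le> m (x + y)"
proof -
  define p where "p x = (INF t\<in>{0..}. m (x + t *\<^sub>R y) - t * m y)" for x
  have bdd: "bdd_below ((\<lambda>t. m (x + t *\<^sub>R y) - t * m y) ` {0..})" for x
  proof (rule bdd_belowI2)
    fix t :: real assume "t \<in> {0..}"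
    then have "m (t *\<^sub>R y) = t * m y"
      using sublinear_scale[OF m, of t y] sublinear_zero[OF m] by (cases "t = 0") auto
    then show "- m (- x) \<le> m (x + t *\<^sub>R y) - t * m y"
      using sublinear_add[OF m, of "x + t *\<^sub>R y" "- x"] by simp
  qed
  have le: "p x \<le> m (x + t *\<^sub>R y) - t * m y" if "t \<ge> 0" for x t
    unfolding p_def using bdd that by (intro cINF_lower) auto
  have ge: "b \<le> p x" if "\<And>t. t \<ge> 0 \<Longrightarrow> b \<le> m (x + t *\<^sub>R y) - t * m y" for b x
    unfolding p_def using that by (intro cINF_greatest) auto
  have "p (x + z) \<le> p x + p z" for x z
  proof -
    have "p (x + z) \<le> (m (x + t *\<^sub>R y) - t * m y) + (m (z + s *\<^sub>R y) - s * m y)"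
      if "t \<ge> 0" "s \<ge> 0" for t s
    proof -
      have "p (x + z) \<le> m (x + z + (t + s) *\<^sub>R y) - (t + s) * m y"
        using that by (intro le) simp
      also have "x + z + (t + s) *\<^sub>R y = (x + t *\<^sub>R y) + (z + s *\<^sub>R y)"
        by (simp add: algebra_simps)
      also have "m \<dots> \<le> m (x + t *\<^sub>R y) + m (z + s *\<^sub>R y)"
        by (rule sublinear_add[OF m])
      finally show ?thesis by (simp add: algebra_simps)
    qed
    then have "p (x + z) - (m (x + t *\<^sub>R y) - t * m y) \<le> p z" if "t \<ge> 0" for t
      using that by (intro ge) (smt (verit))
    then have "p (x + z) - p z \<le> p x"
      by (intro ge) (smt (verit))
    then show ?thesis by simp
  qed
  moreover have "p (r *\<^sub>R x) \<le> r * p x" if "r > 0" for r x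
  proof -
    have "p (r *\<^sub>R x) / r \<le> p x"
    proof (rule ge)
      fix t :: real assume "t \<ge> 0"
      then have "p (r *\<^sub>R x) \<le> m (r *\<^sub>R x + (r * t) *\<^sub>R y) - (r * t) * m y"
        using that by (intro le) simp
      also have "r *\<^sub>R x + (r * t) *\<^sub>R y = r *\<^sub>R (x + t *\<^sub>R y)"
        by (simp add: algebra_simps)
      also have "m \<dots> = r * m (x + t *\<^sub>R y)"
        by (rule sublinear_scale[OF m that])
      finally show "p (r *\<^sub>R x) / r \<le> m (x + t *\<^sub>R y) - t * m y"
        using that by (simp add: field_simps)
    qed
    then show ?thesis using that by (simp add: field_simps)
  qed
  ultimately have "sublinear p" by (simp add: sublinear_def)
  moreover have "p x \<le> m x" for x using le[of 0 x] by simp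
  ultimately have "p = m" by (rule minimal)
  then show ?thesis using le[of 1 x] by simp
qed

theorem sublinear_dominates_linear:
  fixes q :: "'v::real_vector \<Rightarrow> real"
  assumes q: "sublinear q"
  shows "\<exists>f. linear f \<and> (\<forall>x. f x \<le> q x)"
proof -
  let ?A = "{f. sublinear f \<and> (\<forall>x. f x \<le> q x)}"
  \<comment> \<open>The order is reversed, so the maximal element that Zorn's lemma provides is a
    pointwise minimal functional.\<close>
  let ?P = "\<lambda>f g :: 'v \<Rightarrow> real. \<forall>x. g x \<le> f x"
  have "\<exists>m\<in>?A. \<forall>a\<in>?A. ?P m a \<longrightarrow> a = m"
  proof (rule predicate_Zorn)
    show "partial_order_on ?A (relation_of ?P ?A)"
      by (rule partial_order_on_relation_ofI) (auto intro: order_trans simp: fun_eq_iff intro!: antisym)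
    fix C assume "C \<in> Chains (relation_of ?P ?A)"
    then have "f \<in> ?A" "g \<in> ?A" "?P f g \<or> ?P g f" if "f \<in> C" "g \<in> C" for f g
      using that unfolding Chains_def relation_of_def by blast+
    then show "\<exists>u\<in>?A. \<forall>a\<in>C. ?P a u"
      using sublinear_chain_bound[OF q, of C] by blast
  qed
  then obtain m where m: "sublinear m" "\<And>x. m x \<le> q x"
    and minimal: "\<And>p. p \<in> ?A \<Longrightarrow> ?P m p \<Longrightarrow> p = m"
    by blast
  have "p = m" if "sublinear p" "\<And>x. p x \<le> m x" for p
  proof -
    have "p \<in> ?A" using that m(2) order_trans by blast
    then show ?thesis using that(2) minimal by blast
  qed
  then have add: "m (x + y) = m x + m y" for x y
    using minimal_sublinear_superadditive[OF m(1), of x y] sublinear_add[OF m(1), of x y]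
    by fastforce
  have minus: "m (- x) = - m x" for x
    using add[of x "- x"] sublinear_zero[OF m(1)] by simp
  have "m (t *\<^sub>R x) = t * m x" for t x
  proof -
    consider "t > 0" | "t = 0" | "t < 0" by linarith
    then show ?thesis
    proof cases
      case 3
      then show ?thesis using sublinear_scale[OF m(1), of "- t" x] minus[of "t *\<^sub>R x"] by simp
    qed (auto simp: sublinear_scale[OF m(1)] sublinear_zero[OF m(1)])
  qed
  with add have "linear m" by (auto intro: linearI)
  with m(2) show ?thesis by blast
qed

section \<open>Separation for a cone of test data\<close>

lemma linear_below_cone_cost:
  fixes T :: "'a \<Rightarrow> 'v::real_vector" and c :: "'a \<Rightarrow> real"
  assumes ne: "D \<noteq> {}"
    and add: "\<And>x y. x \<in> D \<Longrightarrow> y \<in> D \<Longrightarrow> \<exists>z\<in>D. T z = T x + T y \<and> c z \<le> c x + c y"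
    and scale: "\<And>t x. t > 0 \<Longrightarrow> x \<in> D \<Longrightarrow> \<exists>z\<in>D. T z = t *\<^sub>R T x \<and> c z \<le> t * c x"
    and neg: "\<And>x. x \<in> D \<Longrightarrow> \<exists>z\<in>D. T z = - T x"
    and zero: "\<And>x. x \<in> D \<Longrightarrow> T x = 0 \<Longrightarrow> 0 \<le> c x"
  shows "\<exists>f. linear f \<and> (\<forall>x\<in>D. f (T x) \<le> c x)"
proof -
  define W where "W = T ` D"
  have Wadd: "v + w \<in> W" if "v \<in> W" "w \<in> W" for v w
    using that add unfolding W_def by (metis (no_types, lifting) imageE image_eqI)
  have Wneg: "- v \<in> W" if "v \<in> W" for v
    using that neg unfolding W_def by (metis (no_types, lifting) imageE image_eqI)
  have W0: "0 \<in> W"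
    using ne Wadd Wneg unfolding W_def by (metis add.right_inverse all_not_in_conv image_eqI)
  have Wpos: "t *\<^sub>R v \<in> W" if "t > 0" "v \<in> W" for t v
    using that scale unfolding W_def by (metis (no_types, lifting) imageE image_eqI)
  have Wscale: "t *\<^sub>R v \<in> W" if "v \<in> W" for t v
  proof -
    consider "t > 0" | "t = 0" | "t < 0" by linarith
    then show ?thesis
      using Wpos[of t v] Wpos[of "- t" "- v"] Wneg[OF that] W0 that by cases auto
  qed
  have "module.subspace scaleR W"
    using W0 Wadd Wscale
    by (simp add: module.subspace_def[OF real_vector.module_axioms])
  \<comment> \<open>A left inverse of the identity on \<open>W\<close> is a linear projection onto
    \<open>W\<close>. Composed with it, the least cost becomes sublinear on the whole space, which
    is the form that Hahn--Banach was proved in.\<close>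
  from linear_exists_left_inverse_on[OF linear_id this[folded subspace_raw_def]]
  obtain g :: "'v \<Rightarrow> 'v" where g: "range g \<subseteq> W" "linear g" "\<And>v. v \<in> W \<Longrightarrow> g v = v"
    by auto
  define q where "q w = (INF x\<in>{x\<in>D. T x = w}. c x)" for w
  have bdd: "bdd_below (c ` {x\<in>D. T x = w})" if "w \<in> W" for w
  proof -
    obtain y where y: "y \<in> D" "T y = - w" using Wneg[OF \<open>w \<in> W\<close>] unfolding W_def by force
    show ?thesis
    proof (rule bdd_belowI2)
      fix x assume "x \<in> {x\<in>D. T x = w}"
      then have x: "x \<in> D" "T x = w" by auto
      from add[OF x(1) y(1)] obtain z where "z \<in> D" "T z = 0" "c z \<le> c x + c y"
        using x y by auto
      with zero[of z] show "- c y \<le> c x" by simp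
    qed
  qed
  have le: "q (T x) \<le> c x" if "x \<in> D" for x
    unfolding q_def using that by (intro cINF_lower bdd) (auto simp: W_def)
  have ge: "b \<le> q w" if "w \<in> W" "\<And>x. x \<in> D \<Longrightarrow> T x = w \<Longrightarrow> b \<le> c x" for b w
    unfolding q_def using that by (intro cINF_greatest) (auto simp: W_def)
  have qadd: "q (v + w) \<le> q v + q w" if vw: "v \<in> W" "w \<in> W" for v w
  proof -
    have "q (v + w) \<le> c x + c y" if "x \<in> D" "T x = v" "y \<in> D" "T y = w" for x y
      using add[OF that(1,3)] le that by fastforce
    then have "q (v + w) - c x \<le> q w" if "x \<in> D" "T x = v" for x
      using that vw by (intro ge) (auto simp: diff_le_eq add.commute[of _ "c x"])
    then have "q (v + w) - q w \<le> q v"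
      using vw by (intro ge) (auto simp: diff_le_eq add.commute[of _ "q w"])
    then show ?thesis by simp
  qed
  have qscale: "q (t *\<^sub>R w) \<le> t * q w" if "w \<in> W" "t > 0" for t w
  proof -
    have "q (t *\<^sub>R w) / t \<le> q w"
    proof (rule ge[OF that(1)])
      fix x assume "x \<in> D" "T x = w"
      then show "q (t *\<^sub>R w) / t \<le> c x"
        using scale[OF that(2), of x] le that(2) by (fastforce simp: field_simps)
    qed
    then show ?thesis using that(2) by (simp add: field_simps)
  qed
  have gW: "g v \<in> W" for v using g(1) by blast
  have "sublinear (q \<circ> g)"
    unfolding sublinear_def
    using g(2) qadd qscale gW by (auto simp: linear_add linear_scale)
  from sublinear_dominates_linear[OF this]
  obtain f where f: "linear f" "\<And>v. f v \<le> q (g v)" by auto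
  have "f (T x) \<le> c x" if "x \<in> D" for x
    using f(2)[of "T x"] g(3)[of "T x"] le[OF that] that by (auto simp: W_def)
  with f(1) show ?thesis by blast
qed

text \<open>Test functionals will be functions of a word and two vectors. Pointwise scalars make
  them elements of one real vector space, which is all that the algebraic separation needs.\<close>

instantiation "fun" :: (type, real_vector) real_vector
begin
definition scaleR_fun :: "real \<Rightarrow> ('a \<Rightarrow> 'b) \<Rightarrow> 'a \<Rightarrow> 'b" where "scaleR_fun r f = (\<lambda>x. r *\<^sub>R f x)"
instance
  by standard (auto simp: scaleR_fun_def fun_eq_iff algebra_simps)
end

section \<open>Complex Hilbert spaces\<close>

lemma cinner_add_right: "cinner x (y + z) = cinner x y + cinner x z"
  for x :: "'u::chilbert_space"
  by (metis cinner_add_left cinner_commute complex_cnj_add)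

lemma cinner_scaleC_right: "cinner x (a *\<^sub>C y) = cnj a * cinner x y"
  for x :: "'u::chilbert_space"
  by (metis cinner_commute cinner_scaleC_left complex_cnj_mult)

lemma scaleC_zero_left [simp]: "0 *\<^sub>C x = 0" for x :: "'u::chilbert_space"
  using scaleC_add_left[of 0 0 x] by simp

lemma scaleC_zero_right [simp]: "a *\<^sub>C 0 = 0" for a :: complex
  using scaleC_add_right[of a 0 "0::'u::chilbert_space"] by simp

lemma cinner_zero_left [simp]: "cinner 0 x = 0" for x :: "'u::chilbert_space"
  using cinner_add_left[of 0 0 x] by simp

lemma cinner_zero_right [simp]: "cinner x 0 = 0" for x :: "'u::chilbert_space"
  using cinner_add_right[of x 0 0] by simp

lemma cinner_minus_left: "cinner (- x) y = - cinner x y" for x :: "'u::chilbert_space"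
  using cinner_add_left[of x "- x" y] by (simp add: eq_neg_iff_add_eq_0 add.commute)

lemma cinner_minus_right: "cinner x (- y) = - cinner x y" for x :: "'u::chilbert_space"
  using cinner_add_right[of x y "- y"] by (simp add: eq_neg_iff_add_eq_0 add.commute)

lemma cinner_diff_left: "cinner (x - y) z = cinner x z - cinner y z" for x :: "'u::chilbert_space"
  using cinner_add_left[of x "- y" z] by (simp add: cinner_minus_left)

lemma scaleC_sum_right: "a *\<^sub>C sum f A = (\<Sum>i\<in>A. a *\<^sub>C f i)"
  for f :: "'i \<Rightarrow> 'u::chilbert_space"
  by (induction A rule: infinite_finite_induct) (auto simp: scaleC_add_right)

lemma scaleC_sum_left: "sum f A *\<^sub>C x = (\<Sum>i\<in>A. f i *\<^sub>C x)" for x :: "'u::chilbert_space"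
  by (induction A rule: infinite_finite_induct) (auto simp: scaleC_add_left)

lemma cinner_sum_left: "cinner (sum f A) x = (\<Sum>i\<in>A. cinner (f i) x)"
  for x :: "'u::chilbert_space"
  by (induction A rule: infinite_finite_induct) (auto simp: cinner_add_left)

lemma cinner_sum_right: "cinner x (sum f A) = (\<Sum>i\<in>A. cinner x (f i))"
  for x :: "'u::chilbert_space"
  by (induction A rule: infinite_finite_induct) (auto simp: cinner_add_right)

lemma cinner_eqI: "(\<And>a. cinner x a = cinner y a) \<Longrightarrow> x = y" for x :: "'u::chilbert_space"
  using cinner_self[of "x - y"] by (simp add: cinner_diff_left)

lemma norm_scaleC: "norm (a *\<^sub>C x) = cmod a * norm x" for x :: "'u::chilbert_space"
proof -
  have "complex_of_real ((norm (a *\<^sub>C x))\<^sup>2) = a * cnj a * cinner x x"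
    by (simp only: cinner_self[symmetric] cinner_scaleC_left cinner_scaleC_right mult.assoc
        mult.left_commute)
  also have "\<dots> = complex_of_real ((cmod a * norm x)\<^sup>2)"
    by (simp only: complex_norm_square[symmetric] cinner_self of_real_mult[symmetric] power_mult_distrib)
  finally have "complex_of_real ((norm (a *\<^sub>C x))\<^sup>2) = complex_of_real ((cmod a * norm x)\<^sup>2)" .
  then have "(norm (a *\<^sub>C x))\<^sup>2 = (cmod a * norm x)\<^sup>2"
    using of_real_eq_iff by blast
  then show ?thesis by (simp add: power2_eq_iff_nonneg)
qed

lemma Re_cinner_self: "Re (cinner x x) = (norm x)\<^sup>2" for x :: "'u::chilbert_space"
  by (simp add: cinner_self)

lemma norm_add_square:
  "(norm (x + y))\<^sup>2 = (norm x)\<^sup>2 + 2 * Re (cinner x y) + (norm y)\<^sup>2" for x :: "'u::chilbert_space"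
proof -
  have "Re (cinner y x) = Re (cinner x y)"
    by (subst cinner_commute) simp
  then show ?thesis
    unfolding Re_cinner_self[symmetric] by (simp add: cinner_add_left cinner_add_right)
qed

text \<open>Cauchy--Schwarz read off from the triangle inequality, which the class already provides
  for the norm.\<close>

lemma Re_cinner_le: "\<bar>Re (cinner x y)\<bar> \<le> norm x * norm y" for x :: "'u::chilbert_space"
proof -
  have "(norm (x + y))\<^sup>2 \<le> (norm x + norm y)\<^sup>2"
    by (intro power_mono norm_triangle_ineq) auto
  moreover have "(norm (x - y))\<^sup>2 \<le> (norm x + norm y)\<^sup>2"
    by (intro power_mono norm_triangle_ineq4) auto
  then have "(norm (x + - y))\<^sup>2 \<le> (norm x + norm y)\<^sup>2" by simp
  ultimately show ?thesis
    unfolding norm_add_square by (simp add: cinner_minus_right power2_sum abs_le_iff)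
qed

text \<open>Completeness enters through the minimising sequence of the energy
  \<open>\<lambda>y. (norm y)\<^sup>2 - 2 * g y\<close>, which is Cauchy by the parallelogram law.\<close>

lemma real_riesz_representation:
  fixes g :: "'u::chilbert_space \<Rightarrow> real"
  assumes g: "bounded_linear g"
  shows "\<exists>y. \<forall>b. g b = Re (cinner y b)"
proof -
  interpret g: bounded_linear g by fact
  define J where "J y = (norm y)\<^sup>2 - 2 * g y" for y
  obtain M where M: "\<And>x. norm (g x) \<le> norm x * M" using g.bounded by blast
  have "- M\<^sup>2 \<le> J y" for y
  proof -
    have "g y \<le> norm y * M" using M[of y] by simp
    moreover have "0 \<le> (norm y - M)\<^sup>2" by simp
    ultimately show ?thesis by (simp add: J_def power2_diff)
  qed
  then have bdd: "bdd_below (range J)" by (intro bdd_belowI2[of _ "- M\<^sup>2"]) auto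
  define m where "m = (INF y. J y)"
  have m_le: "m \<le> J y" for y unfolding m_def by (intro cINF_lower bdd) auto
  have par: "(norm (y - z))\<^sup>2 \<le> 2 * J y + 2 * J z - 4 * m" for y z
  proof -
    have "(norm (y - z))\<^sup>2 = 2 * (norm y)\<^sup>2 + 2 * (norm z)\<^sup>2 - (norm (y + z))\<^sup>2"
      using norm_add_square[of y z] norm_add_square[of y "- z"] by (simp add: cinner_minus_right)
    also have "(norm (y + z))\<^sup>2 = 4 * (norm ((1/2) *\<^sub>R (y + z)))\<^sup>2"
      by (simp add: power2_eq_square)
    also have "2 * (norm y)\<^sup>2 + 2 * (norm z)\<^sup>2 - 4 * (norm ((1/2) *\<^sub>R (y + z)))\<^sup>2
        = 2 * J y + 2 * J z - 4 * J ((1/2) *\<^sub>R (y + z))"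
      by (simp add: J_def g.scaleR g.add field_simps)
    finally show ?thesis using m_le[of "(1/2) *\<^sub>R (y + z)"] by simp
  qed
  have "\<exists>y. J y < m + 1 / real (Suc n)" for n
    using cInf_lessD[of "range J" "m + 1 / real (Suc n)"] by (auto simp: m_def)
  then obtain y where y: "\<And>n. J (y n) < m + 1 / real (Suc n)" by metis
  have "Cauchy y"
    unfolding Cauchy_altdef2
  proof (intro allI impI)
    fix e :: real assume e: "e > 0"
    obtain N where N: "1 / real (Suc N) < e\<^sup>2 / 4"
      using nat_approx_posE[of "e\<^sup>2 / 4"] e by auto
    have "dist (y n) (y N) < e" if "n \<ge> N" for n
    proof -
      have "1 / real (Suc n) \<le> 1 / real (Suc N)"
        using that by (intro divide_left_mono) auto
      with par[of "y n" "y N"] y[of n] y[of N] N have "(norm (y n - y N))\<^sup>2 < e\<^sup>2"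
        by linarith
      then show ?thesis using e by (simp add: dist_norm power2_less_imp_less)
    qed
    then show "\<exists>N. \<forall>n\<ge>N. dist (y n) (y N) < e" by blast
  qed
  then obtain l where l: "y \<longlonglongrightarrow> l"
    using Cauchy_convergent convergent_def by blast
  have "(\<lambda>n. J (y n)) \<longlonglongrightarrow> J l"
    unfolding J_def by (intro tendsto_intros l g.tendsto)
  moreover have "(\<lambda>n. m + 1 / real (Suc n)) \<longlonglongrightarrow> m + 0"
    by (intro tendsto_intros LIMSEQ_Suc lim_1_over_n)
  ultimately have Jl: "J l \<le> m"
    using y by (intro LIMSEQ_le[of "\<lambda>n. J (y n)" _ "\<lambda>n. m + 1 / real (Suc n)"])
      (auto intro: less_imp_le)
  have "g b = Re (cinner l b)" for b
  proof -
    define c where "c = Re (cinner l b) - g b"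
    \<comment> \<open>First variation at the minimiser: moving from \<open>l\<close> by
      \<open>t\<close> times \<open>b\<close> changes the energy by this quadratic in
      \<open>t\<close>. It is nonnegative for every \<open>t\<close>, so its linear coefficient
      \<open>c\<close> must vanish.\<close>
    have quad: "0 \<le> 2 * t * c + t\<^sup>2 * (norm b)\<^sup>2" for t
    proof -
      have "g (complex_of_real t *\<^sub>C b) = t * g b"
        using g.scaleR[of t b] by (simp add: scaleR_scaleC)
      moreover have "J l \<le> J (l + t *\<^sub>R b)" using Jl m_le order_trans by blast
      ultimately show ?thesis
        by (simp add: J_def c_def norm_add_square g.add scaleR_scaleC[of t b]
            cinner_scaleC_right norm_scaleC power_mult_distrib algebra_simps)
    qed
    have "c = 0"
    proof (cases "norm b = 0")
      case True
      then show ?thesis using quad[of "- c"] by (simp flip: power2_eq_square)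
    next
      case False
      have "0 \<le> - c\<^sup>2 / (norm b)\<^sup>2"
        using quad[of "- c / (norm b)\<^sup>2"] False
        by (simp add: power2_eq_square field_simps)
      then show ?thesis using False by (simp add: field_simps)
    qed
    then show ?thesis by (simp add: c_def)
  qed
  then show ?thesis by blast
qed

section \<open>Matrices acting on tensor vectors\<close>

definition vinner :: "'u::chilbert_space vec \<Rightarrow> 'u vec \<Rightarrow> complex" where
  "vinner h k = (\<Sum>i<dim_vec h. cinner (h $ i) (k $ i))"

text \<open>The identity of U tensored with \<open>A\<close>. For complex entries it is the ordinary
  matrix action, so one set of lemmas serves tensors and their slices alike.\<close>

definition mact :: "complex mat \<Rightarrow> 'u::chilbert_space vec \<Rightarrow> 'u vec" where
  "mact A h = vec (dim_row A) (\<lambda>i. \<Sum>k<dim_col A. (A $$ (i, k)) *\<^sub>C h $ k)"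

text \<open>Contraction of the factor U against \<open>a\<close>, landing in C^n. A tensor is
  determined by its slices, so subspaces only ever have to be formed in the finite-dimensional
  C^n.\<close>

definition slice :: "'u::chilbert_space \<Rightarrow> 'u vec \<Rightarrow> complex vec" where
  "slice a h = map_vec (\<lambda>x. cinner x a) h"

definition vscale :: "complex \<Rightarrow> 'u::chilbert_space vec \<Rightarrow> 'u vec" where
  "vscale c = map_vec ((*\<^sub>C) c)"

lemma dim_mact [simp]: "dim_vec (mact A h) = dim_row A"
  and dim_slice [simp]: "dim_vec (slice a h) = dim_vec h"
  and dim_vscale [simp]: "dim_vec (vscale c h) = dim_vec h"
  and index_slice [simp]: "i < dim_vec h \<Longrightarrow> slice a h $ i = cinner (h $ i) a"
  and index_vscale [simp]: "i < dim_vec h \<Longrightarrow> vscale c h $ i = c *\<^sub>C h $ i"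
  by (auto simp: mact_def slice_def vscale_def)

lemma index_mact:
  "i < dim_row A \<Longrightarrow> mact A h $ i = (\<Sum>k<dim_col A. (A $$ (i, k)) *\<^sub>C h $ k)"
  by (simp add: mact_def)

lemma mact_carrier [simp]: "A \<in> carrier_mat n m \<Longrightarrow> mact A h \<in> carrier_vec n"
  and slice_carrier [simp]: "h \<in> carrier_vec n \<Longrightarrow> slice a h \<in> carrier_vec n"
  and vscale_carrier [simp]: "h \<in> carrier_vec n \<Longrightarrow> vscale c h \<in> carrier_vec n"
  by (intro carrier_vecI, simp)+

lemma slice_eqI:
  assumes "dim_vec h = dim_vec k" "\<And>a. slice a h = slice a k"
  shows "h = k"
proof (rule eq_vecI)
  fix i assume "i < dim_vec k"
  then have "cinner (h $ i) a = cinner (k $ i) a" for a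
    using assms(1) arg_cong[OF assms(2)[of a], of "\<lambda>v. v $ i"] by simp
  then show "h $ i = k $ i" by (rule cinner_eqI)
qed (use assms in simp)

lemma slice_mact: "dim_vec h = dim_col A \<Longrightarrow> slice a (mact A h) = mact A (slice a h)"
  by (intro eq_vecI)
    (auto simp: index_mact cinner_sum_left cinner_scaleC_left scaleC_complex_def)

lemma mact_add:
  "h \<in> carrier_vec (dim_col A) \<Longrightarrow> k \<in> carrier_vec (dim_col A) \<Longrightarrow> mact A (h + k) = mact A h + mact A k"
  by (intro eq_vecI) (auto simp: index_mact scaleC_add_right sum.distrib)

lemma mact_vscale:
  "h \<in> carrier_vec (dim_col A) \<Longrightarrow> mact A (vscale c h) = vscale c (mact A h)"
  by (intro eq_vecI) (auto simp: index_mact scaleC_sum_right scaleC_scaleC mult.commute)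

lemma mact_one: "h \<in> carrier_vec n \<Longrightarrow> mact (1\<^sub>m n) h = h"
  by (intro eq_vecI) (auto simp: index_mact if_distrib[of "\<lambda>c. c *\<^sub>C _"] scaleC_one cong: if_cong)

lemma mact_zero_mat: "mact (0\<^sub>m m n) h = 0\<^sub>v m"
  by (intro eq_vecI) (auto simp: index_mact)

lemma mact_mult:
  assumes "A \<in> carrier_mat n m" "B \<in> carrier_mat m l"
  shows "mact (A * B) h = mact A (mact B h)"
proof (rule eq_vecI)
  fix i assume "i < dim_vec (mact A (mact B h))"
  then have i: "i < n" using assms by simp
  have "mact (A * B) h $ i = (\<Sum>k<l. (\<Sum>j<m. A $$ (i, j) * B $$ (j, k)) *\<^sub>C h $ k)"
    using assms i by (simp add: index_mact scalar_prod_def lessThan_atLeast0)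
  also have "\<dots> = (\<Sum>j<m. \<Sum>k<l. (A $$ (i, j) * B $$ (j, k)) *\<^sub>C h $ k)"
    by (simp add: scaleC_sum_left) (rule sum.swap)
  also have "\<dots> = mact A (mact B h) $ i"
    using assms i by (simp add: index_mact scaleC_sum_right scaleC_scaleC)
  finally show "mact (A * B) h $ i = mact A (mact B h) $ i" .
qed (use assms in simp)

lemma mat_adjoint_carrier [simp]: "A \<in> carrier_mat n m \<Longrightarrow> mat_adjoint A \<in> carrier_mat m n"
  by (auto simp: mat_adjoint_def mat_of_rows_def)

lemma dim_mat_adjoint [simp]:
  "dim_row (mat_adjoint A) = dim_col A" "dim_col (mat_adjoint A) = dim_row A"
  by (auto simp: mat_adjoint_def mat_of_rows_def)

lemma index_mat_adjoint:
  "i < dim_col A \<Longrightarrow> j < dim_row A \<Longrightarrow> mat_adjoint A $$ (i, j) = cnj (A $$ (j, i))"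
  for A :: "complex mat"
  by (simp add: mat_adjoint_def mat_of_rows_index)

lemma vinner_mact_adjoint:
  assumes "A \<in> carrier_mat n m" "h \<in> carrier_vec m" "k \<in> carrier_vec n"
  shows "vinner (mact A h) k = vinner h (mact (mat_adjoint A) k)"
proof -
  have "vinner (mact A h) k = (\<Sum>i<n. \<Sum>j<m. cinner (A $$ (i, j) *\<^sub>C h $ j) (k $ i))"
    using assms by (simp add: vinner_def index_mact cinner_sum_left)
  also have "\<dots> = (\<Sum>j<m. \<Sum>i<n. cinner (A $$ (i, j) *\<^sub>C h $ j) (k $ i))"
    by (rule sum.swap)
  also have "\<dots> = vinner h (mact (mat_adjoint A) k)"
    using assms mat_adjoint_carrier[OF assms(1)]
    by (auto simp: vinner_def index_mact cinner_sum_right index_mat_adjoint cinner_scaleC_left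
        cinner_scaleC_right intro!: sum.cong)
  finally show ?thesis .
qed

lemma tensor_norm_nonneg [simp]: "0 \<le> tensor_norm h"
  by (simp add: tensor_norm_def L2_set_nonneg)

lemma tensor_norm_square: "(tensor_norm h)\<^sup>2 = (\<Sum>i<dim_vec h. (norm (h $ i))\<^sup>2)"
  unfolding tensor_norm_def L2_set_def by (simp add: sum_nonneg)

lemma vinner_self: "vinner h h = complex_of_real ((tensor_norm h)\<^sup>2)"
  by (simp add: vinner_def tensor_norm_square cinner_self)

lemma tensor_norm_eq_0_iff: "tensor_norm h = 0 \<longleftrightarrow> h = 0\<^sub>v (dim_vec h)"
  unfolding tensor_norm_def by (auto simp: L2_set_eq_0_iff vec_eq_iff)

lemma vinner_commute: "dim_vec h = dim_vec k \<Longrightarrow> vinner h k = cnj (vinner k h)"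
  by (simp add: vinner_def) (metis cinner_commute)

lemma vinner_add_left:
  "h \<in> carrier_vec n \<Longrightarrow> k \<in> carrier_vec n \<Longrightarrow> vinner (h + k) l = vinner h l + vinner k l"
  by (simp add: vinner_def cinner_add_left sum.distrib)

lemma vinner_vscale_left: "vinner (vscale c h) k = c * vinner h k"
  by (simp add: vinner_def cinner_scaleC_left sum_distrib_left)

lemma vinner_vscale_right: "dim_vec h = dim_vec k \<Longrightarrow> vinner h (vscale c k) = cnj c * vinner h k"
  by (simp add: vinner_def cinner_scaleC_right sum_distrib_left)

lemma vinner_zero_left [simp]: "vinner (0\<^sub>v n) k = 0"
  by (simp add: vinner_def)

lemma vinner_zero_right [simp]: "dim_vec h = n \<Longrightarrow> vinner h (0\<^sub>v n) = 0"
  by (simp add: vinner_def)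

lemma tensor_norm_vscale: "tensor_norm (vscale c h) = cmod c * tensor_norm h"
proof -
  have "(tensor_norm (vscale c h))\<^sup>2 = (cmod c * tensor_norm h)\<^sup>2"
    by (simp add: tensor_norm_square power_mult_distrib norm_scaleC sum_distrib_left)
  then show ?thesis by (simp add: power2_eq_iff_nonneg)
qed

lemma Re_vinner_le:
  assumes "dim_vec h = dim_vec k"
  shows "\<bar>Re (vinner h k)\<bar> \<le> tensor_norm h * tensor_norm k"
proof -
  have "\<bar>Re (vinner h k)\<bar> \<le> (\<Sum>i<dim_vec h. \<bar>Re (cinner (h $ i) (k $ i))\<bar>)"
    by (simp add: vinner_def)
  also have "\<dots> \<le> (\<Sum>i<dim_vec h. \<bar>norm (h $ i)\<bar> * \<bar>norm (k $ i)\<bar>)"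
    by (intro sum_mono) (simp add: Re_cinner_le)
  also have "\<dots> \<le> tensor_norm h * tensor_norm k"
    unfolding tensor_norm_def using assms L2_set_mult_ineq[of "\<lambda>i. norm (h $ i)" "\<lambda>i. norm (k $ i)"]
    by simp
  finally show ?thesis .
qed

section \<open>Isometries and orthonormal families\<close>

lemma tensor_norm_isometry:
  assumes "\<alpha> \<in> carrier_mat n m" "mat_adjoint \<alpha> * \<alpha> = 1\<^sub>m m" "h \<in> carrier_vec m"
  shows "tensor_norm (mact \<alpha> h) = tensor_norm h"
proof -
  have "vinner (mact \<alpha> h) (mact \<alpha> h) = vinner h (mact (mat_adjoint \<alpha>) (mact \<alpha> h))"
    using assms by (intro vinner_mact_adjoint) auto
  also have "mact (mat_adjoint \<alpha>) (mact \<alpha> h) = h"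
    using assms mact_mult[OF mat_adjoint_carrier[OF assms(1)] assms(1), of h] by (simp add: mact_one)
  finally have "(tensor_norm (mact \<alpha> h))\<^sup>2 = (tensor_norm h)\<^sup>2"
    unfolding vinner_self of_real_eq_iff .
  then show ?thesis by (simp add: power2_eq_iff_nonneg)
qed

text \<open>Writing g for the image of \<open>h\<close>, the squared norm of g pairs
  \<open>mact \<alpha> g\<close> with \<open>h\<close>; Cauchy--Schwarz and the isometry property
  leave one factor g to cancel.\<close>

lemma tensor_norm_coisometry_le:
  assumes "\<alpha> \<in> carrier_mat n m" "mat_adjoint \<alpha> * \<alpha> = 1\<^sub>m m" "h \<in> carrier_vec n"
  shows "tensor_norm (mact (mat_adjoint \<alpha>) h) \<le> tensor_norm h"
proof -
  let ?g = "mact (mat_adjoint \<alpha>) h"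
  have g: "?g \<in> carrier_vec m" using assms by (intro mact_carrier[OF mat_adjoint_carrier])
  have "(tensor_norm ?g)\<^sup>2 = Re (vinner ?g ?g)" by (simp add: vinner_self)
  also have "\<dots> = Re (vinner (mact \<alpha> ?g) h)"
    using assms g by (simp add: vinner_mact_adjoint[of \<alpha> n m])
  also have "\<dots> \<le> tensor_norm (mact \<alpha> ?g) * tensor_norm h"
    using Re_vinner_le[of "mact \<alpha> ?g" h] assms by simp
  also have "tensor_norm (mact \<alpha> ?g) = tensor_norm ?g"
    using assms g by (intro tensor_norm_isometry)
  finally have "tensor_norm ?g * tensor_norm ?g \<le> tensor_norm ?g * tensor_norm h"
    by (simp add: power2_eq_square)
  then show ?thesis
    using tensor_norm_nonneg[of ?g] tensor_norm_nonneg[of h]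
    by (cases "tensor_norm ?g = 0") (auto simp: mult_le_cancel_left)
qed

lemma orthonormal_isometry:
  fixes b :: "nat \<Rightarrow> complex vec"
  assumes b: "\<And>i. i < m \<Longrightarrow> b i \<in> carrier_vec n"
    and on: "\<And>i j. i < m \<Longrightarrow> j < m \<Longrightarrow> vinner (b i) (b j) = (if i = j then 1 else 0)"
    and \<alpha>: "\<alpha> = mat n m (\<lambda>(r, i). b i $ r)"
  shows "\<alpha> \<in> carrier_mat n m" "mat_adjoint \<alpha> * \<alpha> = 1\<^sub>m m"
proof -
  show car: "\<alpha> \<in> carrier_mat n m" by (simp add: \<alpha>)
  show "mat_adjoint \<alpha> * \<alpha> = 1\<^sub>m m"
  proof (rule eq_matI)
    fix i j assume ij: "i < dim_row (1\<^sub>m m :: complex mat)" "j < dim_col (1\<^sub>m m :: complex mat)"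
    then have "(mat_adjoint \<alpha> * \<alpha>) $$ (i, j) = (\<Sum>r<n. cnj (b i $ r) * b j $ r)"
      using car mat_adjoint_carrier[OF car]
      by (auto simp: scalar_prod_def index_mat_adjoint lessThan_atLeast0 \<alpha> intro!: sum.cong)
    also have "\<dots> = vinner (b j) (b i)"
      using b[of j] ij by (simp add: vinner_def cinner_complex_def mult.commute)
    finally show "(mat_adjoint \<alpha> * \<alpha>) $$ (i, j) = 1\<^sub>m m $$ (i, j)"
      using on[of j i] ij by auto
  qed (use car mat_adjoint_carrier[OF car] in auto)
qed

text \<open>Double counting of the squared entries of the isometry formed by the family: its
  \<open>m\<close> columns have norm one, and its \<open>n\<close> rows have norm at most
  one.\<close>

lemma orthonormal_length_le:
  fixes b :: "nat \<Rightarrow> complex vec"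
  assumes b: "\<And>i. i < m \<Longrightarrow> b i \<in> carrier_vec n"
    and on: "\<And>i j. i < m \<Longrightarrow> j < m \<Longrightarrow> vinner (b i) (b j) = (if i = j then 1 else 0)"
  shows "m \<le> n"
proof -
  define \<alpha> where "\<alpha> = mat n m (\<lambda>(r, i). b i $ r)"
  note iso = orthonormal_isometry[OF b on \<alpha>_def]
  have row: "(\<Sum>i<m. (cmod (b i $ r))\<^sup>2) \<le> 1" if r: "r < n" for r
  proof -
    have "(tensor_norm (mact (mat_adjoint \<alpha>) (unit_vec n r :: complex vec)))\<^sup>2
        \<le> (tensor_norm (unit_vec n r :: complex vec))\<^sup>2"
      using iso by (intro power_mono tensor_norm_coisometry_le) auto
    also have "\<dots> = 1"
      using r by (simp add: tensor_norm_square if_distrib[of "\<lambda>x. (cmod x)\<^sup>2"] cong: if_cong)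
    also have "(tensor_norm (mact (mat_adjoint \<alpha>) (unit_vec n r :: complex vec)))\<^sup>2
        = (\<Sum>i<m. (cmod (b i $ r))\<^sup>2)"
      using r iso(1) mat_adjoint_carrier[OF iso(1)]
      by (simp add: tensor_norm_square index_mact index_mat_adjoint scaleC_complex_def \<alpha>_def
          if_distrib[of "\<lambda>x. _ * x"] cong: if_cong)
    finally show ?thesis .
  qed
  have "real m = (\<Sum>i<m. Re (vinner (b i) (b i)))"
    using on by simp
  also have "\<dots> = (\<Sum>i<m. \<Sum>r<n. (cmod (b i $ r))\<^sup>2)"
    using carrier_vecD[OF b] by (auto simp: vinner_self tensor_norm_square intro!: sum.cong)
  also have "\<dots> = (\<Sum>r<n. \<Sum>i<m. (cmod (b i $ r))\<^sup>2)" by (rule sum.swap)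
  also have "\<dots> \<le> (\<Sum>r<n. 1)" by (intro sum_mono row) auto
  finally show ?thesis by simp
qed

text \<open>A maximal orthonormal family in S spans S; it exists because Bessel's inequality for the unit
  vectors bounds the length of such families.\<close>

lemma subspace_isometry:
  fixes S :: "complex vec set"
  assumes S: "S \<subseteq> carrier_vec n" and S0: "0\<^sub>v n \<in> S"
    and add: "\<And>v w. v \<in> S \<Longrightarrow> w \<in> S \<Longrightarrow> v + w \<in> S"
    and scale: "\<And>c v. v \<in> S \<Longrightarrow> vscale c v \<in> S"
  obtains m \<alpha> where "\<alpha> \<in> carrier_mat n m" "mat_adjoint \<alpha> * \<alpha> = 1\<^sub>m m"
    "\<And>v. v \<in> carrier_vec m \<Longrightarrow> mact \<alpha> v \<in> S"
    "\<And>v. v \<in> S \<Longrightarrow> mact \<alpha> (mact (mat_adjoint \<alpha>) v) = v"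
proof -
  let ?Q = "\<lambda>m::nat. \<exists>b. (\<forall>i<m. b i \<in> S) \<and>
    (\<forall>i<m. \<forall>j<m. vinner (b i) (b j) = (if i = j then 1 else (0::complex)))"
  have bound: "m \<le> n" if "?Q m" for m
    using that S orthonormal_length_le[of m _ n] by blast
  have "?Q 0" by simp
  then obtain m where m: "?Q m" and max: "\<And>m'. ?Q m' \<Longrightarrow> m' \<le> m"
    using GreatestI_nat[of ?Q 0 n] Greatest_le_nat[of ?Q _ n] bound by blast
  from m obtain b where b: "\<And>i. i < m \<Longrightarrow> b i \<in> S"
    and on: "\<And>i j. i < m \<Longrightarrow> j < m \<Longrightarrow> vinner (b i) (b j) = (if i = j then 1 else 0)"
    by blast
  define \<alpha> where "\<alpha> = mat n m (\<lambda>(r, i). b i $ r)"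
  have bc: "b i \<in> carrier_vec n" if "i < m" for i using b[OF that] S by blast
  note iso = orthonormal_isometry[OF bc on \<alpha>_def]
  have img: "mact \<alpha> v \<in> S" if v: "v \<in> carrier_vec m" for v
  proof -
    have "vec n (\<lambda>r. \<Sum>i<l. v $ i * b i $ r) \<in> S" if "l \<le> m" for l
      using that
    proof (induction l)
      case 0
      then show ?case using S0 by (simp add: zero_vec_def)
    next
      case (Suc l)
      have "vec n (\<lambda>r. \<Sum>i<l. v $ i * b i $ r) + vscale (v $ l) (b l) \<in> S"
        using Suc b by (intro add scale) auto
      also have "vec n (\<lambda>r. \<Sum>i<l. v $ i * b i $ r) + vscale (v $ l) (b l)
          = vec n (\<lambda>r. \<Sum>i<Suc l. v $ i * b i $ r)"
        using bc[of l] Suc.prems by (intro eq_vecI) (auto simp: scaleC_complex_def)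
      finally show ?case .
    qed
    also have "vec n (\<lambda>r. \<Sum>i<m. v $ i * b i $ r) = mact \<alpha> v"
      by (intro eq_vecI) (auto simp: index_mact \<alpha>_def scaleC_complex_def mult.commute)
    finally show ?thesis by simp
  qed
  have "mact \<alpha> (mact (mat_adjoint \<alpha>) v) = v" if v: "v \<in> S" for v
  proof -
    have vc: "v \<in> carrier_vec n" using v S by blast
    define p where "p = mact \<alpha> (mact (mat_adjoint \<alpha>) v)"
    \<comment> \<open>The part of \<open>v\<close> orthogonal to the family. If it were nonzero, its
      normalisation would prolong a family of maximal length.\<close>
    define w where "w = v + vscale (- 1) p"
    have adj: "mact (mat_adjoint \<alpha>) v \<in> carrier_vec m"
      by (rule mact_carrier[OF mat_adjoint_carrier[OF iso(1)]])
    have pc: "p \<in> carrier_vec n" using iso(1) by (auto simp: p_def)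
    have "p \<in> S" unfolding p_def by (rule img[OF adj])
    then have wS: "w \<in> S" unfolding w_def by (intro add scale v)
    have wc: "w \<in> carrier_vec n" using wS S by blast
    have "mact (mat_adjoint \<alpha>) p = mact (mat_adjoint \<alpha>) v"
      unfolding p_def using mact_mult[OF mat_adjoint_carrier[OF iso(1)] iso(1)] iso(2) adj
      by (metis mact_one)
    then have "mact (mat_adjoint \<alpha>) w = 0\<^sub>v m"
      using vc pc carrier_matD[OF iso(1)] unfolding w_def
      by (subst mact_add) (auto simp: mact_vscale scaleC_complex_def intro!: eq_vecI)
    then have orth: "vinner (b i) w = 0" if i: "i < m" for i
    proof -
      have "b i = mact \<alpha> (unit_vec m i)"
        using i bc[OF i] by (intro eq_vecI)
          (auto simp: index_mact \<alpha>_def scaleC_complex_def if_distrib[of "\<lambda>x. _ * x"] cong: if_cong)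
      then have "vinner (b i) w = vinner (unit_vec m i) (mact (mat_adjoint \<alpha>) w)"
        using wc iso(1) vinner_mact_adjoint[of \<alpha> n m "unit_vec m i" w] by simp
      then show ?thesis using \<open>mact (mat_adjoint \<alpha>) w = 0\<^sub>v m\<close> by simp
    qed
    have "w = 0\<^sub>v n"
    proof (rule ccontr)
      assume "w \<noteq> 0\<^sub>v n"
      then have pos: "tensor_norm w > 0"
        using wc tensor_norm_eq_0_iff[of w] tensor_norm_nonneg[of w] by (auto simp: less_le)
      define u where "u = vscale (complex_of_real (1 / tensor_norm w)) w"
      have u: "u \<in> S" unfolding u_def using wS scale by blast
      have uu: "vinner u u = 1"
        using pos by (simp add: u_def vinner_self tensor_norm_vscale norm_divide)
      have bu: "vinner (b i) u = 0" if "i < m" for i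
        using orth[OF that] bc[OF that] wc by (simp add: u_def vinner_vscale_right)
      have ub: "vinner u (b i) = 0" if "i < m" for i
        using bu[OF that] bc[OF that] wc vinner_commute[of u "b i"] by (simp add: u_def)
      have "?Q (Suc m)"
        using b on u uu bu ub
        by (intro exI[of _ "b(m := u)"]) (auto simp: less_Suc_eq)
      then have "Suc m \<le> m" by (rule max)
      then show False by simp
    qed
    then have w0: "w $ i = 0" if "i < n" for i using that by simp
    show ?thesis
      unfolding p_def[symmetric]
    proof (rule eq_vecI)
      fix i assume "i < dim_vec v"
      then show "p $ i = v $ i"
        using w0[of i] vc pc by (simp add: w_def scaleC_complex_def)
    qed (use vc pc in simp)
  qed
  with iso img that show thesis by blast
qed

section \<open>Compression to nilpotent tuples\<close>

lemma bounded_clinear_add: "bounded_clinear T \<Longrightarrow> T (x + y) = T x + T y"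
  and bounded_clinear_scaleC: "bounded_clinear T \<Longrightarrow> T (c *\<^sub>C x) = c *\<^sub>C T x"
  by (auto simp: bounded_clinear_def bounded_linear_def linear_add)

lemma bounded_clinear_zero: "bounded_clinear T \<Longrightarrow> T 0 = 0"
  using bounded_clinear_scaleC[of T 0 0] by simp

lemma bounded_clinear_sum: "bounded_clinear T \<Longrightarrow> T (sum f A) = (\<Sum>i\<in>A. T (f i))"
  by (induction A rule: infinite_finite_induct)
    (auto simp: bounded_clinear_add bounded_clinear_zero)

text \<open>The tensor product factors into the matrix action followed by \<open>T\<close> on each
  entry. The two factors commute, which later lets the coefficients pass through projections of
  C^n.\<close>

lemma tensor_op_eq:
  assumes "bounded_clinear T"
  shows "tensor_op T A h = map_vec T (mact A h)"
  by (intro eq_vecI)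
    (auto simp: tensor_op_def index_mact bounded_clinear_sum[OF assms]
      bounded_clinear_scaleC[OF assms])

lemma mact_map_vec:
  assumes "bounded_clinear T" "dim_vec h = dim_col A"
  shows "mact A (map_vec T h) = map_vec T (mact A h)"
  using assms by (intro eq_vecI)
    (auto simp: index_mact bounded_clinear_sum bounded_clinear_scaleC)

lemma mact_diff:
  "h \<in> carrier_vec (dim_col A) \<Longrightarrow> k \<in> carrier_vec (dim_col A) \<Longrightarrow> mact A (h - k) = mact A h - mact A k"
proof (intro eq_vecI, goal_cases)
  case (1 i)
  have "a *\<^sub>C (x - y) = a *\<^sub>C x - a *\<^sub>C y" for a and x y :: 'a
    using scaleC_add_right[of a "x - y" y] by (simp add: algebra_simps)
  with 1 show ?case by (simp add: index_mact sum_subtractf)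
qed auto

lemma slice_diff: "dim_vec h = dim_vec k \<Longrightarrow> slice a (h - k) = slice a h - slice a k"
  by (intro eq_vecI) (auto simp: cinner_diff_left)

lemma mact_eq_0_imp:
  assumes "A \<in> carrier_mat n m" "\<And>z :: complex vec. z \<in> carrier_vec m \<Longrightarrow> mact A z = 0\<^sub>v n"
  shows "A = 0\<^sub>m n m"
proof (rule eq_matI)
  fix i j assume ij: "i < dim_row (0\<^sub>m n m :: complex mat)" "j < dim_col (0\<^sub>m n m :: complex mat)"
  then have "mact A (unit_vec m j :: complex vec) $ i = A $$ (i, j)"
    using assms(1) by (simp add: index_mact scaleC_complex_def if_distrib[of "\<lambda>x. _ * x"] cong: if_cong)
  with assms(2)[of "unit_vec m j"] ij show "A $$ (i, j) = 0\<^sub>m n m $$ (i, j)" by simp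
qed (use assms in auto)

lemma isometry_adjoint_cancel:
  assumes "\<alpha> \<in> carrier_mat n m" "mat_adjoint \<alpha> * \<alpha> = 1\<^sub>m m" "h \<in> carrier_vec m"
  shows "mact (mat_adjoint \<alpha>) (mact \<alpha> h) = h"
  using mact_mult[OF mat_adjoint_carrier[OF assms(1)] assms(1), of h] assms by (simp add: mact_one)

lemma word_mat_Nil [simp]: "word_mat n X [] = 1\<^sub>m n"
  and word_mat_Cons [simp]: "word_mat n X (j # w) = X j * word_mat n X w"
  by (auto simp: word_mat_def)

lemma word_mat_carrier [simp]: "X \<in> mat_tuples n \<Longrightarrow> word_mat n X w \<in> carrier_mat n n"
  by (induction w) (auto simp: mat_tuples_def intro!: mult_carrier_mat)

lemma mat_tuplesD: "X \<in> mat_tuples n \<Longrightarrow> X j \<in> carrier_mat n n"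
  by (simp add: mat_tuples_def)

lemma word_mat_append:
  "X \<in> mat_tuples n \<Longrightarrow> word_mat n X (v @ w) = word_mat n X v * word_mat n X w"
proof (induction v)
  case Nil
  then show ?case by (simp add: left_mult_one_mat[OF word_mat_carrier])
next
  case (Cons j v)
  then show ?case
    using assoc_mult_mat[OF mat_tuplesD[of X n j] word_mat_carrier[of X n v] word_mat_carrier[of X n w]] by simp
qed

lemma mact_word_append:
  assumes "X \<in> mat_tuples n"
  shows "mact (word_mat n X (v @ w)) h = mact (word_mat n X v) (mact (word_mat n X w) h)"
  using assms by (simp add: word_mat_append mact_mult[of _ n n _ n])

text \<open>The words outside the segment form a two-sided ideal of the free semigroup. Nilpotency
  of the compression rests on both sides: extension on the right makes M invariant, extension on the
  left sends M into N.\<close>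

lemma initial_segment_append:
  assumes "initial_segment \<Lambda>" "w \<notin> \<Lambda>"
  shows "u @ w \<notin> \<Lambda>" "w @ u \<notin> \<Lambda>"
proof -
  show "u @ w \<notin> \<Lambda>" using assms by (induction u) (auto simp: initial_segment_def)
  show "w @ u \<notin> \<Lambda>"
    using assms by (induction u rule: rev_induct) (auto simp: initial_segment_def simp flip: append_assoc)
qed

text \<open>For linear coefficients this is the sum of the operators \<open>f w\<close> tensored
  with the word matrices, applied to \<open>h\<close>. The polynomial, the homogeneous parts and the
  partial sums of a series are all instances of it, for different \<open>S\<close>.\<close>

definition wsum :: "nat \<Rightarrow> ('d list \<Rightarrow> 'u::chilbert_space \<Rightarrow> 'u) \<Rightarrow> ('d \<Rightarrow> complex mat) \<Rightarrow>
    'd list set \<Rightarrow> 'u vec \<Rightarrow> 'u vec" where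
  "wsum n f X S h = vec n (\<lambda>i. \<Sum>w\<in>S. f w (mact (word_mat n X w) h $ i))"

lemma wsum_carrier [simp]: "wsum n f X S h \<in> carrier_vec n"
  by (simp add: wsum_def)

lemma dim_wsum [simp]: "dim_vec (wsum n f X S h) = n"
  by (simp add: wsum_def)

lemma vinner_wsum:
  assumes "X \<in> mat_tuples n"
  shows "vinner (wsum n f X S h) k = (\<Sum>w\<in>S. vinner (map_vec (f w) (mact (word_mat n X w) h)) k)"
proof -
  have [simp]: "dim_row (word_mat n X w) = n" for w
    using word_mat_carrier[OF assms] by blast
  show ?thesis
    by (simp add: vinner_def wsum_def cinner_sum_left sum.swap[of _ "{..<n}"])
qed

text \<open>The compression of X to the semi-invariant subspace \<open>M \<ominus> N\<close>, where N is the largest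
  invariant subspace orthogonal to the slices of k, and M the subspace that all words outside
  the segment map into N.\<close>

lemma compress_to_nilpotent:
  fixes K :: "nat \<Rightarrow> ('d \<Rightarrow> complex mat) set" and h k :: "'u::chilbert_space vec"
  assumes K: "matrix_convex K" and seg: "initial_segment \<Lambda>"
    and p: "\<And>w. w \<in> \<Lambda> \<Longrightarrow> bounded_clinear (p w)"
    and n: "n \<ge> 1" and X: "X \<in> K n" and h: "h \<in> carrier_vec n" and k: "k \<in> carrier_vec n"
    and zero: "\<And>v a b. v \<notin> \<Lambda> \<Longrightarrow> vinner (mact (word_mat n X v) (slice a h)) (slice b k) = 0"
  obtains m Y h' k' where "m \<ge> 1 \<longrightarrow> Y \<in> K m" "nc_nilpotent \<Lambda> m Y"
    "h' \<in> carrier_vec m" "k' \<in> carrier_vec m"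
    "tensor_norm h' \<le> tensor_norm h" "tensor_norm k' \<le> tensor_norm k"
    "vinner (wsum n p X \<Lambda> h) k = vinner (wsum m p Y \<Lambda> h') k'"
proof -
  let ?W = "word_mat n X"
  have XT: "X \<in> mat_tuples n" using K n X by (auto simp: matrix_convex_def)
  note Xc = mat_tuplesD[OF XT]
  note Wc = word_mat_carrier[OF XT]
  note Xd = carrier_matD[OF Xc]
  note Wd = carrier_matD[OF Wc]
  define N where "N = {v \<in> carrier_vec n. \<forall>u b. vinner (mact (?W u) v) (slice b k) = 0}"
  define M where "M = {v \<in> carrier_vec n. \<forall>u b. u \<notin> \<Lambda> \<longrightarrow> vinner (mact (?W u) v) (slice b k) = 0}"
  have Nc: "N \<subseteq> carrier_vec n" and Mc: "M \<subseteq> carrier_vec n" and NM: "N \<subseteq> M"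
    by (auto simp: N_def M_def)
  have lin: "vinner (mact (?W u) (v + w)) l = vinner (mact (?W u) v) l + vinner (mact (?W u) w) l"
    "vinner (mact (?W u) (vscale c v)) l = c * vinner (mact (?W u) v) l"
    if "v \<in> carrier_vec n" "w \<in> carrier_vec n" for u v w c and l :: "complex vec"
    using that
    by (simp_all add: mact_add mact_vscale Wd vinner_add_left[OF mact_carrier[OF Wc] mact_carrier[OF Wc]]
        vinner_vscale_left)
  have N0: "0\<^sub>v n \<in> N"
  proof -
    have "mact (?W u) (0\<^sub>v n :: complex vec) = 0\<^sub>v n" for u
      by (intro eq_vecI) (auto simp: index_mact Wd)
    then show ?thesis by (simp add: N_def)
  qed
  have Nadd: "v + w \<in> N" if "v \<in> N" "w \<in> N" for v w
    using that by (auto simp: N_def lin)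
  have Nsc: "vscale c v \<in> N" if "v \<in> N" for v c
    using that by (auto simp: N_def lin(2)[OF _ zero_carrier_vec])
  have Madd: "v + w \<in> M" if "v \<in> M" "w \<in> M" for v w
    using that by (auto simp: M_def lin)
  have Msc: "vscale c v \<in> M" if "v \<in> M" for v c
    using that by (auto simp: M_def lin(2)[OF _ zero_carrier_vec])
  have word_X: "mact (?W u) (mact (X j) v) = mact (?W (u @ [j])) v" for u j and v :: "complex vec"
    using Xc by (simp add: mact_word_append[OF XT] mact_mult[OF Xc one_carrier_mat] right_mult_one_mat[of _ n n])
  have NX: "mact (X j) v \<in> N" if "v \<in> N" for v j
    using that mact_carrier[OF Xc] by (auto simp: N_def word_X)
  have MX: "mact (X j) v \<in> M" if "v \<in> M" for v j
    using that seg mact_carrier[OF Xc] by (auto simp: M_def word_X initial_segment_def)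
  have MW: "mact (?W w) v \<in> M" if "v \<in> M" for v w
  proof (induction w)
    case (Cons j w)
    then show ?case using MX by (simp add: mact_mult[OF Xc Wc])
  qed (use that Mc in \<open>auto simp: mact_one\<close>)
  \<comment> \<open>Membership in \<open>N\<close> tests all words \<open>u'\<close>; here each test
    becomes one of \<open>u' @ u\<close>, which stays outside the segment together with
    \<open>u\<close>.\<close>
  have MN: "mact (?W u) v \<in> N" if "v \<in> M" "u \<notin> \<Lambda>" for u v
    using that mact_carrier[OF Wc] initial_segment_append(1)[OF seg]
    by (auto simp: N_def M_def mact_word_append[OF XT, symmetric])
  \<comment> \<open>The only use of the vanishing of the functional: it says exactly that the slices
    of \<open>h\<close> lie in \<open>M\<close>.\<close>
  have hM: "slice a h \<in> M" for a
    using h zero by (auto simp: M_def)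
  from subspace_isometry[OF Nc N0 Nadd Nsc]
  obtain l \<beta> where \<beta>: "\<beta> \<in> carrier_mat n l" "mat_adjoint \<beta> * \<beta> = 1\<^sub>m l"
    and \<beta>N: "\<And>v. v \<in> carrier_vec l \<Longrightarrow> mact \<beta> v \<in> N"
    and \<beta>\<beta>: "\<And>v. v \<in> N \<Longrightarrow> mact \<beta> (mact (mat_adjoint \<beta>) v) = v"
    by metis
  note \<beta>c = mat_adjoint_carrier[OF \<beta>(1)]
  note \<beta>d = carrier_matD[OF \<beta>(1)]
  define S where "S = {v \<in> M. mact (mat_adjoint \<beta>) v = 0\<^sub>v l}"
  have Sc: "S \<subseteq> carrier_vec n" using Mc by (auto simp: S_def)
  have S0: "0\<^sub>v n \<in> S"
    using N0 NM \<beta>d by (auto simp: S_def index_mact intro!: eq_vecI)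
  have Sadd: "v + w \<in> S" if "v \<in> S" "w \<in> S" for v w
  proof -
    have "v \<in> carrier_vec n" "w \<in> carrier_vec n" using that Sc by auto
    then show ?thesis using that \<beta>d by (auto simp: S_def Madd mact_add)
  qed
  have Ssc: "vscale c v \<in> S" if "v \<in> S" for v c
  proof -
    have "v \<in> carrier_vec n" using that Sc by auto
    then show ?thesis using that \<beta>d by (auto simp: S_def Msc mact_vscale intro!: eq_vecI)
  qed
  from subspace_isometry[OF Sc S0 Sadd Ssc]
  obtain m \<alpha> where \<alpha>: "\<alpha> \<in> carrier_mat n m" "mat_adjoint \<alpha> * \<alpha> = 1\<^sub>m m"
    and \<alpha>S: "\<And>v. v \<in> carrier_vec m \<Longrightarrow> mact \<alpha> v \<in> S"
    and \<alpha>\<alpha>: "\<And>v. v \<in> S \<Longrightarrow> mact \<alpha> (mact (mat_adjoint \<alpha>) v) = v"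
    by metis
  note \<alpha>c = mat_adjoint_carrier[OF \<alpha>(1)]
  note \<alpha>d = carrier_matD[OF \<alpha>(1)]
  define Y where "Y = (\<lambda>j. mat_adjoint \<alpha> * X j * \<alpha>)"
  have YT: "Y \<in> mat_tuples m"
    using \<alpha>(1) \<alpha>c Xc by (auto simp: Y_def mat_tuples_def)
  note Yc = mat_tuplesD[OF YT]
  note WYc = word_mat_carrier[OF YT]
  have \<alpha>N: "mact (mat_adjoint \<alpha>) r = 0\<^sub>v m" if r: "r \<in> N" for r
  proof -
    define z where "z = mact (mat_adjoint \<alpha>) r"
    have z: "z \<in> carrier_vec m" unfolding z_def by (rule mact_carrier[OF \<alpha>c])
    have rc: "r \<in> carrier_vec n" using r Nc by blast
    have s: "mact \<alpha> z \<in> S" by (rule \<alpha>S[OF z])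
    have "vinner r (mact \<alpha> z) = vinner (mact \<beta> (mact (mat_adjoint \<beta>) r)) (mact \<alpha> z)"
      by (simp add: \<beta>\<beta>[OF r])
    also have "\<dots> = vinner (mact (mat_adjoint \<beta>) r) (mact (mat_adjoint \<beta>) (mact \<alpha> z))"
      using \<beta>(1) s Sc by (intro vinner_mact_adjoint[OF \<beta>(1)] mact_carrier[OF \<beta>c]) auto
    also have "\<dots> = 0" using s \<beta>d by (simp add: S_def)
    finally have "vinner (mact \<alpha> z) r = 0"
      using rc \<alpha>d vinner_commute[of "mact \<alpha> z" r] by simp
    then have "vinner z z = 0"
      using vinner_mact_adjoint[OF \<alpha>(1) z rc] by (simp add: z_def)
    then have "tensor_norm z = 0" by (simp add: vinner_self)
    then show ?thesis using \<alpha>d by (simp add: tensor_norm_eq_0_iff z_def)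
  qed
  have split: "v - mact \<alpha> (mact (mat_adjoint \<alpha>) v) \<in> N" if v: "v \<in> M" for v
  proof -
    have vc: "v \<in> carrier_vec n" using v Mc by blast
    define r where "r = mact \<beta> (mact (mat_adjoint \<beta>) v)"
    have bv: "mact (mat_adjoint \<beta>) v \<in> carrier_vec l" by (rule mact_carrier[OF \<beta>c])
    have r: "r \<in> N" unfolding r_def by (rule \<beta>N[OF bv])
    have rc: "r \<in> carrier_vec n" using r Nc by blast
    have vr: "v - r = v + vscale (- 1) r"
      using vc rc by (intro eq_vecI) (auto simp: scaleC_complex_def)
    have "mact (mat_adjoint \<beta>) r = mact (mat_adjoint \<beta>) v"
      unfolding r_def by (rule isometry_adjoint_cancel[OF \<beta> bv])
    then have "mact (mat_adjoint \<beta>) (v - r) = 0\<^sub>v l"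
      using vc rc bv \<beta>d by (simp add: mact_diff minus_cancel_vec[of _ l])
    then have s: "v - r \<in> S"
      using Madd[OF v Msc[of r "- 1"]] r NM unfolding S_def vr by auto
    have "mact (mat_adjoint \<alpha>) v = mact (mat_adjoint \<alpha>) (v - r)"
      using vc rc \<alpha>d by (subst mact_diff) (auto simp: \<alpha>N[OF r] intro!: eq_vecI)
    then have "mact \<alpha> (mact (mat_adjoint \<alpha>) v) = v - r" using \<alpha>\<alpha>[OF s] by simp
    moreover have "v - (v - r) = r" using vc rc by (intro eq_vecI) auto
    ultimately show ?thesis using r by simp
  qed
  \<comment> \<open>Semi-invariance makes compression multiplicative on \<open>M\<close>. The part
    of \<open>v\<close> lost by the projection lies in \<open>N\<close>, the matrix keeps it there,
    and the adjoint of \<open>\<alpha>\<close> annihilates \<open>N\<close>.\<close>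
  have step: "mact (mat_adjoint \<alpha>) (mact (X j) v) = mact (Y j) (mact (mat_adjoint \<alpha>) v)"
    if v: "v \<in> M" for v j
  proof -
    have vc: "v \<in> carrier_vec n" using v Mc by blast
    define s where "s = mact \<alpha> (mact (mat_adjoint \<alpha>) v)"
    have sc: "s \<in> carrier_vec n" unfolding s_def by (rule mact_carrier[OF \<alpha>(1)])
    have "mact (mat_adjoint \<alpha>) (mact (X j) (v - s)) = 0\<^sub>v m"
      using split[OF v] NX \<alpha>N by (simp add: s_def)
    also have "mact (X j) (v - s) = mact (X j) v - mact (X j) s"
      using vc sc Xd by (simp add: mact_diff)
    also have "mact (mat_adjoint \<alpha>) \<dots> = mact (mat_adjoint \<alpha>) (mact (X j) v) - mact (mat_adjoint \<alpha>) (mact (X j) s)"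
      using \<alpha>d mact_carrier[OF Xc] by (intro mact_diff) auto
    finally have eq: "mact (mat_adjoint \<alpha>) (mact (X j) v) - mact (mat_adjoint \<alpha>) (mact (X j) s) = 0\<^sub>v m" .
    have "mact (mat_adjoint \<alpha>) (mact (X j) v) = mact (mat_adjoint \<alpha>) (mact (X j) s)"
    proof (rule eq_vecI)
      fix i assume "i < dim_vec (mact (mat_adjoint \<alpha>) (mact (X j) s))"
      then show "mact (mat_adjoint \<alpha>) (mact (X j) v) $ i = mact (mat_adjoint \<alpha>) (mact (X j) s) $ i"
        using arg_cong[OF eq, of "\<lambda>x. x $ i"] \<alpha>d by simp
    qed simp
    also have "\<dots> = mact (Y j) (mact (mat_adjoint \<alpha>) v)"
      unfolding Y_def s_def mact_mult[OF mult_carrier_mat[OF \<alpha>c Xc] \<alpha>(1)] mact_mult[OF \<alpha>c Xc] ..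
    finally show ?thesis .
  qed
  have word: "mact (mat_adjoint \<alpha>) (mact (?W w) v) = mact (word_mat m Y w) (mact (mat_adjoint \<alpha>) v)"
    if v: "v \<in> M" for v w
  proof (induction w)
    case Nil
    then show ?case using v Mc mact_carrier[OF \<alpha>c, of v] by (auto simp: mact_one)
  next
    case (Cons j w)
    then show ?case using step[OF MW[OF v]] by (simp add: mact_mult[OF Xc Wc] mact_mult[OF Yc WYc])
  qed
  have nil: "nc_nilpotent \<Lambda> m Y"
    unfolding nc_nilpotent_def
  proof (intro allI impI)
    fix u assume u: "u \<notin> \<Lambda>"
    show "word_mat m Y u = 0\<^sub>m m m"
    proof (rule mact_eq_0_imp[OF WYc])
      fix z :: "complex vec" assume z: "z \<in> carrier_vec m"
      have zM: "mact \<alpha> z \<in> M" using \<alpha>S[OF z] by (simp add: S_def)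
      show "mact (word_mat m Y u) z = 0\<^sub>v m"
        using word[OF zM, of u] \<alpha>N[OF MN[OF zM u]] isometry_adjoint_cancel[OF \<alpha> z] by simp
    qed
  qed
  define h' where "h' = mact (mat_adjoint \<alpha>) h"
  define k' where "k' = mact (mat_adjoint \<alpha>) k"
  \<comment> \<open>The empty word in the definition of \<open>N\<close> makes \<open>N\<close>
    orthogonal to every slice of \<open>k\<close>, so \<open>k\<close> has no component in U tensor
    \<open>N\<close>.\<close>
  have \<beta>k: "mact (mat_adjoint \<beta>) k = 0\<^sub>v l"
  proof (rule slice_eqI)
    fix b
    define z where "z = mact (mat_adjoint \<beta>) (slice b k)"
    have z: "z \<in> carrier_vec l" unfolding z_def by (rule mact_carrier[OF \<beta>c])
    have "vinner (mact (?W []) (mact \<beta> z)) (slice b k) = 0"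
      using \<beta>N[OF z] unfolding N_def by blast
    then have "vinner (mact \<beta> z) (slice b k) = 0"
      by (simp add: mact_one[OF mact_carrier[OF \<beta>(1)]])
    then have "vinner z z = 0"
      using vinner_mact_adjoint[OF \<beta>(1) z, of "slice b k"] k by (simp add: z_def)
    then have "tensor_norm z = 0" by (simp add: vinner_self)
    then have "z = 0\<^sub>v l" using z by (simp add: tensor_norm_eq_0_iff)
    moreover have "slice b (mact (mat_adjoint \<beta>) k) = z"
      unfolding z_def using k \<beta>d by (intro slice_mact) simp
    moreover have "slice b (0\<^sub>v l :: 'u vec) = 0\<^sub>v l" by (intro eq_vecI) auto
    ultimately show "slice b (mact (mat_adjoint \<beta>) k) = slice b (0\<^sub>v l)" by simp
  qed (use \<beta>d in simp)
  have summand: "vinner (map_vec (p w) (mact (?W w) h)) k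
      = vinner (map_vec (p w) (mact (word_mat m Y w) h')) k'" if w: "w \<in> \<Lambda>" for w
  proof -
    define g where "g = mact (?W w) h"
    define s where "s = mact (mat_adjoint \<alpha>) g"
    define e where "e = g - mact \<alpha> s"
    have gc: "g \<in> carrier_vec n" unfolding g_def by (rule mact_carrier[OF Wc])
    have sc: "s \<in> carrier_vec m" unfolding s_def by (rule mact_carrier[OF \<alpha>c])
    have asc: "mact \<alpha> s \<in> carrier_vec n" by (rule mact_carrier[OF \<alpha>(1)])
    have ec: "e \<in> carrier_vec n" unfolding e_def using gc asc by simp
    have sl: "slice a g = mact (?W w) (slice a h)" for a
      unfolding g_def using h Wd by (intro slice_mact) simp
    have "slice a s = slice a (mact (word_mat m Y w) h')" for a
    proof -
      have "slice a s = mact (mat_adjoint \<alpha>) (mact (?W w) (slice a h))"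
        unfolding s_def using gc \<alpha>d by (subst slice_mact) (auto simp: sl)
      also have "\<dots> = mact (word_mat m Y w) (mact (mat_adjoint \<alpha>) (slice a h))"
        by (rule word[OF hM])
      also have "\<dots> = slice a (mact (word_mat m Y w) h')"
        unfolding h'_def using carrier_matD[OF WYc] \<alpha>d h by (simp add: slice_mact)
      finally show ?thesis .
    qed
    then have s_eq: "s = mact (word_mat m Y w) h'"
      by (rule slice_eqI[rotated]) (simp add: s_def carrier_matD[OF WYc] \<alpha>d)
    have eN: "slice a e \<in> N" for a
    proof -
      have "slice a e = slice a g - mact \<alpha> (mact (mat_adjoint \<alpha>) (slice a g))"
      proof -
        have "slice a s = mact (mat_adjoint \<alpha>) (slice a g)"
          unfolding s_def using gc \<alpha>d by (intro slice_mact) simp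
        then show ?thesis
          unfolding e_def using gc sc asc \<alpha>d by (simp add: slice_diff slice_mact)
      qed
      then show ?thesis using split[OF MW[OF hM[of a], of w]] by (simp add: sl)
    qed
    \<comment> \<open>All slices of the error \<open>e\<close> lie in \<open>N\<close>, so the
      projection \<open>\<beta> \<beta>^*\<close> fixes it. As \<open>p w\<close> acts on the other
      tensor factor, the image of \<open>e\<close> is fixed as well and is therefore orthogonal to
      \<open>k\<close>.\<close>
    have e_eq: "mact \<beta> (mact (mat_adjoint \<beta>) e) = e"
    proof (rule slice_eqI)
      show "slice a (mact \<beta> (mact (mat_adjoint \<beta>) e)) = slice a e" for a
        using \<beta>\<beta>[OF eN[of a]] ec \<beta>d by (simp add: slice_mact)
    qed (use ec \<beta>d in simp)
    have pw: "bounded_clinear (p w)" by (rule p[OF w])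
    have "map_vec (p w) e = mact \<beta> (mact (mat_adjoint \<beta>) (map_vec (p w) e))"
      using ec \<beta>d e_eq by (simp add: mact_map_vec[OF pw])
    then have "vinner (map_vec (p w) e) k
        = vinner (mact \<beta> (mact (mat_adjoint \<beta>) (map_vec (p w) e))) k" by simp
    also have "\<dots> = vinner (mact (mat_adjoint \<beta>) (map_vec (p w) e)) (mact (mat_adjoint \<beta>) k)"
      using k by (intro vinner_mact_adjoint[OF \<beta>(1)] mact_carrier[OF \<beta>c])
    also have "\<dots> = 0" using \<beta>k \<beta>d by simp
    finally have e0: "vinner (map_vec (p w) e) k = 0" .
    have "g = e + mact \<alpha> s"
      unfolding e_def using gc asc \<alpha>d by (intro eq_vecI) auto
    then have "map_vec (p w) g = map_vec (p w) e + map_vec (p w) (mact \<alpha> s)"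
      using carrier_vecD[OF ec] \<alpha>d by (intro eq_vecI) (auto simp: bounded_clinear_add[OF pw])
    then have "vinner (map_vec (p w) g) k = vinner (map_vec (p w) (mact \<alpha> s)) k"
      using ec asc e0 vinner_add_left[of "map_vec (p w) e" n "map_vec (p w) (mact \<alpha> s)" k] by simp
    also have "\<dots> = vinner (mact \<alpha> (map_vec (p w) s)) k"
      using sc \<alpha>d by (simp add: mact_map_vec[OF pw])
    also have "\<dots> = vinner (map_vec (p w) s) k'"
      unfolding k'_def using sc k by (intro vinner_mact_adjoint[OF \<alpha>(1)]) auto
    finally show ?thesis by (simp add: g_def s_eq)
  qed
  show thesis
  proof
    \<comment> \<open>M and N may coincide, and then the compression lives on the zero space. Level
      zero does not belong to a matrix convex set, so membership is claimed from level one
      on.\<close>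
    show "m \<ge> 1 \<longrightarrow> Y \<in> K m"
      using K n X \<alpha> unfolding matrix_convex_def Y_def by blast
    show "vinner (wsum n p X \<Lambda> h) k = vinner (wsum m p Y \<Lambda> h') k'"
      unfolding vinner_wsum[OF XT] vinner_wsum[OF YT] by (intro sum.cong refl summand)
    show "h' \<in> carrier_vec m" "k' \<in> carrier_vec m"
      unfolding h'_def k'_def by (rule mact_carrier[OF \<alpha>c])+
    show "tensor_norm h' \<le> tensor_norm h" "tensor_norm k' \<le> tensor_norm k"
      unfolding h'_def k'_def using h k by (auto intro: tensor_norm_coisometry_le[OF \<alpha>])
  qed (rule nil)
qed

section \<open>The separation argument\<close>

lemma sum_lessThan_add: "(\<Sum>i<n + m. f i) = (\<Sum>i<n. f i) + (\<Sum>i<m. f (n + i))"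
  for f :: "nat \<Rightarrow> 'a::comm_monoid_add"
  by (induction m) (auto simp: add.assoc)

lemma mat_direct_sum_carrier [simp]:
  "A \<in> carrier_mat n n \<Longrightarrow> B \<in> carrier_mat m m \<Longrightarrow> mat_direct_sum A B \<in> carrier_mat (n + m) (n + m)"
  by (auto simp: mat_direct_sum_def)

lemma mat_direct_sum_mult:
  assumes "A \<in> carrier_mat n n" "A' \<in> carrier_mat n n" "B \<in> carrier_mat m m" "B' \<in> carrier_mat m m"
  shows "mat_direct_sum A B * mat_direct_sum A' B' = mat_direct_sum (A * A') (B * B')"
  using assms unfolding mat_direct_sum_def
  by (subst mult_four_block_mat[where ?nr1.0 = n and ?n1.0 = n and ?n2.0 = m and ?nr2.0 = m
        and ?nc1.0 = n and ?nc2.0 = m]) auto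

lemma word_mat_direct_sum:
  assumes "X \<in> mat_tuples n" "Y \<in> mat_tuples m"
  shows "word_mat (n + m) (\<lambda>j. mat_direct_sum (X j) (Y j)) w
    = mat_direct_sum (word_mat n X w) (word_mat m Y w)"
proof (induction w)
  case Nil
  then show ?case by (simp add: mat_direct_sum_def)
next
  case (Cons j w)
  then show ?case
    using assms by (simp add: mat_direct_sum_mult[of _ n _ _ m] mat_tuplesD)
qed

lemma mact_direct_sum:
  assumes "A \<in> carrier_mat n n" "B \<in> carrier_mat m m" "h \<in> carrier_vec n" "h' \<in> carrier_vec m"
  shows "mact (mat_direct_sum A B) (h @\<^sub>v h') = mact A h @\<^sub>v mact B h'"
proof (rule eq_vecI)
  fix i assume "i < dim_vec (mact A h @\<^sub>v mact B h')"
  then have i: "i < n + m" using assms by simp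
  have "mact (mat_direct_sum A B) (h @\<^sub>v h') $ i
      = (\<Sum>k<n + m. mat_direct_sum A B $$ (i, k) *\<^sub>C (h @\<^sub>v h') $ k)"
    using assms i by (simp add: index_mact mat_direct_sum_def)
  also have "\<dots> = (mact A h @\<^sub>v mact B h') $ i"
    unfolding sum_lessThan_add using assms i by (simp add: index_mact mat_direct_sum_def)
  finally show "mact (mat_direct_sum A B) (h @\<^sub>v h') $ i = (mact A h @\<^sub>v mact B h') $ i" .
qed (use assms in \<open>simp add: mat_direct_sum_def\<close>)

lemma slice_append: "slice a (h @\<^sub>v h') = slice a h @\<^sub>v slice a h'"
  by (intro eq_vecI) auto

lemma vinner_append:
  "h \<in> carrier_vec n \<Longrightarrow> k \<in> carrier_vec n \<Longrightarrow> h' \<in> carrier_vec m \<Longrightarrow> k' \<in> carrier_vec m \<Longrightarrow>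
    vinner (h @\<^sub>v h') (k @\<^sub>v k') = vinner h k + vinner h' k'"
  by (simp add: vinner_def sum_lessThan_add)

lemma tensor_norm_append: "(tensor_norm (h @\<^sub>v h'))\<^sup>2 = (tensor_norm h)\<^sup>2 + (tensor_norm h')\<^sup>2"
  by (simp add: tensor_norm_square sum_lessThan_add)

lemma wsum_direct_sum:
  assumes X: "X \<in> mat_tuples n" and Y: "Y \<in> mat_tuples m"
    and h: "h \<in> carrier_vec n" "h' \<in> carrier_vec m"
  shows "wsum (n + m) f (\<lambda>j. mat_direct_sum (X j) (Y j)) S (h @\<^sub>v h') = wsum n f X S h @\<^sub>v wsum m f Y S h'"
proof (rule eq_vecI)
  have d: "dim_row (word_mat n X w) = n" "dim_row (word_mat m Y w) = m" for w
    using word_mat_carrier[OF X] word_mat_carrier[OF Y] by blast+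
  fix i assume "i < dim_vec (wsum n f X S h @\<^sub>v wsum m f Y S h')"
  then show "wsum (n + m) f (\<lambda>j. mat_direct_sum (X j) (Y j)) S (h @\<^sub>v h') $ i
      = (wsum n f X S h @\<^sub>v wsum m f Y S h') $ i"
    using h
    by (simp add: wsum_def word_mat_direct_sum[OF X Y] d
        mact_direct_sum[OF word_mat_carrier[OF X] word_mat_carrier[OF Y]])
qed simp

lemma slice_vscale: "slice a (vscale c h) = vscale c (slice a h)"
  by (intro eq_vecI) (auto simp: cinner_scaleC_left scaleC_complex_def)

lemma wsum_vscale:
  assumes X: "X \<in> mat_tuples n" and h: "h \<in> carrier_vec n"
    and f: "\<And>w. w \<in> S \<Longrightarrow> bounded_clinear (f w)"
  shows "wsum n f X S (vscale c h) = vscale c (wsum n f X S h)"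
proof -
  have d: "dim_row (word_mat n X w) = n" "dim_col (word_mat n X w) = n" for w
    using word_mat_carrier[OF X] by blast+
  show ?thesis
    using h by (intro eq_vecI)
      (auto simp: wsum_def mact_vscale d scaleC_sum_right f bounded_clinear_scaleC intro!: sum.cong)
qed

text \<open>At such a tuple every power series is a finite sum, so each test involves finitely many
  coefficients and raises no question of convergence.\<close>

definition nilpotent_order :: "nat \<Rightarrow> nat \<Rightarrow> ('d \<Rightarrow> complex mat) \<Rightarrow> bool" where
  "nilpotent_order N n X \<longleftrightarrow> (\<forall>w. length w \<ge> N \<longrightarrow> word_mat n X w = 0\<^sub>m n n)"

definition test_data :: "(nat \<Rightarrow> ('d \<Rightarrow> complex mat) set) \<Rightarrow>
    (nat \<times> ('d \<Rightarrow> complex mat) \<times> 'u::chilbert_space vec \<times> 'u vec) set" where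
  "test_data K = {(n, X, h, k). n \<ge> 1 \<and> X \<in> K n \<and> (\<exists>N. nilpotent_order N n X) \<and>
     h \<in> carrier_vec n \<and> k \<in> carrier_vec n}"

text \<open>The functional sending a coefficient T of \<open>v\<close> to the pairing of (T tensor
  X^v) \<open>h\<close> with \<open>k\<close>, recorded by its value at the rank-one operator that
  maps c to \<open>cinner c a *\<^sub>C b\<close>. It is zero on the segment, where the coefficients
  are prescribed and enter through the cost instead.\<close>

definition test_functional :: "'d list set \<Rightarrow>
    nat \<times> ('d \<Rightarrow> complex mat) \<times> 'u::chilbert_space vec \<times> 'u vec \<Rightarrow>
    'd list \<Rightarrow> 'u \<Rightarrow> 'u \<Rightarrow> complex" where
  "test_functional \<Lambda> = (\<lambda>(n, X, h, k) v a b.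
     if v \<in> \<Lambda> then 0 else vinner (mact (word_mat n X v) (slice a h)) (slice b k))"

text \<open>The bound \<open>C * tensor_norm h * tensor_norm k\<close> is replaced by its
  arithmetic-mean majorant, which is additive under direct sums; a product of norms is not. Nothing
  is lost, since rescaling \<open>h\<close> against \<open>k\<close> recovers the product.\<close>

definition test_cost :: "'d list set \<Rightarrow> ('d list \<Rightarrow> 'u::chilbert_space \<Rightarrow> 'u) \<Rightarrow> real \<Rightarrow>
    nat \<times> ('d \<Rightarrow> complex mat) \<times> 'u vec \<times> 'u vec \<Rightarrow> real" where
  "test_cost \<Lambda> p C = (\<lambda>(n, X, h, k).
     C * ((tensor_norm h)\<^sup>2 + (tensor_norm k)\<^sup>2) / 2 - Re (vinner (wsum n p X \<Lambda> h) k))"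

text \<open>Direct sums provide addition, a common factor of \<open>h\<close> and \<open>k\<close>
  the positive multiples, and a sign the negatives. Only the last cone condition has content: when
  the functional vanishes, the pairing can be computed at a nilpotent tuple of the segment, where
  \<open>bound\<close> applies.\<close>

lemma test_functional_dominated:
  fixes K :: "nat \<Rightarrow> ('d \<Rightarrow> complex mat) set" and p :: "'d list \<Rightarrow> 'u::chilbert_space \<Rightarrow> 'u"
  assumes K: "matrix_convex K" and seg: "initial_segment \<Lambda>"
    and p: "\<And>w. w \<in> \<Lambda> \<Longrightarrow> bounded_clinear (p w)" and C: "C \<ge> 0"
    and bound: "\<And>n X h. n \<ge> 1 \<Longrightarrow> X \<in> K n \<Longrightarrow> nc_nilpotent \<Lambda> n X \<Longrightarrow> h \<in> carrier_vec n \<Longrightarrow>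
      tensor_norm (wsum n p X \<Lambda> h) \<le> C * tensor_norm h"
    and ne: "(test_data K :: (nat \<times> _ \<times> 'u vec \<times> 'u vec) set) \<noteq> {}"
  obtains \<phi> where "linear \<phi>"
    "\<forall>x\<in>test_data K. \<phi> (test_functional \<Lambda> x) \<le> test_cost \<Lambda> p C x"
proof -
  let ?D = "test_data K :: (nat \<times> ('d \<Rightarrow> complex mat) \<times> 'u vec \<times> 'u vec) set"
  let ?T = "test_functional \<Lambda> :: _ \<Rightarrow> 'd list \<Rightarrow> 'u \<Rightarrow> 'u \<Rightarrow> complex"
  let ?c = "test_cost \<Lambda> p C"
  have KT: "X \<in> mat_tuples n" if "n \<ge> 1" "X \<in> K n" for n X
    using K that by (auto simp: matrix_convex_def)
  have Wd: "dim_row (word_mat n X w) = n" "dim_col (word_mat n X w) = n"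
    if "n \<ge> 1" "X \<in> K n" for n X and w :: "'d list"
    using word_mat_carrier[OF KT[OF that]] by blast+
  have "\<exists>f. linear f \<and> (\<forall>x\<in>?D. f (?T x) \<le> ?c x)"
  proof (rule linear_below_cone_cost[OF ne])
    fix x y assume "x \<in> ?D" "y \<in> ?D"
    then obtain n X h k m Y h' k' N M where x: "x = (n, X, h, k)" "n \<ge> 1" "X \<in> K n"
      "nilpotent_order N n X" "h \<in> carrier_vec n" "k \<in> carrier_vec n"
      and y: "y = (m, Y, h', k')" "m \<ge> 1" "Y \<in> K m" "nilpotent_order M m Y"
      "h' \<in> carrier_vec m" "k' \<in> carrier_vec m"
      by (auto simp: test_data_def)
    note X = KT[OF x(2,3)] and Y = KT[OF y(2,3)]
    let ?Z = "\<lambda>j. mat_direct_sum (X j) (Y j)"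
    define z where "z = (n + m, ?Z, h @\<^sub>v h', k @\<^sub>v k')"
    have "nilpotent_order (max N M) (n + m) ?Z"
      using x(4) y(4) unfolding nilpotent_order_def word_mat_direct_sum[OF X Y]
      by (auto simp: mat_direct_sum_def)
    then have "z \<in> ?D"
      using K x y unfolding z_def test_data_def matrix_convex_def by auto
    moreover have "?T z = ?T x + ?T y"
      using x(5,6) y(5,6) unfolding fun_eq_iff z_def x(1) y(1) test_functional_def
      by (auto simp: word_mat_direct_sum[OF X Y] slice_append
          mact_direct_sum[OF word_mat_carrier[OF X] word_mat_carrier[OF Y]]
          vinner_append[OF mact_carrier[OF word_mat_carrier[OF X]] _ mact_carrier[OF word_mat_carrier[OF Y]]])
    moreover have "?c z = ?c x + ?c y"
      using x(5,6) y(5,6) unfolding z_def x(1) y(1) test_cost_def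
      by (simp add: tensor_norm_append wsum_direct_sum[OF X Y]
          vinner_append[OF wsum_carrier _ wsum_carrier] distrib_left add_divide_distrib)
    ultimately show "\<exists>z\<in>?D. ?T z = ?T x + ?T y \<and> ?c z \<le> ?c x + ?c y" by auto
  next
    fix t :: real and x assume t: "t > 0" and "x \<in> ?D"
    then obtain n X h k N where x: "x = (n, X, h, k)" "n \<ge> 1" "X \<in> K n"
      "nilpotent_order N n X" "h \<in> carrier_vec n" "k \<in> carrier_vec n"
      by (auto simp: test_data_def)
    note X = KT[OF x(2,3)]
    \<comment> \<open>The functional is sesquilinear in \<open>(h, k)\<close> and the cost
      quadratic, so scaling both vectors by the square root multiplies each of them by
      \<open>t\<close>.\<close>
    define s where "s = complex_of_real (sqrt t)"
    have s: "s * s = of_real t" "cnj s = s" "(cmod s)\<^sup>2 = t"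
      using t by (auto simp: s_def of_real_mult[symmetric] simp del: of_real_mult)
    define z where "z = (n, X, vscale s h, vscale s k)"
    have "z \<in> ?D" using x by (auto simp: z_def test_data_def)
    moreover have "?T z = t *\<^sub>R ?T x"
    proof (intro ext)
      fix v a b
      have "vinner (mact (word_mat n X v) (slice a (vscale s h))) (slice b (vscale s k))
          = (s * s) * vinner (mact (word_mat n X v) (slice a h)) (slice b k)"
        using x(5,6) Wd[OF x(2,3)]
        by (simp add: slice_vscale mact_vscale vinner_vscale_left vinner_vscale_right s(2))
      then show "?T z v a b = (t *\<^sub>R ?T x) v a b"
        by (simp add: z_def x(1) test_functional_def scaleR_fun_def scaleR_conv_of_real s(1))
    qed
    moreover have "?c z = t * ?c x"
    proof -
      have "vinner (wsum n p X \<Lambda> (vscale s h)) (vscale s k) = (s * s) * vinner (wsum n p X \<Lambda> h) k"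
        using x(5,6) p by (simp add: wsum_vscale[OF X] vinner_vscale_left vinner_vscale_right s(2))
      moreover have "(tensor_norm (vscale s l))\<^sup>2 = t * (tensor_norm l)\<^sup>2" for l :: "'u vec"
        by (simp add: tensor_norm_vscale power_mult_distrib s(3))
      ultimately show ?thesis
        by (simp add: z_def x(1) test_cost_def s(1) right_diff_distrib distrib_left)
    qed
    ultimately show "\<exists>z\<in>?D. ?T z = t *\<^sub>R ?T x \<and> ?c z \<le> t * ?c x" by auto
  next
    fix x assume "x \<in> ?D"
    then obtain n X h k N where x: "x = (n, X, h, k)" "n \<ge> 1" "X \<in> K n"
      "nilpotent_order N n X" "h \<in> carrier_vec n" "k \<in> carrier_vec n"
      by (auto simp: test_data_def)
    \<comment> \<open>Changing the sign of one vector only reverses the functional; no claim is made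
      about the cost.\<close>
    define z where "z = (n, X, vscale (- 1) h, k)"
    have "z \<in> ?D" using x by (auto simp: z_def test_data_def)
    moreover have "?T z = - ?T x"
      using x(5,6) Wd[OF x(2,3)] unfolding fun_eq_iff z_def x(1) test_functional_def
      by (auto simp: slice_vscale mact_vscale vinner_vscale_left)
    ultimately show "\<exists>z\<in>?D. ?T z = - ?T x" by auto
  next
    fix x assume "x \<in> ?D" and T0: "?T x = 0"
    then obtain n X h k where x: "x = (n, X, h, k)" "n \<ge> 1" "X \<in> K n"
      "h \<in> carrier_vec n" "k \<in> carrier_vec n"
      by (auto simp: test_data_def)
    have zero: "vinner (mact (word_mat n X v) (slice a h)) (slice b k) = 0" if "v \<notin> \<Lambda>" for v a b
      using fun_cong[OF fun_cong[OF fun_cong[OF T0, of v], of a], of b] that x(1)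
      by (simp add: test_functional_def)
    obtain m Y h' k' where Y: "m \<ge> 1 \<longrightarrow> Y \<in> K m" "nc_nilpotent \<Lambda> m Y"
      and hk: "h' \<in> carrier_vec m" "k' \<in> carrier_vec m"
      and le: "tensor_norm h' \<le> tensor_norm h" "tensor_norm k' \<le> tensor_norm k"
      and eq: "vinner (wsum n p X \<Lambda> h) k = vinner (wsum m p Y \<Lambda> h') k'"
      by (rule compress_to_nilpotent[OF K seg p x(2-5) zero])
    have "Re (vinner (wsum m p Y \<Lambda> h') k') \<le> C * tensor_norm h * tensor_norm k"
    proof (cases "m = 0")
      case True
      then show ?thesis using C by (simp add: vinner_def)
    next
      case False
      then have "tensor_norm (wsum m p Y \<Lambda> h') \<le> C * tensor_norm h'"
        using Y hk by (intro bound) auto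
      also have "\<dots> \<le> C * tensor_norm h" using C le by (intro mult_left_mono)
      finally have "tensor_norm (wsum m p Y \<Lambda> h') * tensor_norm k' \<le> C * tensor_norm h * tensor_norm k"
        using C le by (intro mult_mono) auto
      moreover have "\<bar>Re (vinner (wsum m p Y \<Lambda> h') k')\<bar> \<le> tensor_norm (wsum m p Y \<Lambda> h') * tensor_norm k'"
        using hk by (intro Re_vinner_le) simp
      ultimately show ?thesis by linarith
    qed
    also have "C * tensor_norm h * tensor_norm k \<le> C * ((tensor_norm h)\<^sup>2 + (tensor_norm k)\<^sup>2) / 2"
    proof -
      have "2 * (tensor_norm h * tensor_norm k) \<le> (tensor_norm h)\<^sup>2 + (tensor_norm k)\<^sup>2"
        using sum_squares_bound[of "tensor_norm h" "tensor_norm k"] by simp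
      from mult_left_mono[OF this C] show ?thesis by (simp add: algebra_simps)
    qed
    finally show "0 \<le> ?c x" by (simp add: x(1) test_cost_def eq)
  qed
  then show thesis using that by blast
qed

section \<open>Isolating and bounding single coefficients\<close>

text \<open>\<open>g\<close> is to be the real part of a sesquilinear form. Real Riesz
  representation in \<open>b\<close> produces \<open>T a\<close>; the hypothesis
  \<open>scale\<close>, which moves a complex scalar across the form, makes \<open>T\<close> complex
  linear. Normalising both vectors and replacing \<open>a\<close> by its negative turns the
  one-sided quadratic bound into a two-sided bilinear one.\<close>

lemma bounded_clinear_riesz:
  fixes g :: "'u::chilbert_space \<Rightarrow> 'u \<Rightarrow> real"
  assumes add_left: "\<And>a a' b. g (a + a') b = g a b + g a' b"
    and add_right: "\<And>a b b'. g a (b + b') = g a b + g a b'"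
    and scale: "\<And>c a b. g (c *\<^sub>C a) b = g a (cnj c *\<^sub>C b)"
    and scale_right: "\<And>r a b. g a (r *\<^sub>R b) = r * g a b"
    and bound: "\<And>a b. g a b \<le> M * ((norm a)\<^sup>2 + (norm b)\<^sup>2)"
  obtains T where "bounded_clinear T" "\<And>a b. g a b = Re (cinner (T a) b)"
proof -
  have scale_left: "g (r *\<^sub>R a) b = r * g a b" for r a b
    using scale[of "of_real r" a b] scale_right[of a r b] by (simp add: scaleR_scaleC)
  have bdd: "\<bar>g a b\<bar> \<le> 2 * M * norm a * norm b" for a b
  proof (cases "a = 0 \<or> b = 0")
    case True
    then show ?thesis using scale_left[of 0 0 b] scale_right[of a 0 0] by auto
  next
    case False
    have "g a' b \<le> 2 * M * norm a' * norm b" if "a' \<noteq> 0" for a'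
    proof -
      have "g a' b = norm a' * norm b * g ((1 / norm a') *\<^sub>R a') ((1 / norm b) *\<^sub>R b)"
        using False that by (simp add: scale_left scale_right)
      also have "\<dots> \<le> norm a' * norm b * (M * (1 + 1))"
        using False that bound[of "(1 / norm a') *\<^sub>R a'" "(1 / norm b) *\<^sub>R b"]
        by (intro mult_left_mono) auto
      finally show ?thesis by (simp add: algebra_simps)
    qed
    from this[of a] this[of "- a"] show ?thesis
      using False scale_left[of "- 1" a b] by (simp add: abs_le_iff)
  qed
  have "bounded_linear (g a)" for a
    using bdd[of a] by (intro bounded_linear_intro[where K = "2 * M * norm a"])
      (auto simp: add_right scale_right mult.commute mult.left_commute)
  then have "\<exists>y. \<forall>b. g a b = Re (cinner y b)" for a
    by (rule real_riesz_representation)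
  then obtain T where T: "\<And>a b. g a b = Re (cinner (T a) b)" by metis
  have eqI: "x = y" if "\<And>b. Re (cinner x b) = Re (cinner y b)" for x y :: 'u
    using that[of "x - y"] Re_cinner_self[of "x - y"] by (simp add: cinner_diff_left)
  have add: "T (a + a') = T a + T a'" for a a'
    by (rule eqI) (simp add: T[symmetric] add_left cinner_add_left)
  have scaleC: "T (c *\<^sub>C a) = c *\<^sub>C T a" for c a
  proof (rule eqI)
    fix b
    have "Re (cinner (c *\<^sub>C T a) b) = Re (cinner (T a) (cnj c *\<^sub>C b))"
      by (simp add: cinner_scaleC_left cinner_scaleC_right)
    then show "Re (cinner (T (c *\<^sub>C a)) b) = Re (cinner (c *\<^sub>C T a) b)"
      by (simp add: T[symmetric] scale)
  qed
  have "norm (T a) \<le> norm a * (2 * M)" for a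
  proof (cases "T a = 0")
    case True
    \<comment> \<open>The sign of \<open>M\<close> is not given. Adding the bounds at
      \<open>a\<close> and at \<open>- a\<close> shows that \<open>M\<close> is nonnegative unless
      \<open>a\<close> is zero.\<close>
    have "0 \<le> M * ((norm a)\<^sup>2 + (norm a)\<^sup>2)"
      using bound[of a a] bound[of "- a" a] scale_left[of "- 1" a a] by simp
    then have "0 \<le> M * (norm a * norm a)" by (simp add: power2_eq_square)
    then have "0 \<le> norm a * (2 * M)"
      by (cases "a = 0") (auto simp: zero_le_mult_iff mult_le_0_iff)
    then show ?thesis using True by simp
  next
    case False
    have "norm (T a) * norm (T a) \<le> norm a * (2 * M) * norm (T a)"
      using bdd[of a "T a"] by (simp add: T cinner_self power2_eq_square mult_ac)
    then show ?thesis using False by simp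
  qed
  then have "bounded_linear T"
    by (intro bounded_linear_intro[where K = "2 * M"])
      (auto simp: add scaleC scaleR_scaleC mult.commute)
  then have "bounded_clinear T" by (simp add: bounded_clinear_def scaleC)
  then show thesis using T that by blast
qed

text \<open>A weighted path spelling v: since e(m) is carried to e(0) by the word v only, these tuples
  isolate single coefficients.\<close>

definition path_tuple :: "real \<Rightarrow> 'd list \<Rightarrow> 'd \<Rightarrow> complex mat" where
  "path_tuple \<epsilon> v j = mat (Suc (length v)) (Suc (length v))
     (\<lambda>(r, c). if c = Suc r \<and> v ! r = j then of_real \<epsilon> else 0)"

lemma path_tuple_mat_tuples [simp]: "path_tuple \<epsilon> v \<in> mat_tuples (Suc (length v))"
  by (simp add: path_tuple_def mat_tuples_def)

lemma index_mult_mat_sum: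
  assumes "A \<in> carrier_mat n m" "B \<in> carrier_mat m l" "r < n" "c < l"
  shows "(A * B) $$ (r, c) = (\<Sum>s<m. A $$ (r, s) * B $$ (s, c))"
  using assms by (simp add: scalar_prod_def lessThan_atLeast0)

text \<open>Every letter advances the path by one vertex and must match the label there, so an entry
  is nonzero only if \<open>w\<close> is the stretch of \<open>v\<close> that starts at
  \<open>r\<close>.\<close>

lemma word_mat_path_tuple:
  assumes "r \<le> length v" "c \<le> length v"
  shows "word_mat (Suc (length v)) (path_tuple \<epsilon> v) w $$ (r, c)
    = (if c = r + length w \<and> take (length w) (drop r v) = w then of_real \<epsilon> ^ length w else 0)"
  using assms
proof (induction w arbitrary: r)
  case Nil
  then show ?case by auto
next
  case (Cons j w)
  let ?n = "Suc (length v)"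
  let ?W = "word_mat ?n (path_tuple \<epsilon> v)"
  have Wd: "?W w \<in> carrier_mat ?n ?n" by simp
  have "?W (j # w) $$ (r, c) = (\<Sum>s<?n. path_tuple \<epsilon> v j $$ (r, s) * ?W w $$ (s, c))"
    unfolding word_mat_Cons using Cons.prems
    by (intro index_mult_mat_sum[OF mat_tuplesD[OF path_tuple_mat_tuples] Wd]) auto
  also have "\<dots> = (\<Sum>s<?n. if s = Suc r then (if v ! r = j then of_real \<epsilon> * ?W w $$ (Suc r, c) else 0) else 0)"
    using Cons.prems by (intro sum.cong) (auto simp: path_tuple_def)
  also have "\<dots> = (if r < length v \<and> v ! r = j then of_real \<epsilon> * ?W w $$ (Suc r, c) else 0)"
    by (simp del: sum.lessThan_Suc)
  also have "\<dots> = (if c = r + length (j # w) \<and> take (length (j # w)) (drop r v) = j # w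
      then of_real \<epsilon> ^ length (j # w) else 0)"
  proof (cases "r < length v")
    case True
    then have "drop r v = v ! r # drop (Suc r) v" by (simp add: Cons_nth_drop_Suc)
    then show ?thesis using True Cons by auto
  qed (use Cons.prems in auto)
  finally show ?case .
qed

text \<open>Each row but the last holds a single weight, for a single letter, and distinct rows use
  distinct columns. The Gram matrix is thus \<open>\<epsilon>\<^sup>2\<close> times the projection
  onto all coordinates but the last, and it stays below \<open>\<gamma>\<^sup>2\<close> for every
  smaller positive weight.\<close>

lemma row_gram_path_tuple:
  fixes v :: "'d::finite list"
  assumes "r \<le> length v" "c \<le> length v"
  shows "row_gram (Suc (length v)) (path_tuple \<epsilon> v) $$ (r, c)
    = (if r = c \<and> r < length v then of_real (\<epsilon>\<^sup>2) else 0)"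
proof -
  let ?n = "Suc (length v)"
  have entry: "(path_tuple \<epsilon> v j * mat_adjoint (path_tuple \<epsilon> v j)) $$ (r, c)
      = (if r = c \<and> r < length v \<and> v ! r = j then of_real (\<epsilon>\<^sup>2) else 0)" for j
  proof -
    note car = mat_tuplesD[OF path_tuple_mat_tuples[of \<epsilon> v], of j]
    have "(path_tuple \<epsilon> v j * mat_adjoint (path_tuple \<epsilon> v j)) $$ (r, c)
        = (\<Sum>s<?n. path_tuple \<epsilon> v j $$ (r, s) * cnj (path_tuple \<epsilon> v j $$ (c, s)))"
      using assms carrier_matD[OF car]
      by (subst index_mult_mat_sum[OF car mat_adjoint_carrier[OF car]])
        (auto simp: index_mat_adjoint simp del: sum.lessThan_Suc)
    also have "\<dots> = (\<Sum>s<?n. if s = Suc r then (if r = c \<and> v ! r = j then of_real (\<epsilon>\<^sup>2) else 0) else 0)"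
      using assms by (intro sum.cong) (auto simp: path_tuple_def power2_eq_square)
    finally show ?thesis by (auto simp del: sum.lessThan_Suc)
  qed
  have "row_gram ?n (path_tuple \<epsilon> v) $$ (r, c)
      = (\<Sum>j\<in>UNIV. (path_tuple \<epsilon> v j * mat_adjoint (path_tuple \<epsilon> v j)) $$ (r, c))"
    using assms by (simp add: row_gram_def)
  also have "\<dots> = (if r = c \<and> r < length v then of_real (\<epsilon>\<^sup>2) else 0)"
    unfolding entry by (cases "r = c \<and> r < length v") (auto intro!: sum.neutral)
  finally show ?thesis .
qed

lemma path_tuple_nc_ball:
  fixes v :: "'d::finite list"
  assumes "0 < \<epsilon>" "\<epsilon> < \<gamma>"
  shows "path_tuple \<epsilon> v \<in> nc_ball \<gamma> (Suc (length v))"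
proof -
  define n where "n = Suc (length v)"
  define A where "A = complex_of_real (\<gamma>\<^sup>2) \<cdot>\<^sub>m 1\<^sub>m n - row_gram n (path_tuple \<epsilon> v)"
  define d where "d r = (if r < length v then \<gamma>\<^sup>2 - \<epsilon>\<^sup>2 else \<gamma>\<^sup>2)" for r
  have d: "d r > 0" for r
    using assms by (auto simp: d_def power_strict_mono)
  have Ac: "A \<in> carrier_mat n n" unfolding A_def by (intro minus_carrier_mat) (simp add: row_gram_def)
  have A: "A $$ (r, c) = (if r = c then of_real (d r) else 0)" if "r < n" "c < n" for r c
    using that row_gram_path_tuple[of r v c \<epsilon>] by (auto simp: A_def d_def row_gram_def n_def)
  have "0 < (A *\<^sub>v x) \<bullet>c x" if x: "x \<in> carrier_vec n" "x \<noteq> 0\<^sub>v n" for x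
  proof -
    have Ax: "(A *\<^sub>v x) $ r = of_real (d r) * x $ r" if r: "r < n" for r
    proof -
      have "(A *\<^sub>v x) $ r = (\<Sum>s<n. A $$ (r, s) * x $ s)"
        using Ac x r by (simp add: scalar_prod_def lessThan_atLeast0)
      also have "\<dots> = (\<Sum>s<n. if s = r then of_real (d r) * x $ r else 0)"
        using r by (intro sum.cong) (auto simp: A)
      finally show ?thesis using r by (simp)
    qed
    have "(A *\<^sub>v x) \<bullet>c x = (\<Sum>r<n. (A *\<^sub>v x) $ r * cnj (x $ r))"
      using Ac x by (simp add: scalar_prod_def lessThan_atLeast0 del: index_mult_mat_vec)
    also have "\<dots> = (\<Sum>r<n. of_real (d r * (cmod (x $ r))\<^sup>2))"
      by (intro sum.cong) (simp_all only: Ax lessThan_iff of_real_mult complex_norm_square mult.assoc)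
    also have "\<dots> = of_real (\<Sum>r<n. d r * (cmod (x $ r))\<^sup>2)" by simp
    finally have eq: "(A *\<^sub>v x) \<bullet>c x = of_real (\<Sum>r<n. d r * (cmod (x $ r))\<^sup>2)" .
    obtain r where r: "r < n" "x $ r \<noteq> 0"
      using x by (metis carrier_vecD eq_vecI index_zero_vec)
    have "0 < (\<Sum>r<n. d r * (cmod (x $ r))\<^sup>2)"
      using r d by (intro sum_pos2[of _ r]) (auto simp: less_imp_le)
    then show ?thesis unfolding eq by (simp add: less_complex_def)
  qed
  with Ac show ?thesis
    by (simp add: nc_ball_def pos_definite_def A_def n_def)
qed

text \<open>The functional sending a coefficient T of \<open>v\<close> to the pairing of T
  \<open>x\<close> with \<open>y\<close>, again recorded by its values at rank-one
  operators.\<close>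

definition elem_functional :: "'d list \<Rightarrow> 'u::chilbert_space \<Rightarrow> 'u \<Rightarrow> 'd list \<Rightarrow> 'u \<Rightarrow> 'u \<Rightarrow> complex" where
  "elem_functional v x y = (\<lambda>w a b. if w = v then cinner x a * cinner b y else 0)"

lemma vinner_slices:
  assumes "g \<in> carrier_vec n" "k \<in> carrier_vec n"
  shows "vinner (slice a g) (slice b k) = (\<Sum>i<n. cinner (g $ i) a * cinner b (k $ i))"
proof -
  have "cnj (cinner (k $ i) b) = cinner b (k $ i)" for i
    by (subst (2) cinner_commute) simp
  then show ?thesis using assms by (simp add: vinner_def cinner_complex_def)
qed

text \<open>Expanding the pairing over words and coordinates expresses every test functional by
  elementary ones, so a linear functional on the test space is known from its values there.
  Nilpotency makes the expansion finite.\<close>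

lemma test_functional_eq_sum:
  fixes X :: "'d::finite \<Rightarrow> complex mat" and h k :: "'u::chilbert_space vec"
  assumes X: "X \<in> mat_tuples n" and nil: "nilpotent_order N n X"
    and h: "h \<in> carrier_vec n" and k: "k \<in> carrier_vec n"
  shows "test_functional \<Lambda> (n, X, h, k)
    = (\<Sum>v\<in>{v. length v < N} - \<Lambda>. \<Sum>i<n. elem_functional v (mact (word_mat n X v) h $ i) (k $ i))"
proof (intro ext)
  fix w a b
  have fin: "finite {v :: 'd list. length v < N}"
    using finite_lists_length_le[of UNIV N] by (rule finite_subset[rotated]) auto
  let ?g = "\<lambda>v. vinner (slice a (mact (word_mat n X v) h)) (slice b k)"
  have Wc: "word_mat n X v \<in> carrier_mat n n" for v by (rule word_mat_carrier[OF X])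
  have sum_apply: "(\<Sum>i\<in>I. F i) w a b = (\<Sum>i\<in>I. F i w a b)" for I and F :: "'i \<Rightarrow> 'd list \<Rightarrow> 'u \<Rightarrow> 'u \<Rightarrow> complex"
    by (induction I rule: infinite_finite_induct) auto
  have "(\<Sum>v\<in>{v. length v < N} - \<Lambda>. \<Sum>i<n. elem_functional v (mact (word_mat n X v) h $ i) (k $ i)) w a b
      = (\<Sum>v\<in>{v. length v < N} - \<Lambda>. if v = w then ?g w else 0)"
    unfolding sum_apply
    by (intro sum.cong refl) (auto simp: elem_functional_def vinner_slices[OF mact_carrier[OF Wc] k])
  also have "\<dots> = (if length w < N \<and> w \<notin> \<Lambda> then ?g w else 0)"
    using fin by simp
  also have "\<dots> = test_functional \<Lambda> (n, X, h, k) w a b"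
  proof (cases "length w < N")
    case True
    then show ?thesis
      using h carrier_matD[OF Wc] by (simp add: test_functional_def slice_mact)
  next
    case False
    then have "word_mat n X w = 0\<^sub>m n n" using nil by (simp add: nilpotent_order_def)
    then show ?thesis using False by (simp add: test_functional_def mact_zero_mat)
  qed
  finally show "test_functional \<Lambda> (n, X, h, k) w a b
    = (\<Sum>v\<in>{v. length v < N} - \<Lambda>. \<Sum>i<n. elem_functional v (mact (word_mat n X v) h $ i) (k $ i)) w a b"
    by simp
qed

lemma elem_functional_add_left:
  "elem_functional v (x + x') y = elem_functional v x y + elem_functional v x' y"
  by (auto simp: elem_functional_def fun_eq_iff cinner_add_left distrib_right)

lemma elem_functional_add_right:
  "elem_functional v x (y + y') = elem_functional v x y + elem_functional v x y'"
  by (auto simp: elem_functional_def fun_eq_iff cinner_add_right distrib_left)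

lemma elem_functional_scaleC:
  "elem_functional v (c *\<^sub>C x) y = elem_functional v x (cnj c *\<^sub>C y)"
  by (auto simp: elem_functional_def fun_eq_iff cinner_scaleC_left cinner_scaleC_right)

lemma elem_functional_scaleR:
  "elem_functional v x (r *\<^sub>R y) = r *\<^sub>R elem_functional v x y"
  by (auto simp: elem_functional_def fun_eq_iff scaleR_scaleC[of r y] cinner_scaleC_right
      scaleR_fun_def scaleR_conv_of_real)

text \<open>Put \<open>x\<close> at the end of the path spelling \<open>v\<close> and
  \<open>y\<close> at its start: \<open>v\<close> alone connects them, with weight
  \<open>(\<gamma> / 2) ^ length v\<close>. As \<open>v\<close> lies outside the segment, the
  polynomial drops out of the cost, and what remains bounds the coefficient of \<open>v\<close>. The
  weight \<open>\<gamma> / 2\<close> keeps the path strictly inside the ball.\<close>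

lemma elem_functional_test_data:
  fixes K :: "nat \<Rightarrow> ('d::finite \<Rightarrow> complex mat) set" and p :: "'d list \<Rightarrow> 'u::chilbert_space \<Rightarrow> 'u"
  assumes nbhd: "\<gamma> > 0" "\<And>n. n \<ge> 1 \<Longrightarrow> nc_ball \<gamma> n \<subseteq> K n"
    and p: "\<And>w. w \<in> \<Lambda> \<Longrightarrow> bounded_clinear (p w)" and v: "v \<notin> \<Lambda>"
  obtains n X h k where "(n, X, h, k) \<in> test_data K"
    "test_functional \<Lambda> (n, X, h, k) = (\<gamma> / 2) ^ length v *\<^sub>R elem_functional v x y"
    "test_cost \<Lambda> p C (n, X, h, k) = C * ((norm x)\<^sup>2 + (norm y)\<^sup>2) / 2"
proof -
  define m where "m = length v"
  define n where "n = Suc m"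
  have n0: "0 < n" by (simp add: n_def)
  define X where "X = path_tuple (\<gamma> / 2) v"
  define h where "h = vec n (\<lambda>i. if i = m then x else 0)"
  define k where "k = vec n (\<lambda>i. if i = 0 then y else 0)"
  have hk: "h \<in> carrier_vec n" "k \<in> carrier_vec n" by (simp_all add: h_def k_def)
  have XT: "X \<in> mat_tuples n" unfolding X_def n_def m_def by (rule path_tuple_mat_tuples)
  note Wd = carrier_matD[OF word_mat_carrier[OF XT]]
  have XK: "X \<in> K n"
    using nbhd(2)[of n] path_tuple_nc_ball[of "\<gamma> / 2" \<gamma> v] nbhd(1) by (auto simp: X_def n_def m_def)
  have entry: "word_mat n X w $$ (0, m) = (if w = v then of_real ((\<gamma> / 2) ^ length v) else 0)" for w
    using word_mat_path_tuple[of 0 v m "\<gamma> / 2" w] by (auto simp: X_def n_def m_def)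
  have "nilpotent_order n n X"
    unfolding nilpotent_order_def
  proof (intro allI impI eq_matI)
    fix w :: "'d list" and r c assume "length w \<ge> n" "r < dim_row (0\<^sub>m n n :: complex mat)" "c < dim_col (0\<^sub>m n n :: complex mat)"
    then show "word_mat n X w $$ (r, c) = 0\<^sub>m n n $$ (r, c)"
      using word_mat_path_tuple[of r v c "\<gamma> / 2" w] by (auto simp: X_def n_def m_def)
  qed (use Wd in auto)
  then have D: "(n, X, h, k) \<in> test_data K"
    using XK hk by (auto simp: test_data_def n_def)
  have mact0: "mact (word_mat n X w) h $ 0 = (if w = v then of_real ((\<gamma> / 2) ^ length v) *\<^sub>C x else 0)" for w
  proof -
    have "mact (word_mat n X w) h $ 0 = (\<Sum>i<n. word_mat n X w $$ (0, i) *\<^sub>C h $ i)"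
      using Wd n0 by (simp add: index_mact)
    also have "\<dots> = (\<Sum>i<n. if i = m then word_mat n X w $$ (0, m) *\<^sub>C x else 0)"
      by (intro sum.cong) (auto simp: h_def)
    also have "\<dots> = word_mat n X w $$ (0, m) *\<^sub>C x" by (simp add: n_def)
    finally show ?thesis by (simp add: entry)
  qed
  have pair: "(\<Sum>i<n. F i (k $ i)) = F 0 y" if "\<And>i. F i 0 = 0" for F :: "nat \<Rightarrow> 'u \<Rightarrow> complex"
  proof -
    have "(\<Sum>i<n. F i (k $ i)) = (\<Sum>i<n. if i = 0 then F 0 y else 0)"
      using that by (intro sum.cong) (auto simp: k_def)
    then show ?thesis using n0 by simp
  qed
  have T: "test_functional \<Lambda> (n, X, h, k) = (\<gamma> / 2) ^ length v *\<^sub>R elem_functional v x y"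
  proof (intro ext)
    fix w a b
    have "vinner (mact (word_mat n X w) (slice a h)) (slice b k)
        = (\<Sum>i<n. cinner (mact (word_mat n X w) h $ i) a * cinner b (k $ i))"
      using hk Wd by (simp add: slice_mact[symmetric] vinner_slices[OF mact_carrier[OF word_mat_carrier[OF XT]]])
    also have "\<dots> = cinner (mact (word_mat n X w) h $ 0) a * cinner b y"
      by (rule pair) simp
    finally show "test_functional \<Lambda> (n, X, h, k) w a b
        = ((\<gamma> / 2) ^ length v *\<^sub>R elem_functional v x y) w a b"
      using v by (auto simp: test_functional_def mact0 elem_functional_def scaleR_fun_def
          scaleR_conv_of_real cinner_scaleC_left)
  qed
  have "vinner (wsum n p X \<Lambda> h) k = cinner (wsum n p X \<Lambda> h $ 0) y"
    unfolding vinner_def dim_wsum by (rule pair) simp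
  also have "wsum n p X \<Lambda> h $ 0 = 0"
  proof -
    have "p w (mact (word_mat n X w) h $ 0) = 0" if "w \<in> \<Lambda>" for w
      using that v bounded_clinear_zero[OF p[OF that]] by (auto simp: mact0)
    then show ?thesis using n0 by (simp add: wsum_def)
  qed
  finally have "vinner (wsum n p X \<Lambda> h) k = 0" by simp
  moreover have "(tensor_norm h)\<^sup>2 = (\<Sum>i<n. if i = m then (norm x)\<^sup>2 else 0)"
    unfolding tensor_norm_square carrier_vecD[OF hk(1)] by (intro sum.cong) (auto simp: h_def)
  then have "(tensor_norm h)\<^sup>2 = (norm x)\<^sup>2" by (simp add: n_def)
  moreover have "(tensor_norm k)\<^sup>2 = (\<Sum>i<n. if i = 0 then (norm y)\<^sup>2 else 0)"
    unfolding tensor_norm_square carrier_vecD[OF hk(2)] by (intro sum.cong) (auto simp: k_def)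
  then have "(tensor_norm k)\<^sup>2 = (norm y)\<^sup>2" using n0 by simp
  ultimately have "test_cost \<Lambda> p C (n, X, h, k) = C * ((norm x)\<^sup>2 + (norm y)\<^sup>2) / 2"
    by (simp add: test_cost_def)
  from D T this show thesis by (rule that)
qed

text \<open>Undoes the arithmetic mean in the cost. Tested at the multiple \<open>s\<close> of
  \<open>g\<close>, the bound is sharpest for \<open>s = 1 / C\<close>; for \<open>C = 0\<close> any
  positive \<open>s\<close> shows that \<open>g\<close> vanishes.\<close>

lemma le_norm_of_quadratic_bound:
  fixes g h :: "'u::chilbert_space vec"
  assumes gh: "g \<in> carrier_vec n" and C: "C \<ge> 0"
    and le: "\<And>k. k \<in> carrier_vec n \<Longrightarrow> Re (vinner g k) \<le> C * ((tensor_norm h)\<^sup>2 + (tensor_norm k)\<^sup>2) / 2"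
  shows "tensor_norm g \<le> C * tensor_norm h"
proof -
  have main: "s * (tensor_norm g)\<^sup>2 \<le> C * ((tensor_norm h)\<^sup>2 + s\<^sup>2 * (tensor_norm g)\<^sup>2) / 2" for s
  proof -
    have "vinner g (vscale (of_real s) g) = of_real (s * (tensor_norm g)\<^sup>2)"
      by (simp add: vinner_vscale_right vinner_self)
    with le[of "vscale (of_real s) g"] gh show ?thesis
      by (simp add: tensor_norm_vscale power_mult_distrib)
  qed
  show ?thesis
  proof (cases "C = 0")
    case True
    then show ?thesis using main[of 1] by simp
  next
    case False
    with C have C: "C > 0" by simp
    have "(1 / C) * (tensor_norm g)\<^sup>2 \<le> C * ((tensor_norm h)\<^sup>2 + (1 / C)\<^sup>2 * (tensor_norm g)\<^sup>2) / 2"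
      by (rule main)
    then have "(tensor_norm g)\<^sup>2 \<le> (C * tensor_norm h)\<^sup>2"
      using C by (simp add: field_simps power2_eq_square)
    then show ?thesis by (rule power2_le_imp_le) (use C in simp)
  qed
qed

text \<open>On a test functional, the separating functional is the real part of the pairing
  contributed by the new coefficients, and the polynomial part already sits in the cost with a minus
  sign. Moving it across bounds the whole pairing by
  \<open>C * ((tensor_norm h)\<^sup>2 + (tensor_norm k)\<^sup>2) / 2\<close> for all
  \<open>k\<close>, hence the norm.\<close>

lemma nilpotent_extension:
  fixes K :: "nat \<Rightarrow> ('d::finite \<Rightarrow> complex mat) set" and p :: "'d list \<Rightarrow> 'u::chilbert_space \<Rightarrow> 'u"
  assumes K: "matrix_convex K" and nbhd: "contains_nc_nbhd_0 K"
    and fin: "finite \<Lambda>" and seg: "initial_segment \<Lambda>"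
    and p: "\<And>w. w \<in> \<Lambda> \<Longrightarrow> bounded_clinear (p w)" and C: "C \<ge> 0"
    and bound: "\<And>n X h. n \<ge> 1 \<Longrightarrow> X \<in> K n \<Longrightarrow> nc_nilpotent \<Lambda> n X \<Longrightarrow> h \<in> carrier_vec n \<Longrightarrow>
      tensor_norm (wsum n p X \<Lambda> h) \<le> C * tensor_norm h"
  obtains x where "\<forall>w. bounded_clinear (x w)" "\<forall>w\<in>\<Lambda>. x w = p w"
    "\<forall>n\<ge>1. \<forall>X\<in>K n. \<forall>N. nilpotent_order N n X \<longrightarrow> (\<forall>h\<in>carrier_vec n.
      tensor_norm (wsum n x X {w. length w < N} h) \<le> C * tensor_norm h)"
proof -
  obtain \<gamma> where \<gamma>: "\<gamma> > 0" "\<And>n. n \<ge> 1 \<Longrightarrow> nc_ball \<gamma> n \<subseteq> K n"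
    using nbhd unfolding contains_nc_nbhd_0_def by blast
  have ne: "test_data K \<noteq> ({} :: (nat \<times> _ \<times> 'u vec \<times> 'u vec) set)"
  \<comment> \<open>The path of the empty word is the zero tuple at level one. The empty segment is
    chosen so that the empty word counts as lying outside.\<close>
  proof (rule elem_functional_test_data[OF \<gamma>, where \<Lambda> = "{}" and v = "[]"])
    fix n X and h k :: "'u vec" assume "(n, X, h, k) \<in> test_data K"
    then show ?thesis by blast
  qed auto
  obtain \<phi> where lin: "linear \<phi>" and
    le: "\<forall>x\<in>test_data K. \<phi> (test_functional \<Lambda> x) \<le> test_cost \<Lambda> p C x"
    by (rule test_functional_dominated[OF K seg p C bound ne])
  have "\<exists>T. bounded_clinear T \<and> (\<forall>a b. \<phi> (elem_functional v a b) = Re (cinner (T a) b))" if v: "v \<notin> \<Lambda>" for v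
  proof -
    define c where "c = (\<gamma> / 2) ^ length v"
    have c: "c > 0" using \<gamma>(1) by (simp add: c_def)
    have "\<phi> (elem_functional v a b) \<le> C / (2 * c) * ((norm a)\<^sup>2 + (norm b)\<^sup>2)" for a b
    proof -
      obtain n X h k where D: "(n, X, h, k) \<in> test_data K"
        "test_functional \<Lambda> (n, X, h, k) = c *\<^sub>R elem_functional v a b"
        "test_cost \<Lambda> p C (n, X, h, k) = C * ((norm a)\<^sup>2 + (norm b)\<^sup>2) / 2"
        unfolding c_def by (rule elem_functional_test_data[OF \<gamma> p v])
      have "c * \<phi> (elem_functional v a b) \<le> C * ((norm a)\<^sup>2 + (norm b)\<^sup>2) / 2"
        using bspec[OF le D(1)] unfolding D(2,3) by (simp add: linear_scale[OF lin])
      then show ?thesis using c by (simp add: field_simps)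
    qed
    then obtain T where "bounded_clinear T" "\<And>a b. \<phi> (elem_functional v a b) = Re (cinner (T a) b)"
      by (rule bounded_clinear_riesz[where g = "\<lambda>a b. \<phi> (elem_functional v a b)", rotated 4])
        (simp_all add: elem_functional_add_left elem_functional_add_right elem_functional_scaleC
          elem_functional_scaleR linear_add[OF lin] linear_scale[OF lin])
    then show ?thesis by blast
  qed
  then obtain T where T: "\<And>v. v \<notin> \<Lambda> \<Longrightarrow> bounded_clinear (T v)"
    "\<And>v a b. v \<notin> \<Lambda> \<Longrightarrow> \<phi> (elem_functional v a b) = Re (cinner (T v a) b)"
    by metis
  define x where "x w = (if w \<in> \<Lambda> then p w else T w)" for w
  have x: "bounded_clinear (x w)" for w using T(1) p by (simp add: x_def)
  have "tensor_norm (wsum n x X {w. length w < N} h) \<le> C * tensor_norm h"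
    if n: "n \<ge> 1" and X: "X \<in> K n" and nil: "nilpotent_order N n X" and h: "h \<in> carrier_vec n" for n N X h
  proof (rule le_norm_of_quadratic_bound[OF wsum_carrier C])
    fix k :: "'u vec" assume k: "k \<in> carrier_vec n"
    have XT: "X \<in> mat_tuples n" using K n X by (auto simp: matrix_convex_def)
    have D: "(n, X, h, k) \<in> test_data K" using n X nil h k by (auto simp: test_data_def)
    let ?V = "\<lambda>w. mact (word_mat n X w) h"
    let ?S = "{w :: 'd list. length w < N}"
    have finS: "finite ?S"
      using finite_lists_length_le[of "UNIV :: 'd set" N] by (rule finite_subset[rotated]) auto
    have V: "?V w \<in> carrier_vec n" for w by (rule mact_carrier[OF word_mat_carrier[OF XT]])
    have "\<phi> (test_functional \<Lambda> (n, X, h, k))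
        = (\<Sum>v\<in>?S - \<Lambda>. \<Sum>i<n. \<phi> (elem_functional v (?V v $ i) (k $ i)))"
      unfolding test_functional_eq_sum[OF XT nil h k] using lin by (simp add: linear_sum)
    also have "\<dots> = (\<Sum>v\<in>?S - \<Lambda>. Re (vinner (map_vec (x v) (?V v)) k))"
      using T(2) carrier_vecD[OF V] by (intro sum.cong) (auto simp: vinner_def x_def)
    finally have 1: "\<phi> (test_functional \<Lambda> (n, X, h, k))
        = (\<Sum>v\<in>?S - \<Lambda>. Re (vinner (map_vec (x v) (?V v)) k))" .
    have "Re (vinner (wsum n p X \<Lambda> h) k) = (\<Sum>v\<in>\<Lambda>. Re (vinner (map_vec (x v) (?V v)) k))"
      unfolding vinner_wsum[OF XT] by (simp add: x_def)
    \<comment> \<open>Words of the segment of length at least \<open>N\<close> vanish at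
      \<open>X\<close>, so cutting the sum at \<open>N\<close> costs nothing even if the segment
      contains longer words.\<close>
    also have "\<dots> = (\<Sum>v\<in>?S \<inter> \<Lambda>. Re (vinner (map_vec (x v) (?V v)) k))"
    proof (rule sum.mono_neutral_right[OF fin])
      show "\<forall>v\<in>\<Lambda> - ?S \<inter> \<Lambda>. Re (vinner (map_vec (x v) (?V v)) k) = 0"
      proof
        fix v assume "v \<in> \<Lambda> - ?S \<inter> \<Lambda>"
        then have "word_mat n X v = 0\<^sub>m n n" using nil by (auto simp: nilpotent_order_def)
        then have "map_vec (x v) (?V v) = 0\<^sub>v n"
          using bounded_clinear_zero[OF x] by (intro eq_vecI) (auto simp: mact_zero_mat)
        then show "Re (vinner (map_vec (x v) (?V v)) k) = 0" by simp
      qed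
    qed auto
    finally have 2: "Re (vinner (wsum n p X \<Lambda> h) k) = (\<Sum>v\<in>?S \<inter> \<Lambda>. Re (vinner (map_vec (x v) (?V v)) k))" .
    have "Re (vinner (wsum n x X ?S h) k) = (\<Sum>v\<in>?S. Re (vinner (map_vec (x v) (?V v)) k))"
      unfolding vinner_wsum[OF XT] by simp
    also have "\<dots> = (\<Sum>v\<in>?S \<inter> \<Lambda>. Re (vinner (map_vec (x v) (?V v)) k))
        + (\<Sum>v\<in>?S - \<Lambda>. Re (vinner (map_vec (x v) (?V v)) k))"
      by (rule sum.Int_Diff[OF finS])
    finally show "Re (vinner (wsum n x X ?S h) k) \<le> C * ((tensor_norm h)\<^sup>2 + (tensor_norm k)\<^sup>2) / 2"
      using bspec[OF le D] 1 2 by (simp add: test_cost_def)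
  qed
  then show thesis
    using x by (intro that[of x] ballI allI impI) (simp_all add: x_def)
qed

section \<open>Tensoring with a shift\<close>

text \<open>Index convention for C^L tensor C^n: position \<open>s * n + i\<close> is coordinate
  \<open>i\<close> of block \<open>s\<close>, recovered by \<open>div n\<close> and
  \<open>mod n\<close>.\<close>

lemma sum_blocks:
  fixes f :: "nat \<Rightarrow> 'a::comm_monoid_add"
  shows "(\<Sum>a<L * n. f a) = (\<Sum>s<L. \<Sum>i<n. f (s * n + i))"
proof (induction L)
  case (Suc L)
  have "(\<Sum>a<Suc L * n. f a) = (\<Sum>a<L * n + n. f a)" by (simp add: add.commute)
  then show ?case by (simp add: sum_lessThan_add Suc)
qed simp

lemma block_index:
  fixes n :: nat
  assumes "i < n"
  shows "(s * n + i) div n = s" "(s * n + i) mod n = i"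
  using assms by auto

lemma block_index_less:
  fixes s i n L :: nat
  assumes "s < L" "i < n"
  shows "s * n + i < L * n"
proof -
  have "s * n + i < Suc s * n" using assms(2) by simp
  also have "\<dots> \<le> L * n" using assms(1) by (intro mult_le_mono1) simp
  finally show ?thesis .
qed

lemma sum_blocks_div_mod:
  fixes f :: "nat \<Rightarrow> nat \<Rightarrow> 'a::comm_monoid_add"
  shows "(\<Sum>a<L * n. f (a div n) (a mod n)) = (\<Sum>s<L. \<Sum>i<n. f s i)"
  unfolding sum_blocks by (intro sum.cong refl) (simp add: block_index)

text \<open>Orthogonality of the characters of the cyclic group of order \<open>L\<close>. The bound
  on \<open>k\<close> excludes the nonzero multiples of \<open>L\<close>, for which the sum would be
  \<open>L\<close> too.\<close>

lemma sum_roots_of_unity: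
  fixes k :: int
  assumes k: "\<bar>k\<bar> < int L"
  shows "(\<Sum>s<L. cis (2 * pi * of_int k / of_nat L) ^ s) = (if k = 0 then of_nat L else 0)"
proof (cases "k = 0")
  case False
  let ?z = "cis (2 * pi * of_int k / of_nat L)"
  have L: "L > 0" using k by linarith
  have "?z \<noteq> 1"
  proof
    assume "?z = 1"
    then have "cos (2 * pi * of_int k / of_nat L) = 1" by (simp add: complex_eq_iff)
    then obtain m :: int where "2 * pi * of_int k / of_nat L = of_int m * 2 * pi"
      unfolding cos_one_2pi_int by auto
    then have "(of_int k :: real) = of_int (m * int L)" using L by (simp add: field_simps)
    then have km: "k = m * int L" by (simp only: of_int_eq_iff)
    then have "\<bar>m\<bar> * int L < 1 * int L" using k by (simp add: abs_mult)
    then have "m = 0" using L by simp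
    then show False using km False by simp
  qed
  moreover have "?z ^ L = 1"
    using L cis_multiple_2pi[of "of_int k"] by (simp add: DeMoivre field_simps)
  ultimately show ?thesis using False by (simp add: geometric_sum)
qed simp

definition block_diag_tuple :: "nat \<Rightarrow> nat \<Rightarrow> (nat \<Rightarrow> real) \<Rightarrow> ('d \<Rightarrow> complex mat) \<Rightarrow> 'd \<Rightarrow> complex mat" where
  "block_diag_tuple L n \<theta> X j = mat (L * n) (L * n) (\<lambda>(a, b).
     if a div n = b div n then cis (\<theta> (a div n)) * X j $$ (a mod n, b mod n) else 0)"

text \<open>The truncated shift tensored with X. Each letter moves one block on, so the degree of a
  word becomes a block displacement, and words of length \<open>N\<close> leave the space.\<close>

definition shift_tuple :: "nat \<Rightarrow> nat \<Rightarrow> ('d \<Rightarrow> complex mat) \<Rightarrow> 'd \<Rightarrow> complex mat" where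
  "shift_tuple N n X j = mat (N * n) (N * n) (\<lambda>(a, b).
     if a div n = Suc (b div n) then X j $$ (a mod n, b mod n) else 0)"

text \<open>A direct sum of rotated copies of \<open>X\<close>: circledness puts each copy into
  \<open>K\<close>, and direct sums keep them there.\<close>

lemma block_diag_tuple_mem:
  assumes K: "matrix_convex K" "circled K" and n: "n \<ge> 1" and X: "X \<in> K n" and L: "L \<ge> 1"
  shows "block_diag_tuple L n \<theta> X \<in> K (L * n)"
  using L
proof (induction L rule: dec_induct)
  case base
  have XT: "X \<in> mat_tuples n" using K n X by (auto simp: matrix_convex_def)
  have "block_diag_tuple 1 n \<theta> X = (\<lambda>j. exp (\<i> * complex_of_real (\<theta> 0)) \<cdot>\<^sub>m X j)"
    using carrier_matD[OF mat_tuplesD[OF XT]]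
    by (intro ext eq_matI) (auto simp: block_diag_tuple_def cis_conv_exp)
  then show ?case using K(2) n X by (simp add: circled_def)
next
  case (step L)
  have XT: "X \<in> mat_tuples n" using K n X by (auto simp: matrix_convex_def)
  note d = carrier_matD[OF mat_tuplesD[OF XT]]
  let ?R = "\<lambda>j. exp (\<i> * complex_of_real (\<theta> L)) \<cdot>\<^sub>m X j"
  have R: "?R \<in> K n" using K(2) n X by (simp add: circled_def)
  have "block_diag_tuple (Suc L) n \<theta> X = (\<lambda>j. mat_direct_sum (block_diag_tuple L n \<theta> X j) (?R j))"
  proof (intro ext eq_matI, goal_cases)
    case (1 j a b)
    then have ab: "a < L * n + n" "b < L * n + n"
      using d by (auto simp: mat_direct_sum_def block_diag_tuple_def)
    have low: "c div n < L" if "c < L * n" for c using that by (simp add: less_mult_imp_div_less)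
    have high: "c div n = L" "c mod n = c - L * n" if "\<not> c < L * n" "c < L * n + n" for c
    proof -
      have "c = L * n + (c - L * n)" "c - L * n < n" using that by auto
      then show "c div n = L" "c mod n = c - L * n" by (metis block_index)+
    qed
    show ?case
      using ab d low[of a] low[of b] high[of a] high[of b]
      by (cases "a < L * n"; cases "b < L * n")
        (auto simp: mat_direct_sum_def block_diag_tuple_def cis_conv_exp)
  qed (use d in \<open>auto simp: mat_direct_sum_def block_diag_tuple_def\<close>)
  moreover have "L * n \<ge> 1" using step.hyps n by simp
  ultimately have "block_diag_tuple (Suc L) n \<theta> X \<in> K (L * n + n)"
    using K(1) step.IH R n unfolding matrix_convex_def by simp
  then show ?case by (simp add: add.commute)
qed

text \<open>The shift is a compression of the cyclic shift, which is unitarily equivalent to the diagonal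
  matrix of roots of unity.\<close>

lemma shift_tuple_mem:
  assumes K: "matrix_convex K" "circled K" and n: "n \<ge> 1" and X: "X \<in> K n" and N: "N \<ge> 1"
  shows "shift_tuple N n X \<in> K (N * n)"
proof -
  have XT: "X \<in> mat_tuples n" using K n X by (auto simp: matrix_convex_def)
  \<comment> \<open>One block more than the shift has. For block indices t, t' below
    \<open>N\<close>, the frequency t' + 1 - t then has absolute value below \<open>L\<close>, so
    the cyclic shift cannot wrap round inside the compression.\<close>
  define L where "L = Suc N"
  define \<omega> where "\<omega> k = 2 * pi * of_int k / of_nat L" for k
  define Z where "Z = block_diag_tuple L n (\<lambda>s. \<omega> (int s)) X"
  \<comment> \<open>\<open>N\<close> of the \<open>L\<close> columns of the unitary Fourier matrix,
    tensored with the identity. In this basis multiplication by the roots of unity raises the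
    frequency by one, which is the shift.\<close>
  define V where "V = mat (L * n) (N * n) (\<lambda>(a, b).
    if a mod n = b mod n then cis (\<omega> (int (b div n))) ^ (a div n) / of_real (sqrt (of_nat L)) else 0)"
  have Vc: "V \<in> carrier_mat (L * n) (N * n)" by (simp add: V_def)
  have Zc: "Z j \<in> carrier_mat (L * n) (L * n)" for j by (simp add: Z_def block_diag_tuple_def)
  have L0: "L > 0" by (simp add: L_def)
  have ZK: "Z \<in> K (L * n)"
    unfolding Z_def using L0 by (intro block_diag_tuple_mem K n X) simp
  have sq: "complex_of_real (sqrt (of_nat L)) * complex_of_real (sqrt (of_nat L)) = of_nat L"
    by (simp flip: of_real_mult)
  have V: "V $$ (s * n + i, b) = (if i = b mod n then cis (\<omega> (int (b div n))) ^ s / of_real (sqrt (of_nat L)) else 0)"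
    if "s < L" "i < n" "b < N * n" for s i b
    using that block_index_less[of s L i n] by (simp add: V_def block_index)
  have divN: "b div n < N" if "b < N * n" for b using that by (simp add: less_mult_imp_div_less)
  have modn: "b mod n < n" for b using n by simp
  have cis_mult_power: "cnj (cis (\<omega> k) ^ s) * (cis (\<omega> l) ^ s) = cis (\<omega> (l - k)) ^ s" for k l s
    by (simp add: cis_cnj cis_mult \<omega>_def power_mult_distrib[symmetric] diff_divide_distrib algebra_simps)
  have root: "(\<Sum>s<L. cis (\<omega> k) ^ s) = (if k = 0 then of_nat L else 0)" if "\<bar>k\<bar> < int L" for k
    unfolding \<omega>_def by (rule sum_roots_of_unity[OF that])
  have iso: "mat_adjoint V * V = 1\<^sub>m (N * n)"
  proof (rule eq_matI)
    fix b b' assume "b < dim_row (1\<^sub>m (N * n) :: complex mat)" "b' < dim_col (1\<^sub>m (N * n) :: complex mat)"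
    then have b: "b < N * n" "b' < N * n" by auto
    let ?t = "int (b div n)" and ?t' = "int (b' div n)"
    have "(mat_adjoint V * V) $$ (b, b') = (\<Sum>a<L * n. cnj (V $$ (a, b)) * V $$ (a, b'))"
      using b carrier_matD[OF Vc]
      by (subst index_mult_mat_sum[OF mat_adjoint_carrier[OF Vc] Vc]) (auto simp: index_mat_adjoint)
    also have "\<dots> = (\<Sum>s<L. \<Sum>i<n. if i = b mod n then (if b mod n = b' mod n then cis (\<omega> (?t' - ?t)) ^ s / of_nat L else 0) else 0)"
      unfolding sum_blocks using b
      by (intro sum.cong refl) (auto simp: V sq cis_mult_power[symmetric])
    also have "\<dots> = (if b mod n = b' mod n then (\<Sum>s<L. cis (\<omega> (?t' - ?t)) ^ s) / of_nat L else 0)"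
      using modn[of b] by (simp add: sum_divide_distrib)
    also have "\<dots> = (if b mod n = b' mod n \<and> b div n = b' div n then 1 else 0)"
      using divN[OF b(1)] divN[OF b(2)] L0 by (subst root) (auto simp: L_def simp del: of_nat_Suc)
    also have "\<dots> = 1\<^sub>m (N * n) $$ (b, b')"
      using b by (metis div_mult_mod_eq index_one_mat(1))
    finally show "(mat_adjoint V * V) $$ (b, b') = 1\<^sub>m (N * n) $$ (b, b')" .
  qed (use Vc in auto)
  have "mat_adjoint V * Z j * V = shift_tuple N n X j" for j
  proof (rule eq_matI)
    fix b b' assume "b < dim_row (shift_tuple N n X j)" "b' < dim_col (shift_tuple N n X j)"
    then have b: "b < N * n" "b' < N * n" by (auto simp: shift_tuple_def)
    let ?t = "int (b div n)" and ?t' = "int (b' div n)"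
    have Zi: "Z j $$ (s * n + i, s' * n + i') = (if s' = s then cis (\<omega> (int s)) * X j $$ (i, i') else 0)"
      if "s < L" "i < n" "s' < L" "i' < n" for s i s' i'
      using that block_index_less[of s L i n] block_index_less[of s' L i' n]
      by (simp add: Z_def block_diag_tuple_def block_index)
    have ZV: "(Z j * V) $$ (s * n + i, b')
        = cis (\<omega> (int s)) * X j $$ (i, b' mod n) * (cis (\<omega> ?t') ^ s / of_real (sqrt (of_nat L)))"
      if s: "s < L" "i < n" for s i
    proof -
      have "(Z j * V) $$ (s * n + i, b') = (\<Sum>a<L * n. Z j $$ (s * n + i, a) * V $$ (a, b'))"
        using b block_index_less[OF s] by (intro index_mult_mat_sum[OF Zc Vc]) auto
      also have "\<dots> = (\<Sum>s'<L. \<Sum>i'<n. if i' = b' mod n then (if s' = s then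
          cis (\<omega> (int s)) * X j $$ (i, b' mod n) * (cis (\<omega> ?t') ^ s / of_real (sqrt (of_nat L))) else 0) else 0)"
        unfolding sum_blocks using b s by (intro sum.cong refl) (auto simp: V Zi)
      also have "\<dots> = cis (\<omega> (int s)) * X j $$ (i, b' mod n) * (cis (\<omega> ?t') ^ s / of_real (sqrt (of_nat L)))"
        using modn[of b'] s by simp
      finally show ?thesis .
    qed
    have cis_s: "cis (\<omega> (int s)) = cis (\<omega> 1) ^ s" for s
      by (simp add: DeMoivre \<omega>_def mult.commute)
    \<comment> \<open>The conjugate of mode t, the diagonal entry (mode 1) and mode t' multiply to
      mode t' + 1 - t; summed over the blocks it survives only for t = t' + 1.\<close>
    have comb: "cnj (cis (\<omega> ?t) ^ s / of_real (sqrt (of_nat L))) * (cis (\<omega> (int s)) * x * (cis (\<omega> ?t') ^ s / of_real (sqrt (of_nat L))))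
        = cis (\<omega> (?t' + 1 - ?t)) ^ s / of_nat L * x" for s x
    proof -
      have "cis (\<omega> (?t' + 1)) = cis (\<omega> 1) * cis (\<omega> ?t')"
        by (simp add: cis_mult \<omega>_def add_divide_distrib algebra_simps)
      then have "cis (\<omega> (?t' + 1 - ?t)) ^ s = cnj (cis (\<omega> ?t) ^ s) * (cis (\<omega> (int s)) * cis (\<omega> ?t') ^ s)"
        using cis_mult_power[of ?t s "?t' + 1"] by (simp only: cis_s power_mult_distrib)
      then show ?thesis by (simp add: sq[symmetric])
    qed
    have "(mat_adjoint V * Z j * V) $$ (b, b') = (mat_adjoint V * (Z j * V)) $$ (b, b')"
      by (simp add: assoc_mult_mat[OF mat_adjoint_carrier[OF Vc] Zc Vc])
    also have "\<dots> = (\<Sum>a<L * n. cnj (V $$ (a, b)) * (Z j * V) $$ (a, b'))"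
      using b carrier_matD[OF Vc]
      by (subst index_mult_mat_sum[OF mat_adjoint_carrier[OF Vc] mult_carrier_mat[OF Zc Vc]])
        (auto simp: index_mat_adjoint)
    also have "\<dots> = (\<Sum>s<L. \<Sum>i<n. if i = b mod n then
        cis (\<omega> (?t' + 1 - ?t)) ^ s / of_nat L * X j $$ (b mod n, b' mod n) else 0)"
      unfolding sum_blocks
    proof (intro sum.cong refl)
      fix s i assume "s \<in> {..<L}" "i \<in> {..<n}"
      then have si: "s < L" "i < n" by auto
      show "cnj (V $$ (s * n + i, b)) * (Z j * V) $$ (s * n + i, b') = (if i = b mod n then
          cis (\<omega> (?t' + 1 - ?t)) ^ s / of_nat L * X j $$ (b mod n, b' mod n) else 0)"
      proof (cases "i = b mod n")
        case True
        then show ?thesis unfolding V[OF si b(1)] ZV[OF si] if_P[OF True] comb by simp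
      next
        case False
        then show ?thesis by (simp add: V[OF si b(1)])
      qed
    qed
    also have "\<dots> = (\<Sum>s<L. cis (\<omega> (?t' + 1 - ?t)) ^ s) / of_nat L * X j $$ (b mod n, b' mod n)"
      using modn[of b] by (simp add: sum_divide_distrib sum_distrib_right)
    also have "\<dots> = (if b div n = Suc (b' div n) then 1 else 0) * X j $$ (b mod n, b' mod n)"
      using divN[OF b(1)] divN[OF b(2)] L0 by (subst root) (auto simp: L_def simp del: of_nat_Suc)
    also have "\<dots> = shift_tuple N n X j $$ (b, b')"
      using b by (simp add: shift_tuple_def)
    finally show "(mat_adjoint V * Z j * V) $$ (b, b') = shift_tuple N n X j $$ (b, b')" .
  qed (use Vc Zc in \<open>auto simp: shift_tuple_def\<close>)
  then have "(\<lambda>j. mat_adjoint V * Z j * V) = shift_tuple N n X" by blast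
  moreover have "(\<lambda>j. mat_adjoint V * Z j * V) \<in> K (N * n)"
  proof -
    have "L * n \<ge> 1" "N * n \<ge> 1" using n N L0 by simp_all
    then show ?thesis using K(1) ZK Vc iso unfolding matrix_convex_def by blast
  qed
  ultimately show ?thesis by simp
qed

lemma shift_tuple_mat_tuples [simp]: "shift_tuple N n X \<in> mat_tuples (N * n)"
  by (simp add: shift_tuple_def mat_tuples_def)

lemma word_mat_shift_tuple:
  assumes X: "X \<in> mat_tuples n" and a: "a < N * n" and b: "b < N * n"
  shows "word_mat (N * n) (shift_tuple N n X) w $$ (a, b)
    = (if a div n = b div n + length w then word_mat n X w $$ (a mod n, b mod n) else 0)"
  using a
proof (induction w arbitrary: a)
  case Nil
  have "a mod n < n" "b mod n < n" using Nil b by (auto intro!: mod_less_divisor gr0I)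
  moreover have "a = b \<longleftrightarrow> a div n = b div n \<and> a mod n = b mod n"
    by (metis div_mult_mod_eq)
  ultimately show ?case using Nil b by auto
next
  case (Cons j w)
  have n: "n > 0" using b by (cases n) auto
  let ?Y = "shift_tuple N n X" and ?W = "word_mat (N * n) (shift_tuple N n X) w"
  have aN: "a div n < N" using Cons.prems by (simp add: less_mult_imp_div_less)
  have "word_mat (N * n) ?Y (j # w) $$ (a, b) = (\<Sum>c<N * n. ?Y j $$ (a, c) * ?W $$ (c, b))"
    unfolding word_mat_Cons using Cons.prems b
    by (intro index_mult_mat_sum[OF mat_tuplesD[OF shift_tuple_mat_tuples] word_mat_carrier[OF shift_tuple_mat_tuples]])
  also have "\<dots> = (\<Sum>c<N * n. (if a div n = Suc (c div n) then X j $$ (a mod n, c mod n) else 0) *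
      (if c div n = b div n + length w then word_mat n X w $$ (c mod n, b mod n) else 0))"
    using Cons.prems by (intro sum.cong refl) (simp add: Cons.IH shift_tuple_def)
  also have "\<dots> = (\<Sum>s<N. \<Sum>i<n. (if a div n = Suc s then X j $$ (a mod n, i) else 0) *
      (if s = b div n + length w then word_mat n X w $$ (i, b mod n) else 0))"
    by (rule sum_blocks_div_mod)
  also have "\<dots> = (\<Sum>s<N. if s = b div n + length w then (if a div n = b div n + length (j # w) then
      (\<Sum>i<n. X j $$ (a mod n, i) * word_mat n X w $$ (i, b mod n)) else 0) else 0)"
    by (intro sum.cong refl) auto
  also have "\<dots> = (if a div n = b div n + length (j # w) then
      (\<Sum>i<n. X j $$ (a mod n, i) * word_mat n X w $$ (i, b mod n)) else 0)"
    using aN by auto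
  also have "(\<Sum>i<n. X j $$ (a mod n, i) * word_mat n X w $$ (i, b mod n)) = word_mat n X (j # w) $$ (a mod n, b mod n)"
    unfolding word_mat_Cons using n
    by (intro index_mult_mat_sum[OF mat_tuplesD[OF X] word_mat_carrier[OF X], symmetric]) auto
  finally show ?case .
qed

lemma nilpotent_order_shift_tuple:
  assumes X: "X \<in> mat_tuples n"
  shows "nilpotent_order N (N * n) (shift_tuple N n X)"
  unfolding nilpotent_order_def
proof (intro allI impI eq_matI)
  fix w :: "'a list" and a b
  assume "N \<le> length w" and ab: "a < dim_row (0\<^sub>m (N * n) (N * n) :: complex mat)"
    "b < dim_col (0\<^sub>m (N * n) (N * n) :: complex mat)"
  moreover have "a div n < N" using ab by (simp add: less_mult_imp_div_less)
  ultimately show "word_mat (N * n) (shift_tuple N n X) w $$ (a, b) = 0\<^sub>m (N * n) (N * n) $$ (a, b)"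
    by (simp add: word_mat_shift_tuple[OF X])
qed (simp_all add: carrier_matD[OF word_mat_carrier[OF shift_tuple_mat_tuples[of N n X]]])

section \<open>Toeplitz structure of the series at a shifted tuple\<close>

definition weighted_copies :: "nat \<Rightarrow> nat \<Rightarrow> (nat \<Rightarrow> complex) \<Rightarrow> 'u::chilbert_space vec \<Rightarrow> 'u vec" where
  "weighted_copies N n c h = vec (N * n) (\<lambda>a. c (a div n) *\<^sub>C h $ (a mod n))"

text \<open>Block \<open>s\<close> of the series at the shifted tuple, applied to \<open>c\<close>
  tensor \<open>h\<close>: the convolution of the weights \<open>c\<close> with the homogeneous
  parts of the series at \<open>X\<close>.\<close>

definition toeplitz_row :: "nat \<Rightarrow> ('d::finite list \<Rightarrow> 'u::chilbert_space \<Rightarrow> 'u) \<Rightarrow> ('d \<Rightarrow> complex mat) \<Rightarrow>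
    (nat \<Rightarrow> complex) \<Rightarrow> 'u vec \<Rightarrow> nat \<Rightarrow> 'u vec" where
  "toeplitz_row n f X c h s = vec n (\<lambda>i. \<Sum>w | length w \<le> s.
     c (s - length w) *\<^sub>C f w (mact (word_mat n X w) h $ i))"

lemma tensor_norm_blocks:
  assumes g: "g \<in> carrier_vec (N * n)"
  shows "(tensor_norm g)\<^sup>2 = (\<Sum>s<N. (tensor_norm (vec n (\<lambda>i. g $ (s * n + i))))\<^sup>2)"
  unfolding tensor_norm_square carrier_vecD[OF g] sum_blocks by simp

lemma tensor_norm_weighted_copies:
  assumes h: "h \<in> carrier_vec n"
  shows "(tensor_norm (weighted_copies N n c h))\<^sup>2 = (\<Sum>s<N. (cmod (c s))\<^sup>2) * (tensor_norm h)\<^sup>2"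
proof -
  have "vec n (\<lambda>i. weighted_copies N n c h $ (s * n + i)) = vscale (c s) h" if "s < N" for s
    using that h block_index_less[of s N _ n]
    by (intro eq_vecI) (auto simp: weighted_copies_def block_index)
  then show ?thesis
    by (subst tensor_norm_blocks[of _ N n])
      (auto simp: weighted_copies_def tensor_norm_vscale power_mult_distrib sum_distrib_right)
qed

lemma finite_words_less: "finite {w :: 'd::finite list. length w < N}"
  using finite_lists_length_le[of "UNIV :: 'd set" N] by (rule finite_subset[rotated]) auto

lemma finite_words_le: "finite {w :: 'd::finite list. length w \<le> N}"
  using finite_lists_length_le[of "UNIV :: 'd set" N] by (rule finite_subset[rotated]) auto

lemma wsum_shift_tuple:
  fixes X :: "'d::finite \<Rightarrow> complex mat"
  assumes X: "X \<in> mat_tuples n" and h: "h \<in> carrier_vec n" and f: "\<And>w. bounded_clinear (f w)"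
    and s: "s < N" and i: "i < n"
  shows "wsum (N * n) f (shift_tuple N n X) {w. length w < N} (weighted_copies N n c h) $ (s * n + i)
    = toeplitz_row n f X c h s $ i"
proof -
  let ?Y = "shift_tuple N n X" and ?a = "s * n + i"
  have a: "?a < N * n" by (rule block_index_less[OF s i])
  have Wd: "dim_row (word_mat n X w) = n" "dim_col (word_mat n X w) = n"
    "dim_row (word_mat (N * n) ?Y w) = N * n" "dim_col (word_mat (N * n) ?Y w) = N * n" for w
    using carrier_matD[OF word_mat_carrier[OF X]]
      carrier_matD[OF word_mat_carrier[OF shift_tuple_mat_tuples[of N n X]]] by auto
  have act: "mact (word_mat (N * n) ?Y w) (weighted_copies N n c h) $ ?a
      = (if length w \<le> s then c (s - length w) *\<^sub>C mact (word_mat n X w) h $ i else 0)" for w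
  proof -
    have "mact (word_mat (N * n) ?Y w) (weighted_copies N n c h) $ ?a
        = (\<Sum>b<N * n. word_mat (N * n) ?Y w $$ (?a, b) *\<^sub>C weighted_copies N n c h $ b)"
      using a by (simp add: index_mact Wd)
    also have "\<dots> = (\<Sum>b<N * n. (if s = b div n + length w then word_mat n X w $$ (i, b mod n) else 0) *\<^sub>C
            c (b div n) *\<^sub>C h $ (b mod n))"
      by (intro sum.cong refl)
        (simp add: word_mat_shift_tuple[OF X a, unfolded block_index[OF i]] weighted_copies_def)
    also have "\<dots> = (\<Sum>t<N. \<Sum>k<n. (if s = t + length w then word_mat n X w $$ (i, k) else 0) *\<^sub>C
            c t *\<^sub>C h $ k)"
      by (rule sum_blocks_div_mod)
    also have "\<dots> = (\<Sum>t<N. if t = s - length w then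
        (if length w \<le> s then \<Sum>k<n. word_mat n X w $$ (i, k) *\<^sub>C c t *\<^sub>C h $ k else 0) else 0)"
    proof -
      have "s = t + length w \<longleftrightarrow> length w \<le> s \<and> t = s - length w" for t by auto
      then show ?thesis by (intro sum.cong refl) auto
    qed
    also have "\<dots> = (if length w \<le> s then c (s - length w) *\<^sub>C mact (word_mat n X w) h $ i else 0)"
      using s i by (simp add: index_mact Wd scaleC_sum_right scaleC_scaleC mult.commute)
    finally show ?thesis .
  qed
  have "wsum (N * n) f ?Y {w. length w < N} (weighted_copies N n c h) $ ?a
      = (\<Sum>w | length w < N. if length w \<le> s then c (s - length w) *\<^sub>C f w (mact (word_mat n X w) h $ i) else 0)"
    using a by (auto simp: wsum_def act bounded_clinear_scaleC[OF f] bounded_clinear_zero[OF f] intro!: sum.cong)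
  also have "\<dots> = (\<Sum>w | length w \<le> s. c (s - length w) *\<^sub>C f w (mact (word_mat n X w) h $ i))"
    using s by (intro sum.mono_neutral_cong_right finite_words_less) auto
  finally show ?thesis using i by (simp add: toeplitz_row_def)
qed

text \<open>The bound at the nilpotent shifted tuple, read block by block. Weights concentrated at 0
  will bound single homogeneous parts; constant weights will bound the mean of the squared norms of
  the partial sums.\<close>

lemma toeplitz_bound:
  fixes K :: "nat \<Rightarrow> ('d::finite \<Rightarrow> complex mat) set" and f :: "'d list \<Rightarrow> 'u::chilbert_space \<Rightarrow> 'u"
  assumes K: "matrix_convex K" "circled K" and f: "\<And>w. bounded_clinear (f w)"
    and bound: "\<forall>n\<ge>1. \<forall>X\<in>K n. \<forall>N. nilpotent_order N n X \<longrightarrow> (\<forall>h\<in>carrier_vec n.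
      tensor_norm (wsum n f X {w. length w < N} h) \<le> C * tensor_norm h)"
    and n: "n \<ge> 1" and X: "X \<in> K n" and h: "h \<in> carrier_vec n" and N: "N \<ge> 1"
  shows "(\<Sum>s<N. (tensor_norm (toeplitz_row n f X c h s))\<^sup>2)
    \<le> C\<^sup>2 * (\<Sum>s<N. (cmod (c s))\<^sup>2) * (tensor_norm h)\<^sup>2"
proof -
  have XT: "X \<in> mat_tuples n" using K n X by (auto simp: matrix_convex_def)
  let ?H = "weighted_copies N n c h"
  let ?G = "wsum (N * n) f (shift_tuple N n X) {w. length w < N} ?H"
  have "vec n (\<lambda>i. ?G $ (s * n + i)) = toeplitz_row n f X c h s" if "s < N" for s
    using that wsum_shift_tuple[OF XT h f] by (intro eq_vecI) (auto simp: toeplitz_row_def)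
  then have "(\<Sum>s<N. (tensor_norm (toeplitz_row n f X c h s))\<^sup>2) = (tensor_norm ?G)\<^sup>2"
    by (subst tensor_norm_blocks[of _ N n]) auto
  also have "tensor_norm ?G \<le> C * tensor_norm ?H"
  proof -
    have "N * n \<ge> 1" using n N by simp
    moreover have "?H \<in> carrier_vec (N * n)" by (simp add: weighted_copies_def)
    ultimately show ?thesis
      using bound shift_tuple_mem[OF K n X N] nilpotent_order_shift_tuple[OF XT] by blast
  qed
  then have "(tensor_norm ?G)\<^sup>2 \<le> (C * tensor_norm ?H)\<^sup>2" by (intro power_mono) auto
  finally show ?thesis
    by (simp add: power_mult_distrib tensor_norm_weighted_copies[OF h] mult.assoc)
qed

section \<open>Convergence of the extension\<close>

lemma nc_partial_sum_eq:
  fixes f :: "'d::finite list \<Rightarrow> 'u::chilbert_space \<Rightarrow> 'u"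
  assumes f: "\<And>w. bounded_clinear (f w)" and X: "X \<in> mat_tuples n"
  shows "nc_partial_sum n f X N h = vec n (\<lambda>i. \<Sum>j<N. wsum n f X {w. length w = j} h $ i)"
    and "nc_partial_sum n f X N h = wsum n f X {w. length w < N} h"
proof -
  have Wd: "dim_row (word_mat n X w) = n" for w
    using carrier_matD[OF word_mat_carrier[OF X]] by simp
  show eq: "nc_partial_sum n f X N h = vec n (\<lambda>i. \<Sum>j<N. wsum n f X {w. length w = j} h $ i)"
    by (intro eq_vecI) (auto simp: nc_partial_sum_def wsum_def tensor_op_eq[OF f] Wd intro!: sum.cong)
  have fin: "finite {w :: 'd list. length w = j}" for j
    using finite_words_le[of j] by (rule finite_subset[rotated]) auto
  have "(\<Sum>j<N. \<Sum>w | length w = j. g w) = (\<Sum>w | length w < N. g w)" for g :: "'d list \<Rightarrow> 'u"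
  proof -
    have "(\<Sum>j<N. \<Sum>w | length w = j. g w) = sum g (\<Union>j<N. {w. length w = j})"
      using fin by (intro sum.UNION_disjoint[symmetric]) auto
    also have "(\<Union>j<N. {w :: 'd list. length w = j}) = {w. length w < N}" by auto
    finally show ?thesis .
  qed
  then show "nc_partial_sum n f X N h = wsum n f X {w. length w < N} h"
    unfolding eq by (intro eq_vecI) (auto simp: wsum_def)
qed

lemma wsum_add:
  assumes f: "\<And>w. w \<in> S \<Longrightarrow> bounded_clinear (f w)" and X: "X \<in> mat_tuples n"
    and h: "h \<in> carrier_vec n" "k \<in> carrier_vec n"
  shows "wsum n f X S (h + k) = wsum n f X S h + wsum n f X S k"
proof -
  note Wd = carrier_matD[OF word_mat_carrier[OF X]]
  show ?thesis
    using h by (intro eq_vecI)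
      (auto simp: wsum_def mact_add Wd bounded_clinear_add[OF f] sum.distrib[symmetric] intro!: sum.cong)
qed

lemma op_norm_leI:
  assumes "\<And>h. h \<in> carrier_vec n \<Longrightarrow> tensor_norm h \<le> 1 \<Longrightarrow> tensor_norm (T h) \<le> B"
  shows "op_norm n T \<le> ennreal B"
  unfolding op_norm_def using assms by (intro SUP_least ennreal_leI) auto

lemma op_norm_leD:
  fixes h :: "'u::chilbert_space vec"
  assumes le: "op_norm n T \<le> ennreal B" and B: "B \<ge> 0" and h: "h \<in> carrier_vec n"
    and scale: "\<And>c h. h \<in> carrier_vec n \<Longrightarrow> T (vscale c h) = vscale c (T h)"
  shows "tensor_norm (T h) \<le> B * tensor_norm h"
proof (cases "tensor_norm h = 0")
  case True
  then have "h = 0\<^sub>v n" using h by (simp add: tensor_norm_eq_0_iff)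
  then have "h = vscale 0 h" by (intro eq_vecI) auto
  then have "tensor_norm (T h) = tensor_norm (vscale 0 (T h))" using scale[OF h, of 0] by simp
  then show ?thesis by (simp add: tensor_norm_vscale True)
next
  case False
  then have pos: "tensor_norm h > 0" using tensor_norm_nonneg[of h] by linarith
  define k where "k = vscale (of_real (1 / tensor_norm h)) h"
  have k: "k \<in> carrier_vec n" using h by (simp add: k_def)
  have "tensor_norm k \<le> 1" using pos by (simp add: k_def tensor_norm_vscale norm_divide)
  then have "ennreal (tensor_norm (T k)) \<le> op_norm n T"
    unfolding op_norm_def using k by (intro SUP_upper) auto
  also note le
  finally have "tensor_norm (T k) \<le> B" using B by simp
  moreover have "tensor_norm (T k) = tensor_norm (T h) / tensor_norm h"
    using pos scale[OF h] by (simp add: k_def tensor_norm_vscale norm_divide)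
  ultimately show ?thesis using pos by (simp add: field_simps)
qed

lemma norm_index_le_tensor_norm: "i < dim_vec h \<Longrightarrow> norm (h $ i) \<le> tensor_norm h"
  unfolding tensor_norm_def by (intro member_le_L2_set) auto

lemma tensor_norm_le_sum: "tensor_norm h \<le> (\<Sum>i<dim_vec h. norm (h $ i))"
  unfolding tensor_norm_def by (intro L2_set_le_sum) auto

text \<open>Individual partial sums may exceed the wanted bound, but their limit cannot exceed a
  bound on all averages. If it did, all terms from some index on would exceed a \<open>d\<close>
  above \<open>b\<close>; the earlier ones are discarded by nonnegativity, and a long average
  exceeds \<open>b\<close>.\<close>

lemma cesaro_le:
  fixes a :: "nat \<Rightarrow> real"
  assumes lim: "a \<longlonglongrightarrow> l" and pos: "\<And>s. a s \<ge> 0"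
    and avg: "\<And>N. N \<ge> 1 \<Longrightarrow> (\<Sum>s<N. a s) \<le> real N * b"
  shows "l \<le> b"
proof (rule ccontr)
  assume "\<not> l \<le> b"
  define d where "d = (l + b) / 2"
  have d: "b < d" "d < l" using \<open>\<not> l \<le> b\<close> by (auto simp: d_def)
  obtain s0 where s0: "\<And>s. s \<ge> s0 \<Longrightarrow> d < a s"
    using order_tendstoD(1)[OF lim d(2)] unfolding eventually_sequentially by blast
  obtain M where M: "real s0 * d < real M * (d - b)"
    using reals_Archimedean3[of "d - b"] d by auto
  define N where "N = Suc (s0 + M)"
  have "b \<ge> 0" using avg[of 1] pos[of 0] by simp
  have "real (N - s0) * d = (\<Sum>s\<in>{s0..<N}. d)" by (simp add: N_def)
  also have "\<dots> \<le> (\<Sum>s\<in>{s0..<N}. a s)" using s0 by (intro sum_mono) (auto intro: less_imp_le)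
  also have "\<dots> \<le> (\<Sum>s<N. a s)" using pos by (intro sum_mono2) auto
  also have "\<dots> \<le> real N * b" by (intro avg) (simp add: N_def)
  finally have "real (N - s0) * d \<le> real N * b" .
  then have "real N * (d - b) \<le> real s0 * d" by (simp add: N_def algebra_simps)
  moreover have "real M * (d - b) \<le> real N * (d - b)"
    using d by (intro mult_right_mono) (auto simp: N_def)
  ultimately show False using M by linarith
qed

lemma bounded_linear_scaleC: "bounded_linear (\<lambda>x :: 'u::chilbert_space. c *\<^sub>C x)"
  by (intro bounded_linear_intro[where K = "cmod c"])
    (auto simp: scaleC_add_right scaleR_scaleC scaleC_scaleC norm_scaleC mult.commute)

text \<open>Openness leaves room to enlarge \<open>X\<close> slightly within \<open>K\<close>. A
  homogeneous part of degree j at \<open>X\<close> is \<open>t ^ j\<close> times the one at the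
  enlarged tuple, which is the source of geometric convergence.\<close>

lemma open_scale_up:
  fixes K :: "nat \<Rightarrow> ('d::finite \<Rightarrow> complex mat) set"
  assumes K: "matrix_convex K" and op: "nc_open K" and n: "n \<ge> 1" and X: "X \<in> K n"
  obtains t :: real where "0 < t" "t < 1" "(\<lambda>j. complex_of_real (1 / t) \<cdot>\<^sub>m X j) \<in> K n"
proof -
  have XT: "X \<in> mat_tuples n" using K n X by (auto simp: matrix_convex_def)
  note d = carrier_matD[OF mat_tuplesD[OF XT]]
  have "\<exists>\<epsilon>>0. \<forall>Y\<in>mat_tuples n.
      (\<forall>j. \<forall>i<n. \<forall>k<n. cmod (Y j $$ (i, k) - X j $$ (i, k)) < \<epsilon>) \<longrightarrow> Y \<in> K n"
    using op n X unfolding nc_open_def by simp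
  then obtain \<epsilon> where \<epsilon>: "\<epsilon> > 0" "\<forall>Y\<in>mat_tuples n.
      (\<forall>j. \<forall>i<n. \<forall>k<n. cmod (Y j $$ (i, k) - X j $$ (i, k)) < \<epsilon>) \<longrightarrow> Y \<in> K n"
    by (elim exE conjE)
  define B where "B = (\<Sum>j\<in>UNIV. \<Sum>i<n. \<Sum>k<n. cmod (X j $$ (i, k)))"
  have B: "cmod (X j $$ (i, k)) \<le> B" if "i < n" "k < n" for j i k
  proof -
    have "cmod (X j $$ (i, k)) \<le> (\<Sum>k<n. cmod (X j $$ (i, k)))"
      using that by (intro member_le_sum) auto
    also have "\<dots> \<le> (\<Sum>i<n. \<Sum>k<n. cmod (X j $$ (i, k)))"
      using that by (intro member_le_sum[of i "{..<n}" "\<lambda>i. \<Sum>k<n. cmod (X j $$ (i, k))"] sum_nonneg) auto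
    also have "\<dots> \<le> B"
      unfolding B_def
      by (intro member_le_sum[of j UNIV "\<lambda>j. \<Sum>i<n. \<Sum>k<n. cmod (X j $$ (i, k))"] sum_nonneg) auto
    finally show ?thesis .
  qed
  have B0: "B \<ge> 0" unfolding B_def by (intro sum_nonneg) auto
  \<comment> \<open>\<open>B\<close> dominates every entry of the tuple; the added one keeps the
    quotient meaningful for the zero tuple and makes the estimate strict.\<close>
  define \<delta> where "\<delta> = \<epsilon> / (B + 1)"
  have \<delta>: "\<delta> > 0" using \<epsilon>(1) B0 by (simp add: \<delta>_def)
  define t where "t = 1 / (1 + \<delta>)"
  have t: "0 < t" "t < 1" "1 / t = 1 + \<delta>" using \<delta> by (auto simp: t_def)
  have "(\<lambda>j. complex_of_real (1 / t) \<cdot>\<^sub>m X j) \<in> K n"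
  proof (rule bspec[OF \<epsilon>(2), THEN mp])
    show "(\<lambda>j. complex_of_real (1 / t) \<cdot>\<^sub>m X j) \<in> mat_tuples n"
      using XT by (simp add: mat_tuples_def)
    show "\<forall>j. \<forall>i<n. \<forall>k<n. cmod ((complex_of_real (1 / t) \<cdot>\<^sub>m X j) $$ (i, k) - X j $$ (i, k)) < \<epsilon>"
    proof (intro allI impI)
      fix j i k assume ik: "i < n" "k < n"
      have "(complex_of_real (1 / t) \<cdot>\<^sub>m X j) $$ (i, k) - X j $$ (i, k) = of_real \<delta> * X j $$ (i, k)"
        using ik d by (simp only: index_smult_mat t(3)) (simp add: algebra_simps)
      then have "cmod ((complex_of_real (1 / t) \<cdot>\<^sub>m X j) $$ (i, k) - X j $$ (i, k)) = \<delta> * cmod (X j $$ (i, k))"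
        using \<delta> by (simp only: norm_mult norm_of_real abs_of_pos)
      also have "\<dots> \<le> \<delta> * B" using \<delta> B[OF ik] by (intro mult_left_mono) auto
      also have "\<dots> < \<delta> * (B + 1)" using \<delta> by simp
      also have "\<dots> = \<epsilon>" using B0 by (simp add: \<delta>_def)
      finally show "cmod ((complex_of_real (1 / t) \<cdot>\<^sub>m X j) $$ (i, k) - X j $$ (i, k)) < \<epsilon>" .
    qed
  qed
  with t(1,2) show thesis by (rule that)
qed

lemma word_mat_smult:
  assumes X: "X \<in> mat_tuples n"
  shows "word_mat n (\<lambda>j. a \<cdot>\<^sub>m X j) w = a ^ length w \<cdot>\<^sub>m word_mat n X w"
proof (induction w)
  case (Cons j w)
  have "word_mat n (\<lambda>j. a \<cdot>\<^sub>m X j) (j # w) = (a \<cdot>\<^sub>m X j) * (a ^ length w \<cdot>\<^sub>m word_mat n X w)"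
    by (simp add: Cons)
  also have "\<dots> = a ^ length (j # w) \<cdot>\<^sub>m word_mat n X (j # w)"
    using mat_tuplesD[OF X, of j] word_mat_carrier[OF X, of w]
    by (intro eq_matI) (auto simp: scalar_prod_def sum_distrib_left mult_ac)
  finally show ?case .
qed (auto intro!: eq_matI)

text \<open>Homogeneous parts are bounded by \<open>C\<close> at an enlarged tuple, hence decay like
  \<open>t ^ j\<close> at \<open>X\<close>, and the series converges. Summing these estimates would
  give only \<open>C / (1 - t)\<close>; the sharp constant comes from the averages of the partial
  sums.\<close>

lemma nc_sums_of_nilpotent_bound:
  fixes K :: "nat \<Rightarrow> ('d::finite \<Rightarrow> complex mat) set" and f :: "'d list \<Rightarrow> 'u::chilbert_space \<Rightarrow> 'u"
  assumes K: "matrix_convex K" "circled K" and op: "nc_open K" and C: "C \<ge> 0"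
    and f: "\<And>w. bounded_clinear (f w)"
    and bound: "\<forall>n\<ge>1. \<forall>X\<in>K n. \<forall>N. nilpotent_order N n X \<longrightarrow> (\<forall>h\<in>carrier_vec n.
      tensor_norm (wsum n f X {w. length w < N} h) \<le> C * tensor_norm h)"
    and n: "n \<ge> 1" and X: "X \<in> K n"
  obtains L where "nc_sums n f X L" "op_norm n L \<le> ennreal C"
proof -
  have XT: "X \<in> mat_tuples n" using K n X by (auto simp: matrix_convex_def)
  define F where "F Y j h = wsum n f Y {w. length w = j} h" for Y j and h :: "'u vec"
  have hom: "tensor_norm (F Y j h) \<le> C * tensor_norm h" if Y: "Y \<in> K n" and h: "h \<in> carrier_vec n" for Y j h
  proof -
    \<comment> \<open>Unit mass at block zero: row \<open>j\<close> of the convolution is then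
      exactly the homogeneous part of degree \<open>j\<close>.\<close>
    let ?c = "\<lambda>s. if s = 0 then 1 else 0 :: complex"
    have "toeplitz_row n f Y ?c h j = F Y j h"
    proof (rule eq_vecI)
      fix i assume "i < dim_vec (F Y j h)"
      then have i: "i < n" by (simp add: F_def)
      have "(\<Sum>w | length w \<le> j. ?c (j - length w) *\<^sub>C f w (mact (word_mat n Y w) h $ i))
          = (\<Sum>w | length w = j. f w (mact (word_mat n Y w) h $ i))"
        by (intro sum.mono_neutral_cong_right finite_words_le) (auto simp: scaleC_one)
      then show "toeplitz_row n f Y ?c h j $ i = F Y j h $ i"
        using i by (simp add: toeplitz_row_def F_def wsum_def)
    qed (simp add: F_def toeplitz_row_def)
    then have "(tensor_norm (F Y j h))\<^sup>2 = (tensor_norm (toeplitz_row n f Y ?c h j))\<^sup>2" by simp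
    also have "\<dots> \<le> (\<Sum>s<Suc j. (tensor_norm (toeplitz_row n f Y ?c h s))\<^sup>2)"
      by (intro member_le_sum[of j "{..<Suc j}" "\<lambda>s. (tensor_norm (toeplitz_row n f Y ?c h s))\<^sup>2"]) auto
    also have "\<dots> \<le> C\<^sup>2 * (\<Sum>s<Suc j. (cmod (?c s))\<^sup>2) * (tensor_norm h)\<^sup>2"
      by (intro toeplitz_bound[OF K f bound n Y h]) simp
    also have "(\<Sum>s<Suc j. (cmod (?c s))\<^sup>2) = (\<Sum>s<Suc j. if s = 0 then 1 else 0)"
      by (intro sum.cong) auto
    also have "\<dots> = (1 :: real)" by (simp del: sum.lessThan_Suc)
    finally have "(tensor_norm (F Y j h))\<^sup>2 \<le> (C * tensor_norm h)\<^sup>2"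
      by (simp add: power_mult_distrib)
    then show ?thesis by (rule power2_le_imp_le) (use C in simp)
  qed
  obtain t where t: "0 < t" "t < 1" and Xt: "(\<lambda>j. complex_of_real (1 / t) \<cdot>\<^sub>m X j) \<in> K n"
    by (rule open_scale_up[OF K(1) op n X])
  have decay: "tensor_norm (F X j h) \<le> C * tensor_norm h * t ^ j" if h: "h \<in> carrier_vec n" for j h
  proof -
    have "F (\<lambda>j. complex_of_real (1 / t) \<cdot>\<^sub>m X j) j h = vscale (of_real (1 / t) ^ j) (F X j h)"
    proof (rule eq_vecI)
      fix i assume "i < dim_vec (vscale (of_real (1 / t) ^ j) (F X j h))"
      then have i: "i < n" by (simp add: F_def)
      have "mact (a \<cdot>\<^sub>m word_mat n X w) h $ i = a *\<^sub>C mact (word_mat n X w) h $ i" for a w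
        using i carrier_matD[OF word_mat_carrier[OF XT]]
        by (simp add: index_mact scaleC_sum_right scaleC_scaleC)
      then show "F (\<lambda>j. complex_of_real (1 / t) \<cdot>\<^sub>m X j) j h $ i = vscale (of_real (1 / t) ^ j) (F X j h) $ i"
        using i by (simp add: F_def wsum_def word_mat_smult[OF XT] bounded_clinear_scaleC[OF f]
            scaleC_sum_right del: of_real_divide)
    qed (simp add: F_def)
    then have "(1 / t) ^ j * tensor_norm (F X j h) \<le> C * tensor_norm h"
      using hom[OF Xt h, of j] t by (simp add: tensor_norm_vscale norm_power norm_divide)
    then show ?thesis using t by (simp add: field_simps)
  qed
  have entry: "norm (F X j h $ i) \<le> C * tensor_norm h * t ^ j" if "h \<in> carrier_vec n" "i < n" for j h i
    using norm_index_le_tensor_norm[of i "F X j h"] decay[OF that(1), of j] that(2) by (simp add: F_def)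
  have geo: "summable (\<lambda>j. B * t ^ j)" for B :: real
    using t by (intro summable_mult summable_geometric) simp
  have summ: "summable (\<lambda>j. norm (F X j h $ i))" if "h \<in> carrier_vec n" "i < n" for h i
    using entry[OF that] by (intro summable_comparison_test'[OF geo[of "C * tensor_norm h"], of 0]) auto
  \<comment> \<open>The restriction fixes the value outside the carrier, as
    \<open>bounded_tensor_op\<close> demands; this makes the sum of a series unique as a
    function.\<close>
  define L where "L = restrict (\<lambda>h. vec n (\<lambda>i. \<Sum>j. F X j h $ i)) (carrier_vec n)"
  let ?P = "nc_partial_sum n f X"
  have P: "?P N h = vec n (\<lambda>i. \<Sum>j<N. F X j h $ i)" for N h
    unfolding F_def by (rule nc_partial_sum_eq(1)[OF f XT])
  have L: "L h \<in> carrier_vec n" if "h \<in> carrier_vec n" for h using that by (simp add: L_def)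
  have lim: "(\<lambda>N. ?P N h $ i) \<longlonglongrightarrow> L h $ i" if "h \<in> carrier_vec n" "i < n" for h i
    using summable_LIMSEQ[OF summable_norm_cancel[OF summ[OF that]]] that by (simp add: L_def P)
  \<comment> \<open>The factor \<open>real n\<close> comes from replacing the tensor norm by the sum
    of the entry norms. It is harmless, since only convergence to zero is wanted and the estimate is
    uniform on the unit ball.\<close>
  have tail: "tensor_norm (?P N h - L h) \<le> real n * (C * t ^ N / (1 - t))"
    if h: "h \<in> carrier_vec n" "tensor_norm h \<le> 1" for N h
  proof -
    have "norm ((?P N h - L h) $ i) \<le> C * t ^ N / (1 - t)" if i: "i < n" for i
    proof -
      note s = summ[OF h(1) i]
      have "(\<Sum>j. F X (j + N) h $ i) = L h $ i - ?P N h $ i"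
        using suminf_minus_initial_segment[OF summable_norm_cancel[OF s], of N] i h by (simp add: L_def P)
      then have "norm ((?P N h - L h) $ i) = norm (\<Sum>j. F X (j + N) h $ i)"
        using i L[OF h(1)] by (simp add: norm_minus_commute)
      also have "\<dots> \<le> (\<Sum>j. norm (F X (j + N) h $ i))"
        by (intro summable_norm summable_ignore_initial_segment s)
      also have "\<dots> \<le> (\<Sum>j. C * t ^ N * t ^ j)"
      proof (intro suminf_le summable_ignore_initial_segment s geo)
        fix j
        have "C * tensor_norm h * t ^ (j + N) \<le> C * 1 * t ^ (j + N)"
          using C h(2) t by (intro mult_right_mono mult_left_mono) auto
        then show "norm (F X (j + N) h $ i) \<le> C * t ^ N * t ^ j"
          using entry[OF h(1) i, of "j + N"] by (simp add: power_add mult_ac)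
      qed
      also have "\<dots> = C * t ^ N / (1 - t)"
        using t by (simp add: suminf_mult suminf_geometric summable_geometric)
      finally show ?thesis .
    qed
    then have "(\<Sum>i<n. norm ((?P N h - L h) $ i)) \<le> (\<Sum>i<n. C * t ^ N / (1 - t))"
      by (intro sum_mono) auto
    moreover have "dim_vec (?P N h - L h) = n" using L[OF h(1)] by simp
    ultimately show ?thesis using tensor_norm_le_sum[of "?P N h - L h"] by simp
  qed
  have conv: "(\<lambda>N. op_norm n (\<lambda>h. ?P N h - L h)) \<longlonglongrightarrow> 0"
  proof -
    have "(\<lambda>N. real n * (C * t ^ N / (1 - t))) \<longlonglongrightarrow> real n * (C * 0 / (1 - t))"
      using t by (intro tendsto_intros LIMSEQ_power_zero) auto
    then have upper: "(\<lambda>N. ennreal (real n * (C * t ^ N / (1 - t)))) \<longlonglongrightarrow> 0"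
      using tendsto_ennrealI by fastforce
    have "op_norm n (\<lambda>h. ?P N h - L h) \<le> ennreal (real n * (C * t ^ N / (1 - t)))" for N
      using tail by (rule op_norm_leI)
    then show ?thesis
      by (intro tendsto_sandwich[OF always_eventually always_eventually tendsto_const upper] allI zero_le)
  qed
  have Lbound: "tensor_norm (L h) \<le> C * tensor_norm h" if h: "h \<in> carrier_vec n" for h
  proof -
    \<comment> \<open>Row \<open>s\<close> contains the words of length at most \<open>s\<close>,
      the partial sum \<open>N\<close> those of length below \<open>N\<close>, hence the successor.
      The averages are taken of squared norms, because the Toeplitz bound controls exactly
      these.\<close>
    have row: "toeplitz_row n f X (\<lambda>_. 1) h s = ?P (Suc s) h" for s
      unfolding nc_partial_sum_eq(2)[OF f XT]
      by (intro eq_vecI) (auto simp: toeplitz_row_def wsum_def scaleC_one less_Suc_eq_le)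
    have "(\<lambda>s. (tensor_norm (?P s h))\<^sup>2) \<longlonglongrightarrow> (tensor_norm (L h))\<^sup>2"
      unfolding tensor_norm_square carrier_vecD[OF L[OF h]]
      using lim[OF h] by (auto simp: nc_partial_sum_def intro!: tendsto_intros)
    then have "(\<lambda>s. (tensor_norm (?P (Suc s) h))\<^sup>2) \<longlonglongrightarrow> (tensor_norm (L h))\<^sup>2"
      by (rule LIMSEQ_Suc)
    then have "(tensor_norm (L h))\<^sup>2 \<le> (C * tensor_norm h)\<^sup>2"
    proof (rule cesaro_le)
      fix N :: nat assume "N \<ge> 1"
      from toeplitz_bound[OF K f bound n X h this, of "\<lambda>_. 1"]
      show "(\<Sum>s<N. (tensor_norm (?P (Suc s) h))\<^sup>2) \<le> real N * (C * tensor_norm h)\<^sup>2"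
        by (simp add: row power_mult_distrib mult_ac)
    qed simp
    then show ?thesis by (rule power2_le_imp_le) (use C in simp)
  qed
  have Lop: "op_norm n L \<le> ennreal C"
  proof (rule op_norm_leI)
    fix h :: "'u vec" assume h: "h \<in> carrier_vec n" "tensor_norm h \<le> 1"
    have "C * tensor_norm h \<le> C * 1" using C h(2) by (intro mult_left_mono)
    then show "tensor_norm (L h) \<le> C" using Lbound[OF h(1)] by simp
  qed
  have Ladd: "L (h + k) = L h + L k" if h: "h \<in> carrier_vec n" and k: "k \<in> carrier_vec n" for h k
  proof (rule eq_vecI)
    fix i assume "i < dim_vec (L h + L k)"
    then have i: "i < n" using L[OF k] by simp
    have "(\<lambda>N. ?P N h $ i + ?P N k $ i) \<longlonglongrightarrow> L h $ i + L k $ i"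
      by (intro tendsto_add lim h k i)
    moreover have "?P N (h + k) $ i = ?P N h $ i + ?P N k $ i" for N
      unfolding nc_partial_sum_eq(2)[OF f XT] using i by (simp add: wsum_add[OF f XT h k])
    ultimately have "(\<lambda>N. ?P N (h + k) $ i) \<longlonglongrightarrow> L h $ i + L k $ i" by simp
    then show "L (h + k) $ i = (L h + L k) $ i"
      using LIMSEQ_unique[OF lim[OF add_carrier_vec[OF h k] i]] i L[OF k] by simp
  qed (simp add: carrier_vecD[OF L[OF add_carrier_vec[OF h k]]] carrier_vecD[OF L[OF k]])
  have Lscale: "L (vscale c h) = vscale c (L h)" if h: "h \<in> carrier_vec n" for c h
  proof (rule eq_vecI)
    fix i assume "i < dim_vec (vscale c (L h))"
    then have i: "i < n" using L[OF h] by simp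
    have "(\<lambda>N. c *\<^sub>C ?P N h $ i) \<longlonglongrightarrow> c *\<^sub>C L h $ i"
      by (intro bounded_linear.tendsto[OF bounded_linear_scaleC] lim h i)
    moreover have "?P N (vscale c h) $ i = c *\<^sub>C ?P N h $ i" for N
      unfolding nc_partial_sum_eq(2)[OF f XT] using i by (simp add: wsum_vscale[OF XT h f])
    ultimately have "(\<lambda>N. ?P N (vscale c h) $ i) \<longlonglongrightarrow> c *\<^sub>C L h $ i" by simp
    then show "L (vscale c h) $ i = vscale c (L h) $ i"
      using LIMSEQ_unique[OF lim[OF vscale_carrier[OF h] i]] i L[OF h] by simp
  qed (simp add: carrier_vecD[OF L[OF vscale_carrier[OF h]]] carrier_vecD[OF L[OF h]])
  have "bounded_tensor_op n L"
    unfolding bounded_tensor_op_def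
  proof (intro conjI ballI allI)
    show "L \<in> carrier_vec n \<rightarrow>\<^sub>E carrier_vec n" by (auto simp: L_def)
    show "op_norm n L < \<infinity>" using Lop by (rule le_less_trans) simp
  qed (auto simp: Ladd Lscale[unfolded vscale_def])
  then have "nc_sums n f X L" using conv by (simp add: nc_sums_def)
  then show thesis using Lop by (rule that)
qed

section \<open>Evaluating the prescribed polynomial\<close>

lemma nc_poly_bounded_clinear:
  "(\<And>w. w \<in> \<Lambda> \<Longrightarrow> bounded_clinear (p w)) \<Longrightarrow> bounded_clinear (nc_poly \<Lambda> p w)"
  by (auto simp: nc_poly_def bounded_clinear_def)

text \<open>The partial sums are constant once they have passed the longest word of the finite
  segment. What remains is that the limit has finite operator norm, for which a crude bound through
  the entries of the word matrices suffices.\<close>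

lemma nc_sums_poly:
  fixes p :: "'d::finite list \<Rightarrow> 'u::chilbert_space \<Rightarrow> 'u"
  assumes fin: "finite \<Lambda>" and p: "\<And>w. w \<in> \<Lambda> \<Longrightarrow> bounded_clinear (p w)" and X: "X \<in> mat_tuples n"
  shows "nc_sums n (nc_poly \<Lambda> p) X (restrict (wsum n p X \<Lambda>) (carrier_vec n))"
proof -
  let ?L = "restrict (wsum n p X \<Lambda>) (carrier_vec n)"
  have q: "bounded_clinear (nc_poly \<Lambda> p w)" for w
    using p by (rule nc_poly_bounded_clinear)
  note Wd = carrier_matD[OF word_mat_carrier[OF X]]
  obtain M where M: "\<And>w. w \<in> \<Lambda> \<Longrightarrow> length w < M"
    using finite_nat_set_iff_bounded[of "length ` \<Lambda>"] fin by auto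
  have P: "nc_partial_sum n (nc_poly \<Lambda> p) X N h = wsum n p X \<Lambda> h" if "N \<ge> M" for N h
  proof -
    have "(\<Sum>w | length w < N. nc_poly \<Lambda> p w (g w)) = (\<Sum>w\<in>\<Lambda>. p w (g w))" for g
      using M that by (intro sum.mono_neutral_cong_right finite_words_less)
        (auto simp: nc_poly_def intro: less_le_trans)
    then show ?thesis unfolding nc_partial_sum_eq(2)[of "nc_poly \<Lambda> p", OF q X] by (simp add: wsum_def)
  qed
  have "\<forall>w\<in>\<Lambda>. \<exists>B\<ge>0. \<forall>y. norm (p w y) \<le> norm y * B"
    using p unfolding bounded_clinear_def by (metis bounded_linear.nonneg_bounded)
  then obtain B where B: "\<And>w. w \<in> \<Lambda> \<Longrightarrow> 0 \<le> B w" "\<And>w y. w \<in> \<Lambda> \<Longrightarrow> norm (p w y) \<le> norm y * B w"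
    by metis
  define D where "D = (\<Sum>i<n. \<Sum>w\<in>\<Lambda>. (\<Sum>k<n. cmod (word_mat n X w $$ (i, k))) * B w)"
  have "tensor_norm (wsum n p X \<Lambda> h) \<le> D" if h: "h \<in> carrier_vec n" "tensor_norm h \<le> 1" for h
  proof -
    have "norm (wsum n p X \<Lambda> h $ i) \<le> (\<Sum>w\<in>\<Lambda>. (\<Sum>k<n. cmod (word_mat n X w $$ (i, k))) * B w)" if i: "i < n" for i
    proof -
      have "norm (mact (word_mat n X w) h $ i) \<le> (\<Sum>k<n. cmod (word_mat n X w $$ (i, k)))" for w
      proof -
        have "norm (mact (word_mat n X w) h $ i) \<le> (\<Sum>k<n. norm (word_mat n X w $$ (i, k) *\<^sub>C h $ k))"
          using i Wd by (simp add: index_mact norm_sum)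
        also have "\<dots> \<le> (\<Sum>k<n. cmod (word_mat n X w $$ (i, k)))"
        proof (rule sum_mono)
          fix k assume "k \<in> {..<n}"
          then have "norm (h $ k) \<le> 1"
            using norm_index_le_tensor_norm[of k h] h by simp
          then show "norm (word_mat n X w $$ (i, k) *\<^sub>C h $ k) \<le> cmod (word_mat n X w $$ (i, k))"
            by (simp add: norm_scaleC mult_left_le)
        qed
        finally show ?thesis .
      qed
      then have "norm (p w (mact (word_mat n X w) h $ i)) \<le> (\<Sum>k<n. cmod (word_mat n X w $$ (i, k))) * B w"
        if "w \<in> \<Lambda>" for w
        using B(2)[OF that] B(1)[OF that] by (meson mult_right_mono order_trans)
      then have "(\<Sum>w\<in>\<Lambda>. norm (p w (mact (word_mat n X w) h $ i)))
          \<le> (\<Sum>w\<in>\<Lambda>. (\<Sum>k<n. cmod (word_mat n X w $$ (i, k))) * B w)"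
        by (rule sum_mono)
      then show ?thesis using i norm_sum order_trans by (fastforce simp: wsum_def)
    qed
    then have "(\<Sum>i<n. norm (wsum n p X \<Lambda> h $ i)) \<le> D"
      unfolding D_def by (intro sum_mono) auto
    then show ?thesis using tensor_norm_le_sum[of "wsum n p X \<Lambda> h"] by simp
  qed
  then have "op_norm n ?L \<le> ennreal D" by (intro op_norm_leI) auto
  then have fin_norm: "op_norm n ?L < \<infinity>" by (rule le_less_trans) simp
  have "bounded_tensor_op n ?L"
    unfolding bounded_tensor_op_def vscale_def[symmetric]
    using fin_norm by (auto simp: wsum_add[OF p X] wsum_vscale[OF X _ p])
  moreover have "(\<lambda>N. op_norm n (\<lambda>h. nc_partial_sum n (nc_poly \<Lambda> p) X N h - ?L h)) \<longlonglongrightarrow> 0"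
  proof (rule tendsto_eventually, unfold eventually_sequentially, intro exI allI impI)
    fix N assume N: "N \<ge> M"
    have "op_norm n (\<lambda>h. nc_partial_sum n (nc_poly \<Lambda> p) X N h - ?L h) \<le> ennreal 0"
      by (rule op_norm_leI) (simp add: P[OF N] minus_cancel_vec[OF wsum_carrier] tensor_norm_eq_0_iff
          eq_refl)
    then show "op_norm n (\<lambda>h. nc_partial_sum n (nc_poly \<Lambda> p) X N h - ?L h) = 0" by simp
  qed
  ultimately show ?thesis by (simp add: nc_sums_def)
qed

theorem theorem5:
  fixes K :: "nat \<Rightarrow> ('d::finite \<Rightarrow> complex mat) set"
    and \<Lambda> :: "'d list set"
    and p :: "'d list \<Rightarrow> 'u::chilbert_space \<Rightarrow> 'u"
  assumes "matrix_convex K" and "nc_open K" and "nc_bounded K" and "circled K"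
    and "contains_nc_nbhd_0 K"
    and "finite \<Lambda>" and "initial_segment \<Lambda>"
    and separable: "\<exists>D :: 'u set. countable D \<and> closure D = UNIV"
    and "\<And>w. w \<in> \<Lambda> \<Longrightarrow> bounded_clinear (p w)"
  shows "\<exists>x :: 'd list \<Rightarrow> 'u \<Rightarrow> 'u.
    (\<forall>w. bounded_clinear (x w)) \<and>
    (\<forall>w \<in> \<Lambda>. x w = p w) \<and>
    (\<forall>n\<ge>1. \<forall>X \<in> K n. nc_convergent n x X) \<and>
    nc_norm K x =
      Sup {op_norm n (nc_eval n (nc_poly \<Lambda> p) X) | n X. n \<ge> 1 \<and> X \<in> K n \<and> nc_nilpotent \<Lambda> n X}"
proof -
  let ?S = "{op_norm n (nc_eval n (nc_poly \<Lambda> p) X) | n X. n \<ge> 1 \<and> X \<in> K n \<and> nc_nilpotent \<Lambda> n X}"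
  note K = assms(1) and p = assms(9)
  have XT: "X \<in> mat_tuples n" if "n \<ge> 1" "X \<in> K n" for n X
    using K that by (auto simp: matrix_convex_def)
  have poly: "nc_sums n (nc_poly \<Lambda> p) X (restrict (wsum n p X \<Lambda>) (carrier_vec n))"
    if "n \<ge> 1" "X \<in> K n" for n X
    by (rule nc_sums_poly[OF assms(6) p XT[OF that]])
  \<comment> \<open>At a nilpotent tuple of the segment the words outside it contribute zero
    matrices, so every extension has the same value there as the polynomial. No extension can
    therefore have a smaller norm.\<close>
  have lower: "Sup ?S \<le> nc_norm K x" if x: "\<forall>w\<in>\<Lambda>. x w = p w" for x
    unfolding nc_norm_def
  proof (rule Sup_mono, safe)
    fix n X assume n: "n \<ge> 1" and X: "X \<in> K n" and nil: "nc_nilpotent \<Lambda> n X"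
    have "tensor_op (x w) (word_mat n X w) h = tensor_op (nc_poly \<Lambda> p w) (word_mat n X w) h" for w h
      using x nil by (cases "w \<in> \<Lambda>")
        (auto simp: nc_poly_def nc_nilpotent_def tensor_op_def intro!: eq_vecI)
    then have "nc_eval n x X = nc_eval n (nc_poly \<Lambda> p) X"
      unfolding nc_eval_def nc_sums_def nc_partial_sum_def by simp
    then have "op_norm n (nc_eval n (nc_poly \<Lambda> p) X) = op_norm n (nc_eval n x X)" by simp
    then show "\<exists>b\<in>{op_norm n (nc_eval n x X) |n X. 1 \<le> n \<and> X \<in> K n}.
        op_norm n (nc_eval n (nc_poly \<Lambda> p) X) \<le> b"
      using n X by auto
  qed
  show ?thesis
  proof (cases "Sup ?S = \<infinity>")
    case True
    \<comment> \<open>With an infinite supremum the lower bound alone gives equality, and the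
      polynomial itself converges everywhere because it is a finite sum.\<close>
    have "nc_norm K (nc_poly \<Lambda> p) = \<infinity>"
      using lower[of "nc_poly \<Lambda> p"] unfolding True by (simp add: nc_poly_def top_unique)
    then have "nc_norm K (nc_poly \<Lambda> p) = Sup ?S" unfolding True .
    moreover have "bounded_clinear (nc_poly \<Lambda> p w)" for w
      using p by (rule nc_poly_bounded_clinear)
    moreover have "nc_poly \<Lambda> p w = p w" if "w \<in> \<Lambda>" for w
      using that by (simp add: nc_poly_def)
    moreover have "nc_convergent n (nc_poly \<Lambda> p) X" if "n \<ge> 1" "X \<in> K n" for n X
      using poly[OF that] unfolding nc_convergent_def by blast
    ultimately show ?thesis by blast
  next
    case False
    have "\<exists>C\<ge>0. s = ennreal C" if "s \<noteq> \<infinity>" for s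
      using that by (cases s) auto
    from this[OF False] obtain C where C: "C \<ge> 0" "Sup ?S = ennreal C" by (elim exE conjE)
    have bound: "tensor_norm (wsum n p X \<Lambda> h) \<le> C * tensor_norm h"
      if n: "n \<ge> 1" and X: "X \<in> K n" and nil: "nc_nilpotent \<Lambda> n X" and h: "h \<in> carrier_vec n" for n X h
    proof -
      let ?L = "restrict (wsum n p X \<Lambda>) (carrier_vec n)"
      have "op_norm n (nc_eval n (nc_poly \<Lambda> p) X) \<in> ?S" using n X nil by blast
      then have "op_norm n ?L \<le> Sup ?S"
        unfolding nc_eval_eq[OF poly[OF n X]] by (rule Sup_upper)
      then have "tensor_norm (?L h) \<le> C * tensor_norm h"
        unfolding C(2) by (rule op_norm_leD[where T = ?L, OF _ C(1) h])
          (simp add: wsum_vscale[OF XT[OF n X] _ p])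
      then show ?thesis using h by simp
    qed
    obtain x where x: "\<forall>w. bounded_clinear (x w)" "\<forall>w\<in>\<Lambda>. x w = p w"
      and xb: "\<forall>n\<ge>1. \<forall>X\<in>K n. \<forall>N. nilpotent_order N n X \<longrightarrow> (\<forall>h\<in>carrier_vec n.
        tensor_norm (wsum n x X {w. length w < N} h) \<le> C * tensor_norm h)"
      by (rule nilpotent_extension[OF K assms(5,6,7) p C(1) bound])
    have ev: "nc_convergent n x X \<and> op_norm n (nc_eval n x X) \<le> ennreal C"
      if n: "n \<ge> 1" and X: "X \<in> K n" for n X
    proof -
      obtain L where "nc_sums n x X L" "op_norm n L \<le> ennreal C"
        by (rule nc_sums_of_nilpotent_bound[OF K assms(4,2) C(1) spec[OF x(1)] xb n X])
      then show ?thesis using nc_eval_eq by (auto simp: nc_convergent_def)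
    qed
    have "nc_norm K x \<le> Sup ?S"
      unfolding C(2) nc_norm_def using ev by (intro Sup_least) auto
    with lower[OF x(2)] have "nc_norm K x = Sup ?S" by (rule antisym[rotated])
    then show ?thesis using x ev by blast
  qed
qed

end
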